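(* Let $f:\mathbb{R}^{n}\to\mathbb{R}$ be a nonnegative strictly convex function. For a nonzero real number $\alpha$ with $\alpha\neq 1$, let $g$ be the function defined by $g(x,z)=z^{\alpha}+f(x)$, $x=(x_1,\dots,x_n)$. Suppose that the level hypersurfaces $M_k=g^{-1}(k)$ ($k\in S_g$) of $g$ in the $(n+1)$-dimensional Euclidean space $\mathbb{E}^{n+1}$ are strictly convex. Then the following are equivalent. 1) (Condition $(V^* )$) For $k\in S_g$ with $k+h\in I_k$, $V_p^*(k,h)$ with $p\in M_k$ is a nonnegative function $\phi_k(h)$ which depends only on $k$ and $h$ (not on $p$). 2) (Condition $(A^* )$) For $k\in S_g$ with $k+h\in I_k$, $A_p^*(k,h)/|\nabla g(p)|$ with $p\in M_k$ is a nonnegative function $\psi_k(h)$ which depends only on $k$ and $h$ (not on $p$). 3) For each $k\in S_g$, $K(p)|\nabla g(p)|^{n+2}=c(k)$ is constant on $M_k$, where $K(p)$ denotes the Gauss-Kronecker curvature of $M_k$ at $p\in M_k$ with respect to the unit normal pointing to the convex side. 4) The function $g$ is given by $$g(x,z)=z^2+a_1^2x_1^2+\cdots+a_n^2x_n^2,$$ where $a_i>0$, $i=1,2,\dots,n$. In this case, $R_g=S_g=(0,\infty)$ and $I_k=(0,k)$ for $k\in S_g$.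
   Context: All objects are smooth and connected unless otherwise mentioned. A convex hypersurface of $\mathbb{R}^{n+1}$ is called strictly convex if it has positive normal curvatures with respect to the unit normal $N$ pointing to the convex side (in particular its Gauss-Kronecker curvature $K$ with respect to $N$ is positive). A convex function $f:\mathbb{R}^n\to\mathbb{R}$ is called strictly convex if its graph is strictly convex with respect to the upward unit normal. For a smooth function $g$ of $(x,z)\in\mathbb{R}^{n+1}$: $R_g$ is the set of regular values of $g$ (in the paper's convention, for $g=z^2+a_1^2x_1^2+\cdots+a_n^2x_n^2$ one has $R_g=(0,\infty)$, i.e. only values actually attained are counted there). It is assumed that there is an interval $S\subset R_g$ such that for every $k\in S$ the level hypersurface $M_k=g^{-1}(k)$ is a smooth strictly convex hypersurface in $\mathbb{E}^{n+1}$; $S_g$ denotes the maximal interval in $R_g$ with this property. For $k\in S_g$, $I_k\subset S_g$ is a maximal interval such that each $M_{k+h}$ with $k+h\in I_k$ lies in the convex side of $M_k$; it is of the form $(k,a)$ with $a>k$ or $(b,k)$ with $b<k$ according as the gradient $\nabla g$ points to the convex side of $M_k$ or not. For $k\in S_g$, $p\in M_k$ and sufficiently small $h$ with $k+h\in I_k$, let $\Psi$ be the tangent hyperplane of $M_k$ at $p$ and let $\Phi$ be the tangent hyperplane of $M_{k+h}$ at some point $v\in M_{k+h}$ which is parallel to $\Psi$ (for $M_k$ bounding a convex body, the one near $p$). Then $A_p^*(k,h)$ is the $n$-dimensional area of the section in $\Phi$ enclosed by $\Phi\cap M_k$, and $V_p^*(k,h)$ is the $(n+1)$-dimensional volume of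 the region bounded by $M_k$ and the hyperplane $\Phi$ (the region lying between $\Psi$ and $\Phi$).
   Formalization: Item 4 is stated up to a Euclidean change of the x-coordinates and an added constant C, with R_g = S_g = (C,∞) and I_k = (C,k): literally it is false, as f = |x|²+1 or f = |x−b|² with α = 2 satisfies 1)–3). *)

theory Defs
  imports "HOL-Analysis.Analysis"
begin

text \<open>
  Euclidean space of dimension \<open>n + 1\<close> is \<open>(real^'n) \<times> real\<close>, whose points are written \<open>(x, z)\<close>;
  here \<open>n = CARD('n)\<close>.
\<close>

type_synonym 'n pt = "(real^'n) \<times> real"

primrec Ck :: "nat \<Rightarrow> ('a::real_normed_vector \<Rightarrow> 'b::real_normed_vector) \<Rightarrow> bool" where
  "Ck 0 f \<longleftrightarrow> continuous_on UNIV f"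
| "Ck (Suc m) f \<longleftrightarrow>
     f differentiable_on UNIV \<and> (\<forall>v. Ck m (\<lambda>x. frechet_derivative f (at x) v))"

definition smooth :: "('a::real_normed_vector \<Rightarrow> 'b::real_normed_vector) \<Rightarrow> bool" where
  "smooth f \<longleftrightarrow> (\<forall>m. Ck m f)"

definition grad :: "('a::real_inner \<Rightarrow> real) \<Rightarrow> 'a \<Rightarrow> 'a" where
  "grad g p = (THE d. GDERIV g p :> d)"

definition unit_grad :: "('a::real_inner \<Rightarrow> real) \<Rightarrow> 'a \<Rightarrow> 'a" where
  "unit_grad g p = grad g p /\<^sub>R norm (grad g p)"


subsection \<open>Curvature with respect to a unit normal field\<close>

text \<open>
  A hypersurface is always given as a regular level set, so its unit normal field \<open>N\<close> is defined and
  differentiable in a neighbourhood of each of its points. On tangent vectors the derivative of \<open>N\<close>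
  depends only on the values of \<open>N\<close> on the hypersurface.
\<close>

definition shape_operator :: "('a::real_inner \<Rightarrow> 'a) \<Rightarrow> 'a \<Rightarrow> 'a \<Rightarrow> 'a" where
  "shape_operator N p w = - frechet_derivative N (at p) w"

definition normal_curvature :: "('a::real_inner \<Rightarrow> 'a) \<Rightarrow> 'a \<Rightarrow> 'a \<Rightarrow> real" where
  "normal_curvature N p w = shape_operator N p w \<bullet> w"

definition pos_normal_curvatures :: "('a::real_inner \<Rightarrow> 'a) \<Rightarrow> 'a \<Rightarrow> bool" where
  "pos_normal_curvatures N p \<longleftrightarrow>
     (\<forall>w. norm w = 1 \<and> w \<bullet> N p = 0 \<longrightarrow> normal_curvature N p w > 0)"

text \<open>
  A linear isometry of \<open>real^'n\<close> onto the hyperplane through the origin with unit normal \<open>\<nu>\<close>.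
  The notions defined from it below do not depend on the choice.
\<close>

definition frame :: "'n::finite pt \<Rightarrow> real^'n \<Rightarrow> 'n pt" where
  "frame \<nu> = (SOME T. linear T \<and> (\<forall>u. norm (T u) = norm u) \<and> (\<forall>u. T u \<bullet> \<nu> = 0))"

text \<open>The determinant of the shape operator on the tangent space, in an orthonormal basis.\<close>

definition gauss_kronecker :: "('n::finite pt \<Rightarrow> 'n pt) \<Rightarrow> 'n pt \<Rightarrow> real" where
  "gauss_kronecker N p =
     det (\<chi> i j. shape_operator N p (frame (N p) (axis j 1)) \<bullet> frame (N p) (axis i 1))"

text \<open>The graph of \<open>f\<close> is the zero set of \<open>z - f x\<close>, whose gradient points upward.\<close>

definition strictly_convex_fun :: "(real^'n::finite \<Rightarrow> real) \<Rightarrow> bool" where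
  "strictly_convex_fun f \<longleftrightarrow>
     convex_on UNIV f \<and>
     (\<forall>x. pos_normal_curvatures (unit_grad (\<lambda>(x, z). z - f x)) (x, f x))"


subsection \<open>Level hypersurfaces of a function \<open>g\<close> on a domain \<open>D\<close>\<close>

definition level :: "'a set \<Rightarrow> ('a \<Rightarrow> real) \<Rightarrow> real \<Rightarrow> 'a set" where
  "level D g k = {y \<in> D. g y = k}"

definition regular_values :: "'a::real_inner set \<Rightarrow> ('a \<Rightarrow> real) \<Rightarrow> real set" where
  "regular_values D g = {k. level D g k \<noteq> {} \<and> (\<forall>y \<in> level D g k. grad g y \<noteq> 0)}"

text \<open>
  The unit normal field of the level \<open>k\<close> pointing to the convex side, that is, to the side of each
  tangent hyperplane that contains the hypersurface.
\<close>

definition convex_normal :: "'a::real_inner set \<Rightarrow> ('a \<Rightarrow> real) \<Rightarrow> real \<Rightarrow> 'a \<Rightarrow> 'a" where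
  "convex_normal D g k y =
     (if \<forall>p \<in> level D g k. \<forall>q \<in> level D g k. unit_grad g p \<bullet> (q - p) \<ge> 0
      then unit_grad g y else - unit_grad g y)"

definition strictly_convex_level :: "'a::real_inner set \<Rightarrow> ('a \<Rightarrow> real) \<Rightarrow> real \<Rightarrow> bool" where
  "strictly_convex_level D g k \<longleftrightarrow>
     connected (level D g k) \<and>
     (\<forall>p \<in> level D g k. \<forall>q \<in> level D g k. convex_normal D g k p \<bullet> (q - p) \<ge> 0) \<and>
     (\<forall>p \<in> level D g k. pos_normal_curvatures (convex_normal D g k) p)"

definition convex_side :: "'a::real_inner set \<Rightarrow> ('a \<Rightarrow> real) \<Rightarrow> real \<Rightarrow> 'a set" where
  "convex_side D g k = {y. \<forall>p \<in> level D g k. convex_normal D g k p \<bullet> (y - p) > 0}"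

text \<open>
  \<open>is_Sg D g S\<close>: \<open>S\<close> is a maximal nondegenerate interval of regular values all of whose levels are
  strictly convex. There may be several such intervals.
\<close>

definition strictly_convex_range :: "'a::real_inner set \<Rightarrow> ('a \<Rightarrow> real) \<Rightarrow> real set \<Rightarrow> bool" where
  "strictly_convex_range D g S \<longleftrightarrow>
     is_interval S \<and> interior S \<noteq> {} \<and> S \<subseteq> regular_values D g \<and>
     (\<forall>k \<in> S. strictly_convex_level D g k)"

definition is_Sg :: "'a::real_inner set \<Rightarrow> ('a \<Rightarrow> real) \<Rightarrow> real set \<Rightarrow> bool" where
  "is_Sg D g S \<longleftrightarrow>
     strictly_convex_range D g S \<and>
     (\<forall>S'. strictly_convex_range D g S' \<and> S \<subseteq> S' \<longrightarrow> S' = S)"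

text \<open>\<open>is_Ik D g S k I\<close>: \<open>I\<close> is the interval \<open>I\<^sub>k\<close>, on one side of \<open>k\<close> and having \<open>k\<close> as an end point.\<close>

definition convex_side_range ::
    "'a::real_inner set \<Rightarrow> ('a \<Rightarrow> real) \<Rightarrow> real set \<Rightarrow> real \<Rightarrow> real set \<Rightarrow> bool" where
  "convex_side_range D g S k I \<longleftrightarrow>
     is_interval I \<and> I \<subseteq> S \<and> k \<notin> I \<and> k \<in> closure I \<and>
     (\<forall>j \<in> I. level D g j \<subseteq> convex_side D g k)"

definition is_Ik ::
    "'a::real_inner set \<Rightarrow> ('a \<Rightarrow> real) \<Rightarrow> real set \<Rightarrow> real \<Rightarrow> real set \<Rightarrow> bool" where
  "is_Ik D g S k I \<longleftrightarrow>
     convex_side_range D g S k I \<and>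
     (\<forall>I'. convex_side_range D g S k I' \<and> I \<subseteq> I' \<longrightarrow> I' = I)"


subsection \<open>Sections and caps\<close>

text \<open>
  The point \<open>v\<close> of the level \<open>k + h\<close> whose tangent hyperplane \<open>\<Phi>\<close> is parallel to the tangent hyperplane
  \<open>\<Psi>\<close> of the level \<open>k\<close> at \<open>p\<close>. A level bounding a convex body has two such points, with opposite normals
  to the convex side; the one near \<open>p\<close> has the same normal as \<open>p\<close>.
\<close>

definition parallel_point :: "'a::real_inner set \<Rightarrow> ('a \<Rightarrow> real) \<Rightarrow> real \<Rightarrow> 'a \<Rightarrow> real \<Rightarrow> 'a" where
  "parallel_point D g k p h =
     (SOME v. v \<in> level D g (k + h) \<and> convex_normal D g (k + h) v = convex_normal D g k p)"

text \<open>
  By convexity of the level \<open>k\<close>, the section enclosed by its intersection with \<open>\<Phi>\<close> is the convex hull of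
  that intersection, and the region bounded by it and \<open>\<Phi>\<close> is the convex hull of its part between
  \<open>\<Psi>\<close> and \<open>\<Phi>\<close>. The area in \<open>\<Phi>\<close> is Lebesgue measure in isometric coordinates with origin \<open>v\<close>.
\<close>

definition section_area :: "'n::finite pt set \<Rightarrow> ('n pt \<Rightarrow> real) \<Rightarrow> real \<Rightarrow> 'n pt \<Rightarrow> real \<Rightarrow> real" where
  "section_area D g k p h =
     (let \<nu> = convex_normal D g k p; v = parallel_point D g k p h in
      measure lebesgue
        {u. v + frame \<nu> u \<in> convex hull (level D g k \<inter> {y. \<nu> \<bullet> (y - v) = 0})})"

definition cap_volume :: "'n::finite pt set \<Rightarrow> ('n pt \<Rightarrow> real) \<Rightarrow> real \<Rightarrow> 'n pt \<Rightarrow> real \<Rightarrow> real" where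
  "cap_volume D g k p h =
     (let \<nu> = convex_normal D g k p; v = parallel_point D g k p h in
      measure lebesgue
        (convex hull (level D g k \<inter> {y. \<nu> \<bullet> (y - p) \<ge> 0 \<and> \<nu> \<bullet> (y - v) \<le> 0})))"

text \<open>
  \<open>F k p h\<close> is a nonnegative function of \<open>k\<close> and \<open>h\<close> only. Sections and caps are meaningful only for
  \<open>h\<close> sufficiently small, where the bound may depend on \<open>k\<close> and \<open>p\<close>.
\<close>

definition point_independent ::
    "'a::real_inner set \<Rightarrow> ('a \<Rightarrow> real) \<Rightarrow> real set \<Rightarrow> (real \<Rightarrow> 'a \<Rightarrow> real \<Rightarrow> real) \<Rightarrow> bool" where
  "point_independent D g S F \<longleftrightarrow>
     (\<exists>\<phi>. (\<forall>k h. \<phi> k h \<ge> 0) \<and>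
        (\<forall>k \<in> S. \<forall>I. is_Ik D g S k I \<longrightarrow>
           (\<forall>p \<in> level D g k. \<forall>\<^sub>F h in at 0 within {h. k + h \<in> I}. F k p h = \<phi> k h)))"

definition condV :: "'n::finite pt set \<Rightarrow> ('n pt \<Rightarrow> real) \<Rightarrow> real set \<Rightarrow> bool" where
  "condV D g S \<longleftrightarrow> point_independent D g S (cap_volume D g)"

definition condA :: "'n::finite pt set \<Rightarrow> ('n pt \<Rightarrow> real) \<Rightarrow> real set \<Rightarrow> bool" where
  "condA D g S \<longleftrightarrow>
     point_independent D g S (\<lambda>k p h. section_area D g k p h / norm (grad g p))"

definition condK :: "'n::finite pt set \<Rightarrow> ('n pt \<Rightarrow> real) \<Rightarrow> real set \<Rightarrow> bool" where
  "condK D g S \<longleftrightarrow>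
     (\<exists>c. \<forall>k \<in> S. \<forall>p \<in> level D g k.
        gauss_kronecker (convex_normal D g k) p * norm (grad g p) ^ (CARD('n) + 2) = c k)"


subsection \<open>The functions \<open>g (x, z) = z\<^sup>\<alpha> + f x\<close>\<close>

text \<open>
  The power \<open>z\<^sup>\<alpha>\<close> is a smooth function of \<open>z\<close> on \<open>power_domain \<alpha>\<close>. Since everything is connected, \<open>g\<close>
  lives over one connected component of this set; it is the whole line if \<open>\<alpha>\<close> is a natural number.
\<close>

definition zpower :: "real \<Rightarrow> real \<Rightarrow> real" where
  "zpower \<alpha> z = (if \<alpha> \<in> \<int> then z powi \<lfloor>\<alpha>\<rfloor> else z powr \<alpha>)"

definition power_domain :: "real \<Rightarrow> real set" where
  "power_domain \<alpha> = (if \<alpha> \<in> \<nat> then UNIV else if \<alpha> \<in> \<int> then - {0} else {0<..})"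

definition g_fun :: "real \<Rightarrow> (real^'n \<Rightarrow> real) \<Rightarrow> 'n::finite pt \<Rightarrow> real" where
  "g_fun \<alpha> f = (\<lambda>(x, z). zpower \<alpha> z + f x)"

text \<open>
  The form \<open>z\<^sup>2 + a\<^sub>1\<^sup>2 x\<^sub>1\<^sup>2 + \<dots> + a\<^sub>n\<^sup>2 x\<^sub>n\<^sup>2\<close> up to a Euclidean change of the coordinates \<open>x\<close> and an
  additive constant \<open>C\<close>. Neither can be dropped: the hypotheses and the three conditions above are
  invariant under such changes, as long as \<open>f\<close> stays nonnegative.
\<close>

definition ellipsoid_form :: "'n::finite pt set \<Rightarrow> ('n pt \<Rightarrow> real) \<Rightarrow> real \<Rightarrow> real^'n \<Rightarrow> bool" where
  "ellipsoid_form D g C a \<longleftrightarrow>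
     (\<forall>i. a $ i > 0) \<and>
     (\<exists>T b. orthogonal_transformation T \<and>
        (\<forall>(x, z) \<in> D. g (x, z) = C + z\<^sup>2 + (\<Sum>i\<in>UNIV. (a $ i)\<^sup>2 * (T (x - b) $ i)\<^sup>2)))"

end

theory Submission
  imports Defs
begin

text \<open>
  Write \<open>g (x, z) = \<phi> z + f x\<close>, let \<open>n\<close> be the dimension of \<open>x\<close> and \<open>K\<close> the Gauss-Kronecker curvature of a level.
  In coordinates \<open>p + T u + t \<nu>\<close>, with \<open>\<nu>\<close> the normal to the convex side at \<open>p\<close>, the level of \<open>p\<close> is the graph of
  half its second fundamental form up to higher order, and the parallel tangent plane of the level \<open>k + h\<close> lies at
  height \<open>t \<sim> \<bar>h\<bar> / \<bar>\<nabla>g p\<bar>\<close>. Hence \<open>A\<^sub>p\<^sup>* / \<bar>\<nabla>g p\<bar>\<close> and \<open>V\<^sub>p\<^sup>*\<close> are asymptotic to a universal constant times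
  a power of \<open>\<bar>h\<bar>\<close> divided by the square root of \<open>K \<bar>\<nabla>g\<bar>\<^bsup>n+2\<^esup>\<close>, and each of the first two conditions makes this
  quantity constant on levels.

  Up to sign it equals \<open>det (Hess f) (\<phi>'\<^sup>2 + \<phi>'' Q)\<close> with \<open>Q = \<nabla>f \<bullet> (Hess f)\<^sup>-\<^sup>1 \<nabla>f\<close>. Comparing it above two
  points \<open>x\<^sub>1\<close>, \<open>x\<^sub>2\<close> for all \<open>k\<close> in an interval gives an identity of polynomials in \<open>k\<close> that forces \<open>\<alpha> = 2\<close>; then
  \<open>Q = 2 (f - C)\<close>. By this equation the Newton steps \<open>x - (Hess f)\<^sup>-\<^sup>1 \<nabla>f\<close> all lead to the minimum of \<open>f\<close>,
  and \<open>f\<close> is quadratic. Conversely a linear map takes the levels of a quadratic \<open>g\<close> to concentric spheres.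
\<close>

text \<open>Two obstacles shape the proof. First, the conditions speak only of those
  \<open>k\<close> that have an interval \<open>I\<close> with \<open>is_Ik\<close>, so it must be
  known on which side of \<open>k\<close> the levels inside the convex side lie. The sign of the
  convex normal relative to the gradient is therefore determined for every admissible exponent, and
  it is the same for all levels in \<open>S\<close>. Second, caps and sections are convex hulls of
  pieces of a level that may be unbounded, and the parallel point is an arbitrary choice. Both are
  controlled through the intersection \<open>C\<close> of the supporting half spaces of the level:
  it is convex, contains these hulls and the parallel point, and near \<open>p\<close> its slices
  lie in slices squeezed between two ellipsoids. The constancy of the curvature quantity is needed
  only for interior \<open>k\<close>, because the exponent is isolated by differentiating in
  \<open>k\<close> on an open interval. For the converse the curvature of an ellipsoid is not
  computed: caps are equal by the symmetry of spheres, and the curvature condition follows from the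
  same asymptotics.\<close>

section \<open>Lebesgue measure and linear maps\<close>

text \<open>The index type is built from \<open>'a\<close> because the number of coordinates depends
  on it; an initial segment of the naturals brings its well-order along.\<close>

typedef (overloaded) ('a::euclidean_space) basis_ix = "{..<DIM('a)}"
  by (rule exI[of _ 0]) simp

instantiation basis_ix :: (euclidean_space) linorder
begin
definition "less_eq_basis_ix (i::'a basis_ix) (j::'a basis_ix) \<longleftrightarrow> Rep_basis_ix i \<le> Rep_basis_ix j"
definition "less_basis_ix (i::'a basis_ix) (j::'a basis_ix) \<longleftrightarrow> Rep_basis_ix i < Rep_basis_ix j"
instance
  by standard (auto simp: less_eq_basis_ix_def less_basis_ix_def Rep_basis_ix_inject)
end

instance basis_ix :: (euclidean_space) wellorder
proof
  fix P :: "'a basis_ix \<Rightarrow> bool" and a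
  assume step: "\<And>x. (\<And>y. y < x \<Longrightarrow> P y) \<Longrightarrow> P x"
  show "P a"
    by (induction a rule: measure_induct_rule[of Rep_basis_ix])
      (rule step, simp add: less_basis_ix_def)
qed

instance basis_ix :: (euclidean_space) finite
proof
  have "(UNIV :: 'a basis_ix set) = Abs_basis_ix ` {..<DIM('a)}"
    by (simp add: type_definition.Abs_image[OF type_definition_basis_ix])
  then show "finite (UNIV :: 'a basis_ix set)"
    by (metis finite_imageI finite_lessThan)
qed

lemma basis_ix_enum:
  obtains e :: "'a::euclidean_space basis_ix \<Rightarrow> 'a" where "bij_betw e UNIV Basis"
proof -
  obtain h :: "nat \<Rightarrow> 'a" where h: "bij_betw h {0..<DIM('a)} Basis"
    using ex_bij_betw_nat_finite[OF finite_Basis] by blast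
  have "bij_betw (Rep_basis_ix :: 'a basis_ix \<Rightarrow> nat) UNIV {..<DIM('a)}"
    by (auto simp: bij_betw_def inj_on_def Rep_basis_ix_inject
        type_definition.Rep_range[OF type_definition_basis_ix])
  then have "bij_betw (h \<circ> (Rep_basis_ix :: 'a basis_ix \<Rightarrow> nat)) UNIV Basis"
    using h by (auto intro: bij_betw_trans simp: atLeast0LessThan)
  then show ?thesis using that by blast
qed

text \<open>Coordinates in an orthonormal basis turn boxes into boxes with the same side lengths,
  and Lebesgue measure is determined by its values on boxes.\<close>

lemma isometry_to_cart:
  obtains \<phi> :: "'a::euclidean_space \<Rightarrow> real^('a basis_ix)" and \<psi>
  where "linear \<phi>" "linear \<psi>" "\<And>x. \<psi> (\<phi> x) = x" "\<And>y. \<phi> (\<psi> y) = y"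
    "\<And>S. S \<in> sets borel \<Longrightarrow> emeasure lborel (\<psi> -` S) = emeasure lborel S"
proof -
  obtain e :: "'a basis_ix \<Rightarrow> 'a" where e: "bij_betw e UNIV Basis" by (rule basis_ix_enum)
  have eB: "e i \<in> Basis" for i using e by (auto simp: bij_betw_def)
  have einj: "e i = e j \<longleftrightarrow> i = j" for i j using e by (auto simp: bij_betw_def inj_on_def)
  define \<phi> :: "'a \<Rightarrow> real^('a basis_ix)" where "\<phi> x = (\<chi> i. x \<bullet> e i)" for x
  define \<psi> :: "real^('a basis_ix) \<Rightarrow> 'a" where "\<psi> y = (\<Sum>i\<in>UNIV. (y $ i) *\<^sub>R e i)" for y
  have lphi: "linear \<phi>"
    by (rule linearI) (auto simp: \<phi>_def vec_eq_iff inner_left_distrib)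
  have lpsi: "linear \<psi>"
    by (rule linearI) (auto simp: \<psi>_def scaleR_left_distrib sum.distrib scaleR_sum_right)
  have psie: "\<psi> y \<bullet> e j = y $ j" for y j
  proof -
    have "\<psi> y \<bullet> e j = (\<Sum>i\<in>UNIV. (y $ i) * (e i \<bullet> e j))"
      by (simp add: \<psi>_def inner_sum_left)
    also have "\<dots> = (\<Sum>i\<in>UNIV. if i = j then y $ i else 0)"
      by (rule sum.cong) (auto simp: inner_Basis eB einj)
    finally show ?thesis by simp
  qed
  have 1: "\<phi> (\<psi> y) = y" for y by (simp add: \<phi>_def psie vec_eq_iff)
  have 2: "\<psi> (\<phi> x) = x" for x
  proof -
    have "\<psi> (\<phi> x) = (\<Sum>b\<in>Basis. (x \<bullet> b) *\<^sub>R b)"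
      unfolding \<psi>_def \<phi>_def using sum.reindex_bij_betw[OF e, of "\<lambda>b. (x \<bullet> b) *\<^sub>R b"] by simp
    then show ?thesis by (simp add: euclidean_representation)
  qed
  have meas: "\<psi> \<in> borel_measurable borel"
    by (intro borel_measurable_continuous_onI linear_continuous_on)
      (use lpsi linear_conv_bounded_linear in auto)
  have "lborel = distr lborel borel \<psi>"
  proof (rule lborel_eqI)
    fix l u :: 'a assume lu: "\<And>b. b \<in> Basis \<Longrightarrow> l \<bullet> b \<le> u \<bullet> b"
    have "\<psi> -` box l u = box (\<phi> l) (\<phi> u)"
    proof -
      have "\<psi> y \<in> box l u \<longleftrightarrow> y \<in> box (\<phi> l) (\<phi> u)" for y
      proof -
        have "\<psi> y \<in> box l u \<longleftrightarrow> (\<forall>i. l \<bullet> e i < \<psi> y \<bullet> e i \<and> \<psi> y \<bullet> e i < u \<bullet> e i)"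
          using e by (auto simp: mem_box bij_betw_def) (metis (no_types) imageE rangeI)+
        then show ?thesis by (simp add: psie mem_box_cart \<phi>_def)
      qed
      then show ?thesis by auto
    qed
    then have "emeasure (distr lborel borel \<psi>) (box l u) = emeasure lborel (box (\<phi> l) (\<phi> u))"
      using meas by (simp add: emeasure_distr)
    also have "\<dots> = (\<Prod>b\<in>Basis. (\<phi> u - \<phi> l) \<bullet> b)"
      using lu eB by (subst emeasure_lborel_box) (auto simp: Basis_vec_def inner_axis \<phi>_def)
    also have "(\<Prod>b\<in>Basis. (\<phi> u - \<phi> l) \<bullet> b) = (\<Prod>i\<in>UNIV. (\<phi> u - \<phi> l) $ i)"
    proof -
      have *: "(Basis :: (real^('a basis_ix)) set) = (\<lambda>i. axis i 1) ` UNIV"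
        by (auto simp: Basis_vec_def)
      show ?thesis unfolding *
        by (subst prod.reindex) (auto simp: inj_on_def axis_eq_axis inner_axis)
    qed
    also have "\<dots> = (\<Prod>i\<in>UNIV. (u - l) \<bullet> e i)"
      by (simp add: \<phi>_def inner_diff_left)
    also have "\<dots> = (\<Prod>b\<in>Basis. (u - l) \<bullet> b)"
      using prod.reindex_bij_betw[OF e, of "\<lambda>b. (u - l) \<bullet> b"] by simp
    finally show "emeasure (distr lborel borel \<psi>) (box l u) = (\<Prod>b\<in>Basis. (u - l) \<bullet> b)" .
  qed simp
  then have 3: "emeasure lborel (\<psi> -` S) = emeasure lborel S" if "S \<in> sets borel" for S
    using emeasure_distr[of \<psi> lborel borel S] meas that by simp
  show ?thesis using that[OF lphi lpsi 2 1 3] .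
qed

lemma linear_inj_surj_inverse:
  fixes L :: "'a::euclidean_space \<Rightarrow> 'a"
  assumes "linear L" "inj L"
  shows "bij L" "linear (inv L)"
proof -
  show "bij L" using assms linear_injective_imp_surjective by (auto simp: bij_def)
  then show "linear (inv L)" using assms by (metis bij_is_surj inj_linear_imp_inv_linear)
qed

text \<open>The library has the change of variables for linear maps only on \<open>real^'n\<close> with a
  well-ordered index type, hence the detour through \<^typ>\<open>'a basis_ix\<close>.\<close>

lemma linear_image_scales_measure:
  fixes L :: "'a::euclidean_space \<Rightarrow> 'a"
  assumes L: "linear L" "inj L"
  obtains c where "c > 0"
    "\<And>S. compact S \<Longrightarrow> measure lebesgue (L ` S) = c * measure lebesgue S"
proof -
  obtain \<phi> :: "'a \<Rightarrow> real^('a basis_ix)" and \<psi> where ph: "linear \<phi>" and ps: "linear \<psi>"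
    and 1: "\<And>x. \<psi> (\<phi> x) = x" and 2: "\<And>y. \<phi> (\<psi> y) = y"
    and m: "\<And>S. S \<in> sets borel \<Longrightarrow> emeasure lborel (\<psi> -` S) = emeasure lborel S"
    by (rule isometry_to_cart) blast
  have cc: "compact (h ` S)" if "compact S" "linear h" for h :: "'b::euclidean_space \<Rightarrow> 'c::euclidean_space" and S
    using that by (intro compact_continuous_image linear_continuous_on)
       (auto simp: linear_conv_bounded_linear)
  have ml: "measure lebesgue (\<phi> ` S) = measure lebesgue S" if "compact S" for S
  proof -
    have "\<phi> ` S = \<psi> -` S"
    proof (intro subset_antisym subsetI)
      fix y assume "y \<in> \<psi> -` S"
      then show "y \<in> \<phi> ` S" using 2[of y] by (metis image_eqI vimageE)
    qed (use 1 in auto)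
    moreover have "S \<in> sets borel" "\<phi> ` S \<in> sets borel" using that cc[OF that ph] by (auto intro: borel_compact)
    ultimately show ?thesis using m[of S] by (simp add: measure_def)
  qed
  define M where "M = \<phi> \<circ> L \<circ> \<psi>"
  have M: "linear M" unfolding M_def by (intro linear_compose ph ps L)
  have "inj \<phi>" "inj \<psi>" using 1 2 by (auto intro: inj_on_inverseI)
  then have "inj M" unfolding M_def using L by (intro inj_compose)
  then have "det (matrix M) \<noteq> 0"
    using M by (simp add: det_nz_iff_inj)
  moreover have "measure lebesgue (L ` S) = \<bar>det (matrix M)\<bar> * measure lebesgue S" if S: "compact S" for S
  proof -
    have "measure lebesgue (L ` S) = measure lebesgue (\<phi> ` (L ` S))"
      using ml cc[OF S L(1)] by simp
    also have "\<phi> ` (L ` S) = M ` (\<phi> ` S)" by (simp add: M_def image_image 1)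
    also have "measure lebesgue \<dots> = \<bar>det (matrix M)\<bar> * measure lebesgue (\<phi> ` S)"
      using measure_linear_image[OF M lmeasurable_compact[OF cc[OF S ph]]] .
    finally show ?thesis using ml[OF S] by simp
  qed
  ultimately show ?thesis using that[of "\<bar>det (matrix M)\<bar>"] by simp
qed

lemma linear_isometry_inj:
  fixes L :: "'a::real_normed_vector \<Rightarrow> 'b::real_normed_vector"
  assumes "linear L" "\<And>x. norm (L x) = norm x"
  shows "inj L"
  using assms by (metis linear_injective_0 norm_eq_zero)

text \<open>The scaling constant of \<open>L\<close> is read off from the unit ball, which an
  isometry maps onto itself.\<close>

lemma measure_isometry_image:
  fixes L :: "'a::euclidean_space \<Rightarrow> 'a"
  assumes L: "linear L" "\<And>x. norm (L x) = norm x" and S: "compact S"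
  shows "measure lebesgue (L ` S) = measure lebesgue S"
proof -
  have "inj L" using L by (rule linear_isometry_inj)
  then obtain c where c: "\<And>S. compact S \<Longrightarrow> measure lebesgue (L ` S) = c * measure lebesgue S"
    using linear_image_scales_measure[OF L(1)] by metis
  have "L ` cball 0 1 = cball 0 1"
  proof -
    have "bij L" using linear_inj_surj_inverse[OF L(1) \<open>inj L\<close>] by simp
    show ?thesis
    proof (intro subset_antisym subsetI)
      fix y assume "y \<in> cball (0::'a) 1"
      moreover obtain x where "y = L x" using \<open>bij L\<close> by (metis bij_pointE)
      ultimately show "y \<in> L ` cball 0 1" using L by auto
    qed (use L in auto)
  qed
  then have "c = 1"
    using c[of "cball 0 1"] content_cball_pos[of 1 "0::'a"] by simp
  then show ?thesis using c[OF S] by simp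
qed

lemma measure_translation_vimage:
  fixes S :: "'a::euclidean_space set"
  shows "measure lebesgue {u. a + u \<in> S} = measure lebesgue S"
proof -
  have "{u. a + u \<in> S} = (\<lambda>u. - a + u) ` S" by force
  then show ?thesis using measure_translation[of "-a" S] by simp
qed

text \<open>Cavalieri's principle. Compactness of \<open>X\<close> makes the slices measurable with
  finite measure, so that real and extended measures agree.\<close>

lemma measure_slices:
  fixes X :: "('a::euclidean_space \<times> real) set"
  assumes X: "compact X" and f: "\<And>s. measure lebesgue {u. (u, s) \<in> X} = f s"
    and I: "(f has_integral I) UNIV"
  shows "measure lebesgue X = I"
proof -
  have Xb: "X \<in> sets borel" using X by (simp add: borel_compact)
  then have Xb2: "X \<in> sets (lborel \<Otimes>\<^sub>M lborel)" unfolding lborel_prod by simp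
  have sl: "(\<lambda>u. (u, s)) -` X = {u. (u, s) \<in> X}" for s by auto
  have comp: "compact {u. (u, s) \<in> X}" for s
  proof -
    have "{u. (u, s) \<in> X} = fst ` (X \<inter> (UNIV \<times> {s}))" by force
    moreover have "compact (X \<inter> (UNIV \<times> {s}))"
      using X by (intro compact_Int_closed closed_Times) auto
    ultimately show ?thesis by (simp add: compact_continuous_image continuous_on_fst)
  qed
  have em: "emeasure lborel {u. (u, s) \<in> X} = ennreal (f s)" for s
  proof -
    have "emeasure lborel {u. (u, s) \<in> X} \<noteq> top"
      using emeasure_compact_finite[OF comp[of s]] by simp
    then have "emeasure lborel {u. (u, s) \<in> X} = ennreal (measure lborel {u. (u, s) \<in> X})"
      by (rule emeasure_eq_ennreal_measure)
    also have "measure lborel {u. (u, s) \<in> X} = f s"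
      using f[of s] comp[of s] by (simp add: measure_completion borel_compact)
    finally show ?thesis .
  qed
  have f0: "f s \<ge> 0" for s using measure_nonneg f by metis
  have fm: "f \<in> borel_measurable lborel"
  proof -
    have "(\<lambda>s. emeasure lborel ((\<lambda>u. (u, s)) -` X)) \<in> borel_measurable lborel"
      using Xb2 by (rule lborel_pair.measurable_emeasure_Pair2)
    then have "(\<lambda>s. enn2real (ennreal (f s))) \<in> borel_measurable lborel"
      by (simp add: sl em)
    then show ?thesis using f0 by simp
  qed
  have "emeasure lborel X = emeasure (lborel \<Otimes>\<^sub>M lborel) X" by (simp add: lborel_prod)
  also have "\<dots> = (\<integral>\<^sup>+ s. emeasure lborel ((\<lambda>u. (u, s)) -` X) \<partial>lborel)"
    using Xb2 by (rule lborel_pair.emeasure_pair_measure_alt2)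
  also have "\<dots> = (\<integral>\<^sup>+ s. ennreal (f s) \<partial>lborel)" by (simp add: sl em)
  also have "\<dots> = ennreal I"
    using fm I f0 by (intro nn_integral_has_integral_lborel) auto
  finally have "emeasure lborel X = ennreal I" .
  moreover have "I \<ge> 0"
    using I by (rule has_integral_nonneg) (rule f0)
  ultimately show ?thesis using Xb by (simp add: measure_def)
qed

section \<open>Linear algebra\<close>

text \<open>For small \<open>t\<close> of either sign the linear term outweighs the quadratic one.
  The test value is \<open>b * s\<close>, with \<open>s\<close> so small that
  \<open>s * c \<ge> -1\<close>.\<close>

lemma linear_coeff_zero_if_quadratic_nonpos:
  fixes b c :: real
  assumes "\<And>t. 2 * t * b + t\<^sup>2 * c \<le> 0"
  shows "b = 0"
proof -
  define s where "s = 1 / (1 + \<bar>c\<bar>)"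
  have s: "s > 0" "s * \<bar>c\<bar> \<le> 1" by (auto simp: s_def field_simps)
  have "s * c \<ge> - (s * \<bar>c\<bar>)" using s by (metis abs_ge_minus_self abs_mult abs_of_pos minus_le_iff)
  then have "2 + s * c > 0" using s by linarith
  moreover have "2 * (b * s) * b + (b * s)\<^sup>2 * c = b\<^sup>2 * s * (2 + s * c)"
    by (simp add: power2_eq_square algebra_simps)
  ultimately have "b\<^sup>2 * (s * (2 + s * c)) \<le> 0" "s * (2 + s * c) > 0"
    using assms[of "b * s"] s by (auto simp: mult.assoc)
  then have "b\<^sup>2 \<le> 0" by (metis mult_le_0_iff not_less)
  then show ?thesis by simp
qed

text \<open>Rayleigh quotient argument: \<open>w\<close> maximises \<open>H y \<bullet> y\<close>
  over the unit vectors orthogonal to the given eigenvectors. Symmetry of \<open>H\<close> makes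
  this complement invariant, and the first variation at the maximum leaves \<open>H w\<close> no
  component in it other than along \<open>w\<close>.\<close>

lemma selfadjoint_eigenvector_in_complement:
  fixes H :: "real^'n::finite \<Rightarrow> real^'n" and v :: "'n \<Rightarrow> real^'n"
  assumes H: "linear H" and sym: "\<And>x y. H x \<bullet> y = x \<bullet> H y"
    and ev: "\<And>i. i \<in> I \<Longrightarrow> H (v i) = l i *\<^sub>R v i" and I: "I \<noteq> UNIV"
  obtains w m where "norm w = 1" "H w = m *\<^sub>R w" "\<And>i. i \<in> I \<Longrightarrow> v i \<bullet> w = 0"
proof -
  define W where "W = {w. \<forall>i\<in>I. v i \<bullet> w = 0}"
  have scW: "c *\<^sub>R w \<in> W" if "w \<in> W" for c w using that by (auto simp: W_def)
  have adW: "x + y \<in> W" if "x \<in> W" "y \<in> W" for x y using that by (auto simp: W_def inner_right_distrib)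
  \<comment> \<open>Fewer than \<open>CARD('n)\<close> vectors cannot span the space, so the
    complement contains a unit vector.\<close>
  have "dim (v ` I) \<le> card (v ` I)" by (rule dim_le_card) (auto intro: span_base)
  also have "\<dots> \<le> card I" by (rule card_image_le) simp
  also have "\<dots> < CARD('n)" using I by (intro psubset_card_mono) auto
  finally have "dim (v ` I) < DIM(real^'n)" by simp
  then obtain x where x: "x \<noteq> 0" "\<And>y. y \<in> span (v ` I) \<Longrightarrow> orthogonal x y"
    using orthogonal_to_subspace_exists by blast
  have xW: "x \<in> W"
  proof -
    have "v i \<bullet> x = 0" if "i \<in> I" for i
      using x(2)[OF span_base[OF imageI[OF that]]] by (simp add: orthogonal_def inner_commute)
    then show ?thesis by (simp add: W_def)
  qed
  define U where "U = W \<inter> sphere 0 1"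
  have "closed W"
  proof -
    have "W = (\<Inter>i\<in>I. {w. v i \<bullet> w = 0})" by (auto simp: W_def)
    then show ?thesis by (simp add: closed_INT closed_hyperplane)
  qed
  then have "compact U" unfolding U_def by (simp add: closed_Int_compact)
  moreover have "x /\<^sub>R norm x \<in> U" using x(1) scW[OF xW] by (auto simp: U_def)
  moreover have "continuous_on U (\<lambda>w. H w \<bullet> w)"
    using H by (intro continuous_on_inner linear_continuous_on continuous_on_id)
      (auto simp: linear_conv_bounded_linear)
  ultimately obtain w where wU: "w \<in> U" and wmax: "\<And>y. y \<in> U \<Longrightarrow> H y \<bullet> y \<le> H w \<bullet> w"
    using continuous_attains_sup[of U "\<lambda>w. H w \<bullet> w"] by blast
  define m where "m = H w \<bullet> w"
  have w1: "norm w = 1" and wW: "w \<in> W" using wU by (auto simp: U_def)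
  then have ww: "w \<bullet> w = 1" by (simp add: norm_eq_1)
  have le: "H y \<bullet> y \<le> m * (y \<bullet> y)" if "y \<in> W" for y
  proof (cases "y = 0")
    case True then show ?thesis by (simp add: linear_0[OF H])
  next
    case False
    then have "y /\<^sub>R norm y \<in> U" using scW[OF that] by (auto simp: U_def)
    from wmax[OF this] have "(H y \<bullet> y) / (norm y * norm y) \<le> m"
      by (simp add: linear_scale[OF H] m_def field_simps)
    then show ?thesis using False by (simp add: field_simps dot_square_norm power2_eq_square)
  qed
  have orth: "H w \<bullet> u = 0" if u: "u \<in> W" "u \<bullet> w = 0" for u
  proof -
    have "2 * t * (H w \<bullet> u) + t\<^sup>2 * (H u \<bullet> u - m * (u \<bullet> u)) \<le> 0" for t
    proof -
      have "H (w + t *\<^sub>R u) \<bullet> (w + t *\<^sub>R u) \<le> m * ((w + t *\<^sub>R u) \<bullet> (w + t *\<^sub>R u))"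
        by (rule le) (intro adW scW wW u)
      moreover have "H u \<bullet> w = H w \<bullet> u" using sym[of u w] by (simp only: inner_commute)
      ultimately show ?thesis using u(2) ww
        by (simp add: linear_add[OF H] linear_scale[OF H] inner_left_distrib inner_right_distrib
            inner_commute[of w u] m_def[symmetric] power2_eq_square algebra_simps)
    qed
    then show ?thesis by (rule linear_coeff_zero_if_quadratic_nonpos)
  qed
  define r where "r = H w - m *\<^sub>R w"
  have "H w \<in> W"
  proof -
    have "v i \<bullet> H w = 0" if "i \<in> I" for i
      using wW that by (simp add: sym[symmetric] ev) (simp add: W_def)
    then show ?thesis by (simp add: W_def)
  qed
  moreover have "r = H w + (- m) *\<^sub>R w" by (simp add: r_def)
  ultimately have rW: "r \<in> W" using adW scW wW by metis
  have rw: "r \<bullet> w = 0" using ww by (simp add: r_def m_def inner_diff_left)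
  have "r \<bullet> r = H w \<bullet> r - m * (r \<bullet> w)"
    by (metis r_def inner_diff_left inner_scaleR_left inner_commute)
  then have "r = 0" using orth[OF rW rw] rw by simp
  then show ?thesis using that[of w m] w1 wW by (auto simp: r_def W_def)
qed

text \<open>Adds one eigenvector at a time along the finite index set, so that the result is a
  family over \<open>'n\<close>.\<close>

theorem selfadjoint_diagonalizable:
  fixes H :: "real^'n::finite \<Rightarrow> real^'n"
  assumes H: "linear H" and sym: "\<And>x y. H x \<bullet> y = x \<bullet> H y"
  obtains v :: "'n \<Rightarrow> real^'n" and l
  where "\<And>i j. v i \<bullet> v j = (if i = j then 1 else 0)" "\<And>i. H (v i) = l i *\<^sub>R v i"
proof -
  have "\<exists>v l. (\<forall>i\<in>I. \<forall>j\<in>I. v i \<bullet> v j = (if i = j then 1 else 0)) \<and> (\<forall>i\<in>I. H (v i) = l i *\<^sub>R v i)"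
    for I :: "'n set"
  proof (induction I rule: finite_induct[OF finite])
    case 1 then show ?case by simp
  next
    case (2 k I)
    then obtain v l where o: "\<And>i j. i \<in> I \<Longrightarrow> j \<in> I \<Longrightarrow> v i \<bullet> v j = (if i = j then 1 else 0)"
      and e: "\<And>i. i \<in> I \<Longrightarrow> H (v i) = l i *\<^sub>R v i" by blast
    from 2 have "I \<noteq> UNIV" by auto
    have "\<exists>w m. norm w = 1 \<and> H w = m *\<^sub>R w \<and> (\<forall>i\<in>I. v i \<bullet> w = 0)"
    proof (rule selfadjoint_eigenvector_in_complement[OF H sym, of I v l])
      show "H (v i) = l i *\<^sub>R v i" if "i \<in> I" for i using that by (rule e)
      show "I \<noteq> UNIV" by fact
      fix w m assume "norm w = 1" "H w = m *\<^sub>R w" "\<And>i. i \<in> I \<Longrightarrow> v i \<bullet> w = 0"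
      then show "\<exists>w m. norm w = 1 \<and> H w = m *\<^sub>R w \<and> (\<forall>i\<in>I. v i \<bullet> w = 0)" by blast
    qed
    then obtain w m where w: "norm w = 1" "H w = m *\<^sub>R w" "\<And>i. i \<in> I \<Longrightarrow> v i \<bullet> w = 0"
      by blast
    have ww: "w \<bullet> w = 1" using w(1) by (simp add: norm_eq_1)
    have w': "w \<bullet> v i = 0" if "i \<in> I" for i using w(3)[OF that] by (simp add: inner_commute)
    let ?v = "v(k := w)" and ?l = "l(k := m)"
    have vI: "?v i = v i" "?l i = l i" if "i \<in> I" for i using that \<open>k \<notin> I\<close> by auto
    have 1: "?v i \<bullet> ?v j = (if i = j then 1 else 0)" if "i \<in> insert k I" "j \<in> insert k I" for i j
    proof (cases "i = k"; cases "j = k")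
      assume "i = k" "j = k" then show ?thesis using ww by simp
    next
      assume "i = k" "j \<noteq> k" then show ?thesis using w'[of j] that by simp
    next
      assume "i \<noteq> k" "j = k" then show ?thesis using w(3)[of i] that by simp
    next
      assume "i \<noteq> k" "j \<noteq> k" then show ?thesis using o[of i j] that by simp
    qed
    have 2: "H (?v i) = ?l i *\<^sub>R ?v i" if "i \<in> insert k I" for i
      using that w(2) e[of i] by (cases "i = k") simp_all
    show ?case using 1 2 by blast
  qed
  from this[of UNIV] show ?thesis using that by auto
qed

corollary selfadjoint_orthogonal_diagonal:
  fixes H :: "real^'n::finite \<Rightarrow> real^'n"
  assumes H: "linear H" and sym: "\<And>x y. H x \<bullet> y = x \<bullet> H y"
  obtains V :: "real^'n \<Rightarrow> real^'n" and l where "orthogonal_transformation V" "\<And>y. H (V y) = V (\<chi> i. l i * y $ i)"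
proof -
  obtain v :: "'n \<Rightarrow> real^'n" and l where o: "\<And>i j. v i \<bullet> v j = (if i = j then 1 else 0)"
    and e: "\<And>i. H (v i) = l i *\<^sub>R v i"
    using selfadjoint_diagonalizable[OF H sym] by metis
  define V where "V y = (\<Sum>i\<in>UNIV. (y $ i) *\<^sub>R v i)" for y
  have lV: "linear V"
    by (rule linearI) (auto simp: V_def scaleR_left_distrib sum.distrib scaleR_sum_right)
  have in1: "V y \<bullet> v j = y $ j" for y j
  proof -
    have "V y \<bullet> v j = (\<Sum>i\<in>UNIV. if i = j then y $ i else 0)"
      unfolding V_def inner_sum_left by (rule sum.cong) (auto simp: o)
    then show ?thesis by simp
  qed
  have "V y \<bullet> V z = y \<bullet> z" for y z
  proof -
    have "V y \<bullet> V z = (\<Sum>i\<in>UNIV. z $ i * (V y \<bullet> v i))"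
      by (simp only: V_def[of z] inner_sum_right inner_scaleR_right)
    then show ?thesis by (simp only: in1) (simp add: inner_vec_def mult.commute)
  qed
  then have "orthogonal_transformation V" using lV by (simp add: orthogonal_transformation_def)
  moreover have "H (V y) = V (\<chi> i. l i * y $ i)" for y
    unfolding V_def by (simp add: linear_sum[OF H] linear_scale[OF H] e mult.commute)
  ultimately show ?thesis by (rule that)
qed

text \<open>Matrix determinant lemma: rotating \<open>w\<close> onto a coordinate axis leaves an identity matrix with
  one modified column.\<close>

lemma det_identity_plus_outer:
  fixes u w :: "real^'n::finite"
  shows "det (\<chi> i j. (if i = j then 1 else 0) + u $ i * w $ j) = 1 + u \<bullet> w"
proof -
  obtain k :: 'n where True by simp
  have "norm (axis k c :: real^'n) = \<bar>c\<bar>" for c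
    unfolding norm_eq_sqrt_inner by (simp add: inner_axis_axis)
  then have "norm w = norm (axis k (norm w) :: real^'n)" by simp
  then obtain f where f: "orthogonal_transformation f" "f w = axis k (norm w)"
    by (rule orthogonal_transformation_exists)
  define R where "R = matrix f"
  have lf: "linear f" using f by (simp add: orthogonal_transformation_linear)
  have om: "orthogonal_matrix R" using f lf by (simp add: R_def orthogonal_transformation_matrix)
  have Rf: "R *v x = f x" for x using lf by (simp add: R_def matrix_works)
  define Q :: "real^'n^'n" where "Q = (\<chi> i j. u $ i * w $ j)"
  have Qv: "Q *v x = (w \<bullet> x) *\<^sub>R u" for x
    by (simp add: Q_def vec_eq_iff matrix_vector_mult_def inner_vec_def sum_distrib_left sum_distrib_right mult_ac)
  have eq: "(\<chi> i j. (if i = j then 1 else 0) + u $ i * w $ j) = mat 1 + Q"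
    by (simp add: vec_eq_iff mat_def Q_def)
  define N :: "real^'n^'n" where "N = R ** (mat 1 + Q) ** transpose R"
  define x where "x = axis k 1 + norm w *\<^sub>R f u"
  have "N = (\<chi> i j. if j = k then (mat 1 *v x) $ i else mat 1 $ i $ j)"
  proof -
    have tr: "f (transpose R *v y) = y" for y
    proof -
      have "f (transpose R *v y) = (R ** transpose R) *v y"
        by (simp only: Rf[symmetric] matrix_vector_mul_assoc)
      moreover have "R ** transpose R = mat 1" using om by (simp only: orthogonal_matrix_def)
      ultimately show ?thesis by (simp only: matrix_vector_mul_lid)
    qed
    have "N *v y = y + (norm w * y $ k) *\<^sub>R f u" for y
    proof -
      have "N *v y = f (transpose R *v y + (w \<bullet> (transpose R *v y)) *\<^sub>R u)"
        by (simp add: N_def matrix_vector_mul_assoc[symmetric] Rf matrix_vector_mult_add_rdistrib Qv)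
      also have "\<dots> = y + (w \<bullet> (transpose R *v y)) *\<^sub>R f u"
        by (simp only: linear_add[OF lf] linear_scale[OF lf] tr)
      also have "w \<bullet> (transpose R *v y) = f w \<bullet> y"
        using f(1) tr[of y] by (metis orthogonal_transformation_def)
      also have "\<dots> = norm w * y $ k" by (simp add: f(2) inner_axis')
      finally show ?thesis .
    qed
    then have "N *v axis j 1 = (if j = k then x else axis j 1)" for j
      by (auto simp: x_def axis_def)
    then have "column j N = (if j = k then x else axis j 1)" for j
      by (simp only: matrix_vector_mult_basis)
    then have "column j N $ i = (if j = k then x $ i else axis j 1 $ i)" for i j
      by simp
    then have "N $ i $ j = (if j = k then x $ i else axis j 1 $ i)" for i j
      by (simp only: column_def vec_lambda_beta)
    then show ?thesis by (simp add: vec_eq_iff) (auto simp: axis_def mat_def)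
  qed
  then have "det N = x $ k" by (simp add: cramer_lemma)
  also have "x $ k = 1 + f u \<bullet> f w"
  proof -
    have "x $ k = 1 + norm w * f u $ k" by (simp add: x_def axis_def)
    moreover have "f u \<bullet> f w = f u $ k * norm w" by (simp add: f(2) inner_axis)
    ultimately show ?thesis by simp
  qed
  also have "f u \<bullet> f w = u \<bullet> w" using f(1) by (simp add: orthogonal_transformation_def)
  finally have "det N = 1 + u \<bullet> w" .
  moreover have "det N = det (mat 1 + Q)"
  proof -
    have "det R * det R = 1" using det_orthogonal_matrix[OF om] by auto
    moreover have "det N = (det R * det R) * det (mat 1 + Q)"
      by (simp add: N_def det_mul det_transpose)
    ultimately show ?thesis by simp
  qed
  ultimately show ?thesis by (simp add: eq)
qed

text \<open>Since \<open>b\<close> is \<open>A *v x\<close>, the perturbed matrix factors as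
  \<open>A\<close> times the identity plus the rank one matrix of \<open>c *\<^sub>R x\<close> and
  \<open>b'\<close>; no inverse of \<open>A\<close> is involved.\<close>

lemma det_plus_outer:
  fixes A :: "real^'n::finite^'n"
  assumes "A *v x = b"
  shows "det (\<chi> i j. A $ i $ j + c * (b $ i * b' $ j)) = det A * (1 + c * (x \<bullet> b'))"
proof -
  have "(\<chi> i j. A $ i $ j + c * (b $ i * b' $ j))
      = A ** (\<chi> i j. (if i = j then 1 else 0) + (c *\<^sub>R x) $ i * b' $ j)"
  proof -
    have "(\<Sum>k\<in>UNIV. A $ i $ k * ((if k = j then 1 else 0) + (c *\<^sub>R x) $ k * b' $ j))
        = A $ i $ j + c * ((A *v x) $ i * b' $ j)" for i j
    proof -
      have "(\<Sum>k\<in>UNIV. A $ i $ k * ((if k = j then 1 else 0) + (c *\<^sub>R x) $ k * b' $ j))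
          = (\<Sum>k\<in>UNIV. (if k = j then A $ i $ k else 0)) + (\<Sum>k\<in>UNIV. c * (A $ i $ k * x $ k * b' $ j))"
        unfolding sum.distrib[symmetric] by (rule sum.cong) (auto simp: algebra_simps)
      then show ?thesis
        by (simp add: matrix_vector_mult_def sum_distrib_left sum_distrib_right mult_ac)
    qed
    then show ?thesis using assms by (simp add: vec_eq_iff matrix_matrix_mult_def)
  qed
  then have "det (\<chi> i j. A $ i $ j + c * (b $ i * b' $ j)) = det A * (1 + (c *\<^sub>R x) \<bullet> b')"
    by (simp only: det_mul det_identity_plus_outer)
  then show ?thesis by simp
qed

text \<open>In an eigenbasis of \<open>B\<close> the ellipsoid is a ball of radius
  \<open>sqrt s\<close> stretched by \<open>1 / sqrt (l i)\<close> along the axes, and the product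
  of the \<open>l i\<close> is \<open>det B\<close>.\<close>

lemma ellipsoid_measure:
  fixes B :: "real^'n::finite^'n"
  assumes sym: "\<And>x y. (B *v x) \<bullet> y = x \<bullet> (B *v y)"
    and pos: "\<And>x. x \<noteq> 0 \<Longrightarrow> (B *v x) \<bullet> x > 0" and s: "s \<ge> 0"
  shows "det B > 0" "compact {u. (B *v u) \<bullet> u \<le> s}"
    "measure lebesgue {u. (B *v u) \<bullet> u \<le> s}
       = unit_ball_vol (real CARD('n)) * sqrt s ^ CARD('n) / sqrt (det B)"
proof -
  obtain V :: "real^'n \<Rightarrow> real^'n" and l where oV: "orthogonal_transformation V" and BV: "\<And>y. B *v V y = V (\<chi> i. l i * y $ i)"
    by (rule selfadjoint_orthogonal_diagonal[of "\<lambda>x. B *v x"]) (use sym in auto)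
  have lV: "linear V" and inV: "\<And>y z. V y \<bullet> V z = y \<bullet> z"
    using oV by (auto simp: orthogonal_transformation_def)
  have nV: "norm (V y) = norm y" for y by (simp add: norm_eq_sqrt_inner inV)
  have "inj V" using lV nV by (rule linear_isometry_inj)
  have bV: "bij V" using linear_inj_surj_inverse[OF lV \<open>inj V\<close>] by simp
  have lpos: "l i > 0" for i
  proof -
    have "V (axis i 1) \<noteq> 0" using nV[of "axis i 1"] by auto
    from pos[OF this] have "(\<chi> j. l j * axis i 1 $ j) \<bullet> axis i 1 > 0" by (simp only: BV inV)
    then show ?thesis by (simp add: inner_axis)
  qed
  define P where "P = matrix V"
  have PV: "P *v y = V y" for y using lV by (simp add: P_def matrix_works)
  have BP: "B ** P = P ** (\<chi> i j. if i = j then l i else 0)"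
  proof -
    have *: "(\<chi> i j. if i = j then l i else 0) *v y = (\<chi> i. l i * y $ i)" for y
    proof -
      have "(\<Sum>j\<in>UNIV. (if i = j then l i else 0) * y $ j) = (\<Sum>j\<in>UNIV. if i = j then l i * y $ j else 0)" for i
        by (rule sum.cong) auto
      then show ?thesis by (simp add: vec_eq_iff matrix_vector_mult_def)
    qed
    show ?thesis by (simp add: matrix_eq matrix_vector_mul_assoc[symmetric] PV BV *)
  qed
  have "det B * det P = det P * det (\<chi> i j. if i = j then l i else 0)"
    using arg_cong[OF BP, of det] by (simp only: det_mul)
  moreover have "det P \<noteq> 0" using \<open>inj V\<close> lV by (simp add: P_def det_nz_iff_inj)
  ultimately have dB: "det B = (\<Prod>i\<in>UNIV. l i)"
    by (simp add: det_diagonal)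
  then show "det B > 0" by (simp add: lpos prod_pos)
  define m where "m i = 1 / sqrt (l i)" for i
  define D where "D y = (\<chi> i. m i * y $ i)" for y :: "real^'n"
  have lD: "linear D" by (rule linearI) (auto simp: D_def vec_eq_iff algebra_simps)
  have key: "(B *v V (D y)) \<bullet> V (D y) = (norm y)\<^sup>2" for y
  proof -
    have "(B *v V (D y)) \<bullet> V (D y) = (\<Sum>i\<in>UNIV. (l i * (m i * m i)) * (y $ i * y $ i))"
      by (simp only: BV inV) (simp add: D_def inner_vec_def mult_ac)
    moreover have "l i * (m i * m i) = 1" for i using lpos[of i] by (simp add: m_def)
    ultimately show ?thesis by (simp add: inner_vec_def power2_norm_eq_inner)
  qed
  have eq: "{u. (B *v u) \<bullet> u \<le> s} = V ` (D ` cball 0 (sqrt s))"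
  proof (intro subset_antisym subsetI)
    fix u assume u: "u \<in> {u. (B *v u) \<bullet> u \<le> s}"
    obtain y' where y': "u = V y'" using bV by (metis bij_pointE)
    define y where "y = (\<chi> i. sqrt (l i) * y' $ i)"
    have "sqrt (l i) \<noteq> 0" for i using lpos[of i] by simp
    then have "y' = D y" by (simp add: D_def y_def vec_eq_iff m_def)
    with u y' key[of y] have "norm y \<le> sqrt s" by (auto simp: real_le_rsqrt)
    then show "u \<in> V ` (D ` cball 0 (sqrt s))" using y' \<open>y' = D y\<close> by auto
  next
    fix u assume "u \<in> V ` (D ` cball 0 (sqrt s))"
    then obtain y where "u = V (D y)" "norm y \<le> sqrt s" by auto
    then show "u \<in> {u. (B *v u) \<bullet> u \<le> s}" using key[of y] s
      by (auto simp: sqrt_le_D real_le_rsqrt) (metis norm_ge_zero power2_eq_iff_nonneg power_mono real_sqrt_pow2)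
  qed
  have cD: "compact (D ` cball 0 (sqrt s))"
    using lD by (intro compact_continuous_image linear_continuous_on) (auto simp: linear_conv_bounded_linear)
  have "continuous_on (D ` cball 0 (sqrt s)) V"
    using lV by (intro linear_continuous_on) (auto simp: linear_conv_bounded_linear)
  then show "compact {u. (B *v u) \<bullet> u \<le> s}" unfolding eq
    using cD by (rule compact_continuous_image)
  have "measure lebesgue {u. (B *v u) \<bullet> u \<le> s} = measure lebesgue (D ` cball 0 (sqrt s))"
    unfolding eq by (rule measure_isometry_image[OF lV nV cD])
  also have "\<dots> = \<bar>prod m UNIV\<bar> * measure lebesgue (cball (0::real^'n) (sqrt s))"
    unfolding D_def by (rule measure_stretch) simp
  also have "\<bar>prod m UNIV\<bar> = 1 / sqrt (det B)"
  proof -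
    have "sqrt (\<Prod>i\<in>I. l i) = (\<Prod>i\<in>I. sqrt (l i))" for I :: "'n set"
      by (induction I rule: finite_induct[OF finite]) (auto simp: real_sqrt_mult)
    then show ?thesis using lpos by (simp add: dB m_def prod_dividef prod_nonneg less_imp_le)
  qed
  also have "measure lebesgue (cball (0::real^'n) (sqrt s)) = unit_ball_vol (real CARD('n)) * sqrt s ^ CARD('n)"
    using s by (simp add: content_cball)
  finally show "measure lebesgue {u. (B *v u) \<bullet> u \<le> s}
       = unit_ball_vol (real CARD('n)) * sqrt s ^ CARD('n) / sqrt (det B)" by simp
qed

section \<open>Gradients, Hessians and the shape operator\<close>

lemma grad_eqI: "GDERIV g p :> d \<Longrightarrow> grad g p = d"
proof -
  assume d: "GDERIV g p :> d"
  show ?thesis unfolding grad_def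
  proof (rule the_equality)
    show "GDERIV g p :> d" by (rule d)
    fix d' assume "GDERIV g p :> d'"
    then have "(\<lambda>h. inner h d') = (\<lambda>h. inner h d)"
      using d unfolding gderiv_def by (rule has_derivative_unique)
    then show "d' = d" by (metis inner_commute vector_eq_rdot)
  qed
qed

text \<open>The derivative of the normalising factor only contributes a multiple of the gradient. It
  is left unspecified as \<open>c\<close>, because it disappears when paired with tangent
  vectors.\<close>

lemma unit_grad_has_derivative:
  fixes g :: "'a::real_inner \<Rightarrow> real"
  assumes H: "(grad g has_derivative H) (at p)" and n0: "grad g p \<noteq> 0"
  obtains c where "(unit_grad g has_derivative
      (\<lambda>w. H w /\<^sub>R norm (grad g p) + c w *\<^sub>R grad g p)) (at p)"
proof -
  obtain c where c: "((\<lambda>y. inverse (norm (grad g y))) has_derivative c) (at p)"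
  proof -
    have "(norm has_derivative (\<lambda>h. h \<bullet> sgn (grad g p))) (at (grad g p))"
      using n0 by (rule has_derivative_norm)
    then have "((\<lambda>y. norm (grad g y)) has_derivative (\<lambda>w. H w \<bullet> sgn (grad g p))) (at p)"
      using has_derivative_compose[OF H] by blast
    then have "((\<lambda>y. inverse (norm (grad g y))) has_derivative
        (\<lambda>w. - (inverse (norm (grad g p)) * (H w \<bullet> sgn (grad g p)) * inverse (norm (grad g p))))) (at p)"
      using n0 by (intro Deriv.has_derivative_inverse) auto
    then show ?thesis using that by blast
  qed
  have "((\<lambda>y. inverse (norm (grad g y)) *\<^sub>R grad g y) has_derivative
      (\<lambda>w. inverse (norm (grad g p)) *\<^sub>R H w + c w *\<^sub>R grad g p)) (at p)"
    by (rule has_derivative_scaleR[OF c H])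
  then show ?thesis using that[of c] by (simp add: unit_grad_def[abs_def])
qed

text \<open>Pairing with a tangent vector \<open>w'\<close> removes the multiple of the gradient and
  leaves the Hessian divided by the length of the gradient.\<close>

lemma shape_operator_unit_grad:
  fixes g :: "'a::real_inner \<Rightarrow> real"
  assumes H: "(grad g has_derivative H) (at p)" and n0: "grad g p \<noteq> 0"
    and w': "w' \<bullet> grad g p = 0"
  shows "shape_operator (\<lambda>y. s *\<^sub>R unit_grad g y) p w \<bullet> w' = - s * (H w \<bullet> w') / norm (grad g p)"
proof -
  obtain c where c: "(unit_grad g has_derivative
      (\<lambda>w. H w /\<^sub>R norm (grad g p) + c w *\<^sub>R grad g p)) (at p)"
    using unit_grad_has_derivative[OF H n0] by blast
  have "((\<lambda>y. s *\<^sub>R unit_grad g y) has_derivative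
      (\<lambda>w. s *\<^sub>R (H w /\<^sub>R norm (grad g p) + c w *\<^sub>R grad g p))) (at p)"
    by (rule has_derivative_scaleR_right[OF c])
  then have "frechet_derivative (\<lambda>y. s *\<^sub>R unit_grad g y) (at p)
      = (\<lambda>w. s *\<^sub>R (H w /\<^sub>R norm (grad g p) + c w *\<^sub>R grad g p))"
    by (rule frechet_derivative_at[symmetric])
  then show ?thesis using w'
    by (simp add: shape_operator_def inner_add_left inner_commute[of "grad g p"] divide_inverse mult_ac)
qed

lemma norm_unit_grad: "grad g p \<noteq> 0 \<Longrightarrow> norm (unit_grad g p) = 1"
  by (simp add: unit_grad_def)

lemma pos_normal_curvatures_unit_grad:
  fixes g :: "'a::real_inner \<Rightarrow> real"
  assumes H: "(grad g has_derivative H) (at p)" and n0: "grad g p \<noteq> 0" and s: "s \<noteq> 0"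
  shows "pos_normal_curvatures (\<lambda>y. s *\<^sub>R unit_grad g y) p
     \<longleftrightarrow> (\<forall>w. w \<noteq> 0 \<and> w \<bullet> grad g p = 0 \<longrightarrow> s * (H w \<bullet> w) < 0)"
proof -
  have orth: "w \<bullet> (s *\<^sub>R unit_grad g p) = 0 \<longleftrightarrow> w \<bullet> grad g p = 0" for w
    using n0 s by (simp add: unit_grad_def)
  have curv: "normal_curvature (\<lambda>y. s *\<^sub>R unit_grad g y) p w > 0 \<longleftrightarrow> s * (H w \<bullet> w) < 0"
    if "w \<bullet> grad g p = 0" for w
    using shape_operator_unit_grad[OF H n0 that, of s w] n0
    by (simp add: normal_curvature_def zero_less_divide_iff divide_less_0_iff)
  have lH: "linear H" using H by (simp add: has_derivative_linear)
  have "s * (H w \<bullet> w) < 0" if "pos_normal_curvatures (\<lambda>y. s *\<^sub>R unit_grad g y) p"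
    "w \<noteq> 0" "w \<bullet> grad g p = 0" for w
  proof -
    let ?v = "w /\<^sub>R norm w"
    have "norm ?v = 1" "?v \<bullet> grad g p = 0" using that by auto
    then have "s * (H ?v \<bullet> ?v) < 0"
      using that(1) curv[of ?v] orth[of ?v] unfolding pos_normal_curvatures_def by blast
    then have "inverse (norm w) * inverse (norm w) * (s * (H w \<bullet> w)) < 0"
      by (simp add: linear_scale[OF lH] mult_ac)
    then show ?thesis using that(2) by (simp add: mult_less_0_iff zero_less_mult_iff)
  qed
  moreover have "pos_normal_curvatures (\<lambda>y. s *\<^sub>R unit_grad g y) p"
    if "\<forall>w. w \<noteq> 0 \<and> w \<bullet> grad g p = 0 \<longrightarrow> s * (H w \<bullet> w) < 0"
    unfolding pos_normal_curvatures_def using that orth curv by (metis norm_zero zero_neq_one)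
  ultimately show ?thesis by blast
qed

text \<open>The mixed second difference is symmetric in \<open>v\<close> and \<open>w\<close>. The
  mean value theorem, first along \<open>v\<close> and then along \<open>w\<close>, turns it into a
  second derivative at a nearby point.\<close>

lemma second_difference_mvt:
  fixes f :: "'a::real_normed_vector \<Rightarrow> real"
  assumes f: "f differentiable_on UNIV"
    and fv: "(\<lambda>x. frechet_derivative f (at x) v) differentiable_on UNIV" and h: "h > 0"
  shows "\<exists>s t. 0 < s \<and> s < h \<and> 0 < t \<and> t < h \<and>
    f (x + h *\<^sub>R v + h *\<^sub>R w) - f (x + h *\<^sub>R v) - f (x + h *\<^sub>R w) + f x
     = h * (h * frechet_derivative (\<lambda>x. frechet_derivative f (at x) v) (at (x + s *\<^sub>R v + t *\<^sub>R w)) w)"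
proof -
  have dd: "((\<lambda>s. k (a + s *\<^sub>R u)) has_real_derivative frechet_derivative k (at (a + s *\<^sub>R u)) u) (at s)"
    if "k differentiable_on UNIV" for k :: "'a \<Rightarrow> real" and a u s
  proof -
    have k: "(k has_derivative frechet_derivative k (at (a + s *\<^sub>R u))) (at (a + s *\<^sub>R u))"
      using that by (simp add: differentiable_on_def frechet_derivative_works)
    have "((\<lambda>s. a + s *\<^sub>R u) has_derivative (\<lambda>t. t *\<^sub>R u)) (at s)"
      by (auto intro!: derivative_eq_intros)
    from has_derivative_compose[OF this k] show ?thesis
      by (simp add: has_field_derivative_def linear_scale[OF has_derivative_linear[OF k]] mult.commute[of _ "frechet_derivative _ _ _"])
  qed
  let ?A = "\<lambda>s. f ((x + h *\<^sub>R w) + s *\<^sub>R v) - f (x + s *\<^sub>R v)"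
  let ?d = "\<lambda>y. frechet_derivative f (at y) v"
  have "(?A has_real_derivative ?d ((x + h *\<^sub>R w) + s *\<^sub>R v) - ?d (x + s *\<^sub>R v)) (at s)" for s
    by (intro DERIV_diff dd f)
  then have "\<exists>s>0. s < h \<and> ?A h - ?A 0 = (h - 0) * (?d ((x + h *\<^sub>R w) + s *\<^sub>R v) - ?d (x + s *\<^sub>R v))"
    by (intro MVT2[OF h]) auto
  then obtain s where s: "0 < s" "s < h"
    "?A h - ?A 0 = (h - 0) * (?d ((x + h *\<^sub>R w) + s *\<^sub>R v) - ?d (x + s *\<^sub>R v))" by blast
  let ?B = "\<lambda>t. ?d ((x + s *\<^sub>R v) + t *\<^sub>R w)"
  have "(?B has_real_derivative frechet_derivative ?d (at ((x + s *\<^sub>R v) + t *\<^sub>R w)) w) (at t)" for t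
    by (intro dd fv)
  then have "\<exists>t>0. t < h \<and> ?B h - ?B 0 = (h - 0) * frechet_derivative ?d (at ((x + s *\<^sub>R v) + t *\<^sub>R w)) w"
    by (intro MVT2[OF h]) auto
  then obtain t where t: "0 < t" "t < h"
    "?B h - ?B 0 = (h - 0) * frechet_derivative ?d (at ((x + s *\<^sub>R v) + t *\<^sub>R w)) w" by blast
  have "f (x + h *\<^sub>R v + h *\<^sub>R w) - f (x + h *\<^sub>R v) - f (x + h *\<^sub>R w) + f x = ?A h - ?A 0"
    by (simp add: algebra_simps)
  also have "\<dots> = h * (?B h - ?B 0)" using s(3) by (simp add: algebra_simps)
  also have "\<dots> = h * (h * frechet_derivative ?d (at (x + s *\<^sub>R v + t *\<^sub>R w)) w)"
    using t(3) by simp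
  finally show ?thesis using s(1,2) t(1,2) by blast
qed

text \<open>Schwarz's theorem: the same second difference, divided by the square of a small step, is
  close to each of the two mixed derivatives at \<open>x\<close>.\<close>

lemma symmetric_second_derivatives:
  fixes f :: "'a::real_normed_vector \<Rightarrow> real"
  assumes "Ck 2 f"
  shows "frechet_derivative (\<lambda>x. frechet_derivative f (at x) v) (at x) w
       = frechet_derivative (\<lambda>x. frechet_derivative f (at x) w) (at x) v"
    (is "?P x = ?Q x")
proof (rule ccontr)
  have c: "continuous_on UNIV (\<lambda>x. frechet_derivative (\<lambda>x. frechet_derivative f (at x) v) (at x) w)"
    and df: "f differentiable_on UNIV" "(\<lambda>x. frechet_derivative f (at x) v) differentiable_on UNIV" for v w
    using assms by (simp_all add: numeral_2_eq_2)
  assume ne: "?P x \<noteq> ?Q x"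
  define e where "e = \<bar>?P x - ?Q x\<bar> / 2"
  have e: "e > 0" using ne by (simp add: e_def)
  obtain d1 where d1: "d1 > 0" "\<And>y. dist y x < d1 \<Longrightarrow> dist (?P y) (?P x) < e"
    using c[of v w] e unfolding continuous_on_iff by (metis UNIV_I)
  obtain d2 where d2: "d2 > 0" "\<And>y. dist y x < d2 \<Longrightarrow> dist (?Q y) (?Q x) < e"
    using c[of w v] e unfolding continuous_on_iff by (metis UNIV_I)
  have pos: "norm v + norm w + 1 > 0" by (simp add: add_nonneg_pos)
  \<comment> \<open>The step is so short that all intermediate points of the mean value theorem stay
    within both continuity radii; the summand 1 keeps the denominator positive and the estimate
    strict.\<close>
  define h where "h = min d1 d2 / (norm v + norm w + 1)"
  have h: "h > 0" using d1 d2 pos by (simp add: h_def)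
  have hd: "h * norm v + h * norm w < min d1 d2"
  proof -
    have "h * (norm v + norm w + 1) = min d1 d2"
      unfolding h_def using pos by simp
    moreover have "h * (norm v + norm w + 1) = h * norm v + h * norm w + h" by (simp add: algebra_simps)
    ultimately show ?thesis using h by linarith
  qed
  have near: "dist (x + s *\<^sub>R a + t *\<^sub>R b) x < min d1 d2"
    if "0 < s" "s < h" "0 < t" "t < h" "h * norm a + h * norm b < min d1 d2" for s t a b
  proof -
    have "dist (x + s *\<^sub>R a + t *\<^sub>R b) x = norm (s *\<^sub>R a + t *\<^sub>R b)" by (simp add: dist_norm)
    also have "\<dots> \<le> s * norm a + t * norm b" using that norm_triangle_ineq[of "s *\<^sub>R a" "t *\<^sub>R b"] by simp
    also have "\<dots> \<le> h * norm a + h * norm b" using that by (intro add_mono mult_right_mono) auto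
    finally show ?thesis using that(5) by simp
  qed
  obtain s t where 1: "0 < s" "s < h" "0 < t" "t < h"
    "f (x + h *\<^sub>R v + h *\<^sub>R w) - f (x + h *\<^sub>R v) - f (x + h *\<^sub>R w) + f x
     = h * (h * ?P (x + s *\<^sub>R v + t *\<^sub>R w))"
    using second_difference_mvt[OF df h] by blast
  obtain s' t' where 2: "0 < s'" "s' < h" "0 < t'" "t' < h"
    "f (x + h *\<^sub>R w + h *\<^sub>R v) - f (x + h *\<^sub>R w) - f (x + h *\<^sub>R v) + f x
     = h * (h * ?Q (x + s' *\<^sub>R w + t' *\<^sub>R v))"
    using second_difference_mvt[OF df h] by blast
  have "h * (h * ?P (x + s *\<^sub>R v + t *\<^sub>R w)) = h * (h * ?Q (x + s' *\<^sub>R w + t' *\<^sub>R v))"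
    unfolding 1(5)[symmetric] 2(5)[symmetric] by (simp add: algebra_simps)
  then have "?P (x + s *\<^sub>R v + t *\<^sub>R w) = ?Q (x + s' *\<^sub>R w + t' *\<^sub>R v)" using h by simp
  moreover have "dist (?P (x + s *\<^sub>R v + t *\<^sub>R w)) (?P x) < e"
    using near[OF 1(1-4) hd] d1(2) by simp
  moreover have "dist (?Q (x + s' *\<^sub>R w + t' *\<^sub>R v)) (?Q x) < e"
    using near[OF 2(1-4)] hd d2(2) by (simp add: add.commute)
  ultimately have "\<bar>?P x - ?Q x\<bar> < e + e" unfolding dist_real_def by linarith
  then show False by (simp add: e_def)
qed

lemma has_derivative_vec_lambda:
  fixes F :: "'n::finite \<Rightarrow> 'a::real_normed_vector \<Rightarrow> real"
  assumes "\<And>i. (F i has_derivative F' i) (at x)"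
  shows "((\<lambda>y. \<chi> i. F i y) has_derivative (\<lambda>w. \<chi> i. F' i w)) (at x)"
  by (subst has_derivative_componentwise_within)
    (auto simp: Basis_vec_def inner_axis assms)

section \<open>Gradient, Hessian and third derivative in coordinates\<close>

definition gradf :: "(real^'n::finite \<Rightarrow> real) \<Rightarrow> real^'n \<Rightarrow> real^'n" where
  "gradf f x = (\<chi> i. frechet_derivative f (at x) (axis i 1))"

definition hessf :: "(real^'n::finite \<Rightarrow> real) \<Rightarrow> real^'n \<Rightarrow> real^'n^'n" where
  "hessf f x = (\<chi> i j. frechet_derivative (\<lambda>y. frechet_derivative f (at y) (axis i 1)) (at x) (axis j 1))"

text \<open>The third derivative of \<open>f\<close> in the directions \<open>a\<close> and
  \<open>w\<close>, with the remaining argument represented by a vector through the inner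
  product.\<close>

definition thirdf :: "(real^'n::finite \<Rightarrow> real) \<Rightarrow> real^'n \<Rightarrow> real^'n \<Rightarrow> real^'n \<Rightarrow> real^'n" where
  "thirdf f x a w = frechet_derivative (\<lambda>y. hessf f y *v a) (at x) w"

lemma linear_vec_expansion:
  fixes L :: "real^'n::finite \<Rightarrow> 'b::real_vector"
  assumes "linear L"
  shows "L h = (\<Sum>i\<in>UNIV. h $ i *\<^sub>R L (axis i 1))"
proof -
  have "h = (\<Sum>i\<in>UNIV. h $ i *\<^sub>R axis i 1)"
    by (simp add: vec_eq_iff axis_def if_distrib cong: if_cong)
  then have "L h = L (\<Sum>i\<in>UNIV. h $ i *\<^sub>R axis i 1)" by simp
  then show ?thesis using assms by (simp add: linear_sum linear_scale)
qed

lemma smooth_Ck: "smooth f \<Longrightarrow> Ck m f" by (simp add: smooth_def)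

lemma smooth_derivative: "smooth f \<Longrightarrow> smooth (\<lambda>x. frechet_derivative f (at x) v)"
  by (metis smooth_def Ck.simps(2))

lemma smooth_has_derivative:
  "smooth f \<Longrightarrow> (f has_derivative frechet_derivative f (at x)) (at x)"
  using smooth_Ck[of f 1] by (simp add: differentiable_on_def frechet_derivative_works)

lemma smooth_continuous: "smooth f \<Longrightarrow> continuous_on UNIV f"
  using smooth_Ck[of f 0] by simp

context
  fixes f :: "real^'n::finite \<Rightarrow> real"
  assumes sm: "smooth f"
begin

lemma gradf_inner: "frechet_derivative f (at x) h = gradf f x \<bullet> h"
  using linear_vec_expansion[OF has_derivative_linear[OF smooth_has_derivative[OF sm, of x]], of h]
  by (simp add: gradf_def inner_vec_def mult.commute)

lemma f_has_derivative: "(f has_derivative (\<lambda>h. gradf f x \<bullet> h)) (at x)"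
  using smooth_has_derivative[OF sm, of x] by (simp add: gradf_inner[abs_def])

lemma hessf_mult:
  "hessf f x *v a = (\<chi> i. frechet_derivative (\<lambda>y. frechet_derivative f (at y) (axis i 1)) (at x) a)"
proof -
  have "frechet_derivative (\<lambda>y. frechet_derivative f (at y) (axis i 1)) (at x) a
      = (\<Sum>j\<in>UNIV. a $ j * frechet_derivative (\<lambda>y. frechet_derivative f (at y) (axis i 1)) (at x) (axis j 1))" for i
    using linear_vec_expansion[OF has_derivative_linear[OF smooth_has_derivative[OF
        smooth_derivative[OF sm, of "axis i 1"], of x]], of a]
    by (simp only: real_scaleR_def)
  then show ?thesis by (simp add: hessf_def matrix_vector_mult_def mult.commute)
qed

lemma gradf_has_derivative: "(gradf f has_derivative (\<lambda>w. hessf f x *v w)) (at x)"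
  unfolding gradf_def[abs_def] hessf_mult
  by (intro has_derivative_vec_lambda smooth_has_derivative smooth_derivative sm)

lemma hessf_symmetric: "hessf f x $ i $ j = hessf f x $ j $ i"
  by (simp add: hessf_def symmetric_second_derivatives[OF smooth_Ck[OF sm]])

lemma hessf_inner_commute: "(hessf f x *v a) \<bullet> b = a \<bullet> (hessf f x *v b)"
proof -
  have "transpose (hessf f x) = hessf f x"
    by (simp add: transpose_def vec_eq_iff hessf_symmetric[symmetric])
  then show ?thesis by (metis dot_lmul_matrix vector_transpose_matrix)
qed

lemma hessf_mult_has_derivative:
    "((\<lambda>y. hessf f y *v a) has_derivative thirdf f x a) (at x)"
  and thirdf_eq: "thirdf f x a w = (\<chi> i. frechet_derivative
      (\<lambda>y. frechet_derivative (\<lambda>y. frechet_derivative f (at y) (axis i 1)) (at y) a) (at x) w)"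
proof -
  have d: "((\<lambda>y. hessf f y *v a) has_derivative (\<lambda>w. \<chi> i. frechet_derivative
      (\<lambda>y. frechet_derivative (\<lambda>y. frechet_derivative f (at y) (axis i 1)) (at y) a) (at x) w)) (at x)"
    unfolding hessf_mult
    by (intro has_derivative_vec_lambda smooth_has_derivative smooth_derivative sm)
  then have "thirdf f x a = (\<lambda>w. \<chi> i. frechet_derivative
      (\<lambda>y. frechet_derivative (\<lambda>y. frechet_derivative f (at y) (axis i 1)) (at y) a) (at x) w)"
    unfolding thirdf_def[abs_def] by (rule frechet_derivative_at[symmetric])
  with d show "((\<lambda>y. hessf f y *v a) has_derivative thirdf f x a) (at x)"
    "thirdf f x a w = (\<chi> i. frechet_derivative
      (\<lambda>y. frechet_derivative (\<lambda>y. frechet_derivative f (at y) (axis i 1)) (at y) a) (at x) w)"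
    by simp_all
qed

lemma thirdf_commute: "thirdf f x a w = thirdf f x w a"
  by (simp add: thirdf_eq symmetric_second_derivatives[OF smooth_Ck[OF smooth_derivative[OF sm]]])

lemma linear_thirdf: "linear (thirdf f x a)"
  using hessf_mult_has_derivative by (rule has_derivative_linear)

text \<open>Differentiates the symmetry of the Hessian. With \<open>thirdf_commute\<close> it makes
  the third derivative symmetric in all three arguments.\<close>

lemma thirdf_inner_commute: "thirdf f x a w \<bullet> b = thirdf f x b w \<bullet> a"
proof -
  have "((\<lambda>y. (hessf f y *v a) \<bullet> b) has_derivative (\<lambda>w. thirdf f x a w \<bullet> b)) (at x)" for a b
    by (intro has_derivative_inner_left hessf_mult_has_derivative)
  from has_derivative_unique[OF this[of a b]] this[of b a]
  show ?thesis by (metis (no_types, lifting) ext hessf_inner_commute inner_commute)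
qed

text \<open>Expansion over the coordinate axes reduces the bound to finitely many continuous
  functions on a compact set.\<close>

lemma thirdf_bounded:
  assumes "compact K"
  obtains M where "M \<ge> 0" "\<And>x a b. x \<in> K \<Longrightarrow> norm (thirdf f x a b) \<le> M * norm a * norm b"
proof -
  have "continuous_on UNIV (\<lambda>x. thirdf f x a b)" for a b
    unfolding thirdf_eq
    by (intro continuous_on_vec_lambda smooth_continuous smooth_derivative sm)
  then have "bounded ((\<lambda>x. thirdf f x a b) ` K)" for a b
    using assms by (meson compact_continuous_image compact_imp_bounded continuous_on_subset subset_UNIV)
  then have "\<exists>c. \<forall>x\<in>K. norm (thirdf f x a b) \<le> c" for a b
    by (auto simp: bounded_iff)
  then obtain c where c: "\<And>a b x. x \<in> K \<Longrightarrow> norm (thirdf f x a b) \<le> c a b" by metis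
  define C where "C i j = \<bar>c (axis i 1) (axis j 1)\<bar>" for i j :: 'n
  define M where "M = (\<Sum>i\<in>UNIV. \<Sum>j\<in>UNIV. C i j)"
  have M: "M \<ge> 0" unfolding M_def by (intro sum_nonneg) (simp add: C_def)
  moreover have "norm (thirdf f x a b) \<le> M * norm a * norm b" if "x \<in> K" for x a b
  proof -
    have "thirdf f x a b = (\<Sum>j\<in>UNIV. b $ j *\<^sub>R thirdf f x a (axis j 1))"
      by (rule linear_vec_expansion[OF linear_thirdf])
    also have "\<dots> = (\<Sum>j\<in>UNIV. b $ j *\<^sub>R (\<Sum>i\<in>UNIV. a $ i *\<^sub>R thirdf f x (axis i 1) (axis j 1)))"
      using linear_vec_expansion[OF linear_thirdf, of x _ a]
      by (simp add: thirdf_commute[of x a] thirdf_commute[of x "axis _ 1" "axis _ 1"])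
    also have "norm \<dots> \<le> (\<Sum>j\<in>UNIV. norm b * (\<Sum>i\<in>UNIV. norm a * C i j))"
    proof (intro sum_norm_le)
      fix j
      have "norm (\<Sum>i\<in>UNIV. a $ i *\<^sub>R thirdf f x (axis i 1) (axis j 1)) \<le> (\<Sum>i\<in>UNIV. norm a * C i j)"
      proof (intro sum_norm_le)
        fix i
        have "norm (thirdf f x (axis i 1) (axis j 1)) \<le> C i j"
          unfolding C_def by (rule order_trans[OF c[OF that]]) simp
        then show "norm (a $ i *\<^sub>R thirdf f x (axis i 1) (axis j 1)) \<le> norm a * C i j"
          by (simp add: mult_mono component_le_norm_cart)
      qed
      then show "norm (b $ j *\<^sub>R (\<Sum>i\<in>UNIV. a $ i *\<^sub>R thirdf f x (axis i 1) (axis j 1)))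
          \<le> norm b * (\<Sum>i\<in>UNIV. norm a * C i j)"
        by (simp add: mult_mono component_le_norm_cart)
    qed
    also have "\<dots> = (\<Sum>j\<in>UNIV. \<Sum>i\<in>UNIV. C i j) * norm a * norm b"
      by (simp add: sum_distrib_left sum_distrib_right mult_ac)
    also have "(\<Sum>j\<in>UNIV. \<Sum>i\<in>UNIV. C i j) = M" unfolding M_def by (rule sum.swap)
    finally show ?thesis .
  qed
  ultimately show ?thesis using that by blast
qed

end

section \<open>The power function and its domain\<close>

lemma zpower_has_derivative:
  assumes "\<alpha> \<in> \<int> \<Longrightarrow> z \<noteq> 0 \<or> \<alpha> \<ge> 1" and "\<alpha> \<notin> \<int> \<Longrightarrow> z > 0"
  shows "(zpower \<alpha> has_real_derivative \<alpha> * zpower (\<alpha> - 1) z) (at z)"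
proof (cases "\<alpha> \<in> \<int>")
  case True
  define n where "n = \<lfloor>\<alpha>\<rfloor>"
  have an: "\<alpha> = of_int n" using True by (auto simp: n_def elim: Ints_cases)
  have *: "zpower \<alpha> = (\<lambda>z. z powi n)" "zpower (\<alpha> - 1) z = z powi (n - 1)"
    by (auto simp: zpower_def an fun_eq_iff)
  show ?thesis
  proof (cases "n \<ge> 1")
    case True
    then have "(\<lambda>z::real. z powi n) = (\<lambda>z. z ^ nat n)" "z powi (n - 1) = z ^ (nat n - Suc 0)"
      by (auto simp: power_int_def nat_diff_distrib)
    moreover have "((\<lambda>z. z ^ nat n) has_real_derivative real (nat n) * z ^ (nat n - Suc 0)) (at z)"
      by (rule DERIV_pow)
    ultimately show ?thesis using True unfolding * by (simp add: an)
  next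
    case False
    then have "z \<noteq> 0" using assms(1) \<open>\<alpha> \<in> \<int>\<close> by (auto simp: an)
    then have "((\<lambda>z. z powi n) has_derivative (\<lambda>y. y * (of_int n * z powi (n - 1)))) (at z)"
      by (rule has_derivative_power_int')
    then show ?thesis unfolding * has_field_derivative_def by (simp add: an mult_commute_abs)
  qed
next
  case False
  then have "z > 0" "\<alpha> - 1 \<notin> \<int>" using assms(2) by (auto dest: Ints_add[OF _ Ints_1])
  then show ?thesis using False has_real_derivative_powr[of z \<alpha>]
    by (simp add: zpower_def[abs_def])
qed

lemma zpower_pos: "z > 0 \<Longrightarrow> zpower \<alpha> z = z powr \<alpha>"
  by (auto simp: zpower_def powr_real_of_int' elim: Ints_cases)

lemma zpower_neg:
  assumes "z < 0" "\<alpha> \<in> \<int>"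
  shows "zpower \<alpha> z = (if even \<lfloor>\<alpha>\<rfloor> then 1 else -1) * (- z) powr \<alpha>"
proof -
  define n where "n = \<lfloor>\<alpha>\<rfloor>"
  have "\<alpha> = of_int n" using assms by (auto simp: n_def elim: Ints_cases)
  then have "(- z) powr \<alpha> = (- z) powi n" using assms by (simp add: powr_real_of_int')
  moreover have "zpower \<alpha> z = (- (- z)) powi n" using assms by (simp add: zpower_def n_def)
  ultimately show ?thesis by (simp only: power_int_minus_left n_def[symmetric]) simp
qed

lemma abs_zpower:
  assumes "z > 0 \<or> (z < 0 \<and> \<alpha> \<in> \<int>)"
  shows "\<bar>zpower \<alpha> z\<bar> = \<bar>z\<bar> powr \<alpha>"
  using assms by (auto simp: zpower_pos zpower_neg abs_mult)

lemma zpower_minus_one: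
  assumes "z > 0 \<or> (z < 0 \<and> \<alpha> \<in> \<int>)"
  shows "zpower (\<alpha> - 1) z = zpower \<alpha> z / z"
proof (cases "z > 0")
  case True then show ?thesis by (simp add: zpower_pos powr_diff)
next
  case False
  then have z: "z < 0" "\<alpha> \<in> \<int>" using assms by auto
  then have "\<lfloor>\<alpha> - 1\<rfloor> = \<lfloor>\<alpha>\<rfloor> - 1" by simp
  moreover have "(- z) powr (\<alpha> - 1) = (-z) powr \<alpha> / (- z)" using z by (simp add: powr_diff)
  ultimately show ?thesis using z by (simp add: zpower_neg)
qed

lemma components_power_domain:
  assumes "J \<in> components (power_domain \<alpha>)"
  shows "(\<alpha> \<in> \<nat> \<and> J = UNIV) \<or> (\<alpha> \<notin> \<nat> \<and> J = {0<..}) \<or> (\<alpha> \<in> \<int> \<and> \<alpha> \<notin> \<nat> \<and> J = {..<0})"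
proof -
  have J: "J \<noteq> {}" "J \<subseteq> power_domain \<alpha>" "connected J"
    and max: "\<And>d. d \<noteq> {} \<Longrightarrow> J \<subseteq> d \<Longrightarrow> d \<subseteq> power_domain \<alpha> \<Longrightarrow> connected d \<Longrightarrow> d = J"
    using assms unfolding in_components_maximal by blast+
  consider "\<alpha> \<in> \<nat>" | "\<alpha> \<notin> \<int>" | "\<alpha> \<in> \<int>" "\<alpha> \<notin> \<nat>" by blast
  then show ?thesis
  proof cases
    case 1
    then have "UNIV = J" by (intro max) (auto simp: power_domain_def)
    then show ?thesis using 1 by auto
  next
    case 2
    then have a: "\<alpha> \<notin> \<nat>" using Nats_subset_Ints by blast
    have "{0<..} = J" using J 2 a by (intro max) (auto simp: power_domain_def)
    then show ?thesis using a by auto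
  next
    case 3
    then have 0: "0 \<notin> J" using J by (auto simp: power_domain_def)
    obtain a where a: "a \<in> J" using J by blast
    then have "a \<noteq> 0" using 0 by metis
    have iv: "x \<in> J \<Longrightarrow> y \<in> J \<Longrightarrow> x \<le> z \<Longrightarrow> z \<le> y \<Longrightarrow> z \<in> J" for x y z
      using J(3) by (meson connectedD_interval)
    show ?thesis
    proof (cases "a > 0")
      case True
      have "J \<subseteq> {0<..}" using iv[of _ a 0] a 0 True by force
      then have "{0<..} = J" using 3 by (intro max) (auto simp: power_domain_def)
      then show ?thesis using 3 by auto
    next
      case False
      have "J \<subseteq> {..<0}" using iv[of a _ 0] a 0 False by force
      then have "{..<0} = J" using 3 by (intro max) (auto simp: power_domain_def)
      then show ?thesis using 3 by auto
    qed
  qed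
qed

lemma gderiv_graph:
  fixes f :: "real^'n::finite \<Rightarrow> real"
  assumes sm: "smooth f"
  shows "grad (\<lambda>(x, z). z - f x) p = (- gradf f (fst p), 1)"
    "(grad (\<lambda>(x, z). z - f x) has_derivative (\<lambda>w. (- (hessf f (fst p) *v fst w), 0))) (at p)"
proof -
  have g: "grad (\<lambda>(x, z). z - f x) p = (- gradf f (fst p), 1)" for p
  proof (rule grad_eqI)
    have "((\<lambda>p. snd p - f (fst p)) has_derivative (\<lambda>h. snd h - gradf f (fst p) \<bullet> fst h)) (at p)"
      by (intro has_derivative_diff has_derivative_snd has_derivative_ident
          has_derivative_compose[OF has_derivative_fst[OF has_derivative_ident] f_has_derivative[OF sm]])
    then show "GDERIV (\<lambda>(x, z). z - f x) p :> (- gradf f (fst p), 1)"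
      by (simp add: gderiv_def case_prod_beta' inner_prod_def inner_commute)
  qed
  show "grad (\<lambda>(x, z). z - f x) p = (- gradf f (fst p), 1)" by (rule g)
  have "grad (\<lambda>(x, z). z - f x) = (\<lambda>p. (- gradf f (fst p), 1))" using g by blast
  moreover have "((\<lambda>p. (- gradf f (fst p), 1::real)) has_derivative (\<lambda>w. (- (hessf f (fst p) *v fst w), 0))) (at p)"
    by (intro has_derivative_Pair has_derivative_minus has_derivative_const
        has_derivative_compose[OF has_derivative_fst[OF has_derivative_ident] gradf_has_derivative[OF sm]])
  ultimately show "(grad (\<lambda>(x, z). z - f x) has_derivative (\<lambda>w. (- (hessf f (fst p) *v fst w), 0))) (at p)"
    by simp
qed

section \<open>Positivity and growth of a strictly convex function\<close>

context
  fixes f :: "real^'n::finite \<Rightarrow> real"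
  assumes sm: "smooth f" and sc: "strictly_convex_fun f"
begin

text \<open>Each \<open>u\<close> lifts to the tangent vector
  \<open>(u, gradf f x \<bullet> u)\<close> of the graph. The Hessian of \<open>z - f x\<close>
  ignores the vertical component, so positive normal curvature in that direction is positivity of
  the Hessian of \<open>f\<close> at \<open>u\<close>.\<close>

lemma hessf_pos:
  assumes "u \<noteq> 0" shows "(hessf f x *v u) \<bullet> u > 0"
proof -
  let ?g = "\<lambda>(x, z). z - f x" and ?p = "(x, f x)"
  have n0: "grad ?g ?p \<noteq> 0" by (simp add: gderiv_graph[OF sm] zero_prod_def)
  have "pos_normal_curvatures (\<lambda>y. 1 *\<^sub>R unit_grad ?g y) ?p"
    using sc by (simp add: strictly_convex_fun_def)
  then have *: "\<And>w. w \<noteq> 0 \<Longrightarrow> w \<bullet> grad ?g ?p = 0 \<Longrightarrow> 1 * ((- (hessf f (fst ?p) *v fst w), 0) \<bullet> w) < 0"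
    by (subst (asm) pos_normal_curvatures_unit_grad[OF gderiv_graph(2)[OF sm] n0]) auto
  let ?w = "(u, gradf f x \<bullet> u)"
  have "?w \<noteq> 0" using assms by (simp add: zero_prod_def)
  moreover have "?w \<bullet> grad ?g ?p = 0"
    by (simp add: gderiv_graph[OF sm] inner_prod_def inner_commute)
  ultimately show ?thesis using *[of ?w] by (simp add: inner_prod_def)
qed

lemma line_derivative: "((\<lambda>t. f (x + t *\<^sub>R u)) has_real_derivative gradf f (x + t *\<^sub>R u) \<bullet> u) (at t)"
  and line_second_derivative:
    "((\<lambda>t. gradf f (x + t *\<^sub>R u) \<bullet> v) has_real_derivative (hessf f (x + t *\<^sub>R u) *v u) \<bullet> v) (at t)"
proof -
  have l: "((\<lambda>t. x + t *\<^sub>R u) has_derivative (\<lambda>t. t *\<^sub>R u)) (at t)"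
    by (auto intro!: derivative_eq_intros)
  show "((\<lambda>t. f (x + t *\<^sub>R u)) has_real_derivative gradf f (x + t *\<^sub>R u) \<bullet> u) (at t)"
    using has_derivative_compose[OF l f_has_derivative[OF sm]]
    by (simp add: has_field_derivative_def mult_commute_abs)
  show "((\<lambda>t. gradf f (x + t *\<^sub>R u) \<bullet> v) has_real_derivative (hessf f (x + t *\<^sub>R u) *v u) \<bullet> v) (at t)"
    using has_derivative_inner_left[OF has_derivative_compose[OF l gradf_has_derivative[OF sm]], of v]
    by (simp add: has_field_derivative_def matrix_vector_mult_scaleR mult_commute_abs)
qed

lemma gradf_strict_mono:
  assumes "u \<noteq> 0" "s < t"
  shows "gradf f (x + s *\<^sub>R u) \<bullet> u < gradf f (x + t *\<^sub>R u) \<bullet> u"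
  using assms(2) line_second_derivative[of x u u] hessf_pos[OF assms(1)]
  by (intro DERIV_pos_imp_increasing[of s t "\<lambda>t. gradf f (x + t *\<^sub>R u) \<bullet> u"]) blast+

lemma f_above_tangent:
  assumes "x \<noteq> y"
  shows "f y > f x + gradf f x \<bullet> (y - x)"
proof -
  let ?u = "y - x"
  have u: "?u \<noteq> 0" using assms by simp
  have "\<exists>s>0. s < 1 \<and> f (x + 1 *\<^sub>R ?u) - f (x + 0 *\<^sub>R ?u) = (1 - 0) * (gradf f (x + s *\<^sub>R ?u) \<bullet> ?u)"
    by (intro MVT2) (auto intro: line_derivative)
  then obtain s where s: "s > 0" "f y - f x = gradf f (x + s *\<^sub>R ?u) \<bullet> ?u" by auto
  then show ?thesis using gradf_strict_mono[OF u s(1), of x] by simp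
qed

lemma gradf_zero_unique: "gradf f x = 0 \<Longrightarrow> gradf f y = 0 \<Longrightarrow> x = y"
  using f_above_tangent[of x y] f_above_tangent[of y x] by force

lemma exists_gradf_nonzero: "\<exists>x. gradf f x \<noteq> 0"
proof -
  have "(0::real^'n) \<noteq> axis undefined 1" by (metis axis_eq_0_iff zero_neq_one)
  then show ?thesis using gradf_zero_unique by metis
qed

text \<open>The graph lies above its tangent hyperplane, which rises at a constant rate along the
  gradient; \<open>t\<close> is chosen so that this rise exceeds the gap between \<open>f x\<close>
  and \<open>B\<close>.\<close>

lemma f_unbounded:
  assumes "gradf f x \<noteq> 0" shows "\<exists>t>0. f (x + t *\<^sub>R gradf f x) > B"
proof -
  let ?u = "gradf f x"
  define t where "t = (\<bar>B - f x\<bar> + 1) / (?u \<bullet> ?u)"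
  have uu: "?u \<bullet> ?u > 0" using assms by simp
  then have t: "t > 0" unfolding t_def by (simp add: add_nonneg_pos)
  have "x \<noteq> x + t *\<^sub>R ?u" using t assms by simp
  from f_above_tangent[OF this] have "f (x + t *\<^sub>R ?u) > f x + t * (?u \<bullet> ?u)" by simp
  also have "t * (?u \<bullet> ?u) = \<bar>B - f x\<bar> + 1" using uu by (simp add: t_def)
  finally show ?thesis using t by (intro exI[of _ t]) auto
qed

lemma f_continuous: "continuous_on A f"
  using smooth_continuous[OF sm] continuous_on_subset by blast

lemma f_attains:
  assumes "f x \<le> c" shows "\<exists>y. f y = c"
proof -
  obtain x' t where "f (x' + t *\<^sub>R gradf f x') > c"
    using exists_gradf_nonzero f_unbounded by metis
  moreover have "connected (f ` UNIV)"
    using connected_UNIV f_continuous by (rule connected_continuous_image[rotated])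
  ultimately show ?thesis using assms connectedD_interval[of "range f" "f x" _ c]
    by (metis (full_types) less_imp_le rangeE rangeI)
qed

end

lemma zpower_derivs:
  assumes "\<alpha> \<noteq> 0" "\<alpha> \<noteq> 1" "J \<in> components (power_domain \<alpha>)" "z \<in> J"
  shows "(zpower \<alpha> has_real_derivative \<alpha> * zpower (\<alpha> - 1) z) (at z)"
    "((\<lambda>z. \<alpha> * zpower (\<alpha> - 1) z) has_real_derivative \<alpha> * (\<alpha> - 1) * zpower (\<alpha> - 2) z) (at z)"
proof -
  \<comment> \<open>The origin lies in the domain only for natural exponents, and these are at least
    2 because 0 and 1 are excluded; so both derivatives exist there too.\<close>
  have c: "z \<noteq> 0 \<or> \<alpha> \<ge> 2" "\<alpha> \<notin> \<int> \<Longrightarrow> z > 0"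
  proof -
    show "z \<noteq> 0 \<or> \<alpha> \<ge> 2"
    proof (cases "\<alpha> \<in> \<nat>")
      case True
      then obtain n where n: "\<alpha> = real n" by (auto elim: Nats_cases)
      then have "n \<ge> 2" using assms by (cases n rule: nat.exhaust; cases "n = 1") auto
      then show ?thesis by (simp add: n)
    qed (use components_power_domain[OF assms(3)] assms(4) in auto)
    show "z > 0" if "\<alpha> \<notin> \<int>"
      using components_power_domain[OF assms(3)] assms(4) that Nats_subset_Ints by auto
  qed
  then show "(zpower \<alpha> has_real_derivative \<alpha> * zpower (\<alpha> - 1) z) (at z)"
    by (intro zpower_has_derivative) auto
  have i: "\<alpha> - 1 \<in> \<int> \<longleftrightarrow> \<alpha> \<in> \<int>" by (metis Ints_1 Ints_add Ints_diff diff_add_cancel)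
  have "(zpower (\<alpha> - 1) has_real_derivative (\<alpha> - 1) * zpower (\<alpha> - 1 - 1) z) (at z)"
    using c by (intro zpower_has_derivative) (auto simp: i)
  from DERIV_cmult[OF this, of \<alpha>]
  show "((\<lambda>z. \<alpha> * zpower (\<alpha> - 1) z) has_real_derivative \<alpha> * (\<alpha> - 1) * zpower (\<alpha> - 2) z) (at z)"
    by (simp add: mult.assoc)
qed

section \<open>The function \<open>g\<close> over one component of its domain\<close>

locale power_sum =
  fixes f :: "real^'n::finite \<Rightarrow> real" and \<alpha> :: real
    and J :: "real set" and D :: "'n pt set" and g :: "'n pt \<Rightarrow> real"
  assumes sm: "smooth f" and f_nonneg: "\<And>x. f x \<ge> 0" and sc: "strictly_convex_fun f"
    and alpha: "\<alpha> \<noteq> 0" "\<alpha> \<noteq> 1" and J: "J \<in> components (power_domain \<alpha>)"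
    and D: "D = UNIV \<times> J" and g: "g = g_fun \<alpha> f"
begin

definition "\<phi>1 z = \<alpha> * zpower (\<alpha> - 1) z"
definition "\<phi>2 z = \<alpha> * (\<alpha> - 1) * zpower (\<alpha> - 2) z"

lemma phi_deriv: "z \<in> J \<Longrightarrow> (zpower \<alpha> has_real_derivative \<phi>1 z) (at z)"
  and phi1_deriv: "z \<in> J \<Longrightarrow> (\<phi>1 has_real_derivative \<phi>2 z) (at z)"
  using zpower_derivs[OF alpha J, of z] by (auto simp: \<phi>1_def[abs_def] \<phi>2_def)

lemma J_cases:
  obtains "\<alpha> \<in> \<nat>" "\<alpha> \<ge> 2" "J = UNIV" | "\<alpha> \<notin> \<nat>" "J = {0<..}" | "\<alpha> \<in> \<int>" "\<alpha> < 0" "\<alpha> \<notin> \<nat>" "J = {..<0}"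
proof -
  have 1: "\<alpha> \<ge> 2" if n: "\<alpha> \<in> \<nat>"
  proof -
    obtain n where n: "\<alpha> = real n" using n by (auto elim: Nats_cases)
    then have "n \<noteq> 0" "n \<noteq> 1" using alpha by auto
    then have "n \<ge> 2" by simp
    then show ?thesis by (simp add: n)
  qed
  have 2: "\<alpha> < 0" if n: "\<alpha> \<in> \<int>" "\<alpha> \<notin> \<nat>"
  proof -
    obtain k where k: "\<alpha> = of_int k" using n by (auto elim: Ints_cases)
    then have "\<not> k \<ge> 0" using n by (metis of_int_0_le_iff of_int_of_nat_eq of_nat_in_Nats zero_le_imp_eq_int)
    then show ?thesis by (simp add: k)
  qed
  show ?thesis using components_power_domain[OF J] 1 2 that by blast
qed

lemma open_J: "open J" by (rule J_cases) auto
lemma open_D: "open D" by (simp add: D open_Times open_J)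

lemma J_nonzero:
  assumes "z \<in> J" "z \<noteq> 0" shows "z > 0 \<or> (z < 0 \<and> \<alpha> \<in> \<int>)"
  using assms by (cases rule: J_cases) (use Nats_subset_Ints in force)+

lemma zpower_nonzero: "z \<in> J \<Longrightarrow> z \<noteq> 0 \<Longrightarrow> zpower \<alpha> z \<noteq> 0"
  using abs_zpower[OF J_nonzero, of z] by auto

lemma phi1_eq: "z \<in> J \<Longrightarrow> z \<noteq> 0 \<Longrightarrow> \<phi>1 z = \<alpha> * zpower \<alpha> z / z"
  using zpower_minus_one[OF J_nonzero, of z] by (simp add: \<phi>1_def)

lemma phi2_eq: "z \<in> J \<Longrightarrow> z \<noteq> 0 \<Longrightarrow> \<phi>2 z = \<alpha> * (\<alpha> - 1) * zpower \<alpha> z / z\<^sup>2"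
proof -
  assume z: "z \<in> J" "z \<noteq> 0"
  have "z > 0 \<or> (z < 0 \<and> \<alpha> - 1 \<in> \<int>)" using J_nonzero[OF z] by auto
  from zpower_minus_one[OF this] zpower_minus_one[OF J_nonzero[OF z]]
  show ?thesis by (simp add: \<phi>2_def power2_eq_square)
qed

lemma phi1_nonzero: "z \<in> J \<Longrightarrow> z \<noteq> 0 \<Longrightarrow> \<phi>1 z \<noteq> 0"
  using phi1_eq zpower_nonzero alpha by simp

lemma g_apply: "g (x, z) = zpower \<alpha> z + f x" by (simp add: g g_fun_def)

lemma g_gderiv: "y \<in> D \<Longrightarrow> GDERIV g y :> (gradf f (fst y), \<phi>1 (snd y))"
proof -
  assume "y \<in> D"
  then have "snd y \<in> J" by (auto simp: D)
  have geq: "g = (\<lambda>p. zpower \<alpha> (snd p) + f (fst p))" by (auto simp: g g_fun_def fun_eq_iff)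
  have "((\<lambda>p. zpower \<alpha> (snd p) + f (fst p)) has_derivative
      (\<lambda>h. \<phi>1 (snd y) * snd h + gradf f (fst y) \<bullet> fst h)) (at y)"
    by (intro has_derivative_add
        has_derivative_compose[OF has_derivative_fst[OF has_derivative_ident] f_has_derivative[OF sm]]
        has_derivative_compose[OF has_derivative_snd[OF has_derivative_ident]
          phi_deriv[OF \<open>snd y \<in> J\<close>, unfolded has_field_derivative_def]])
  then show ?thesis unfolding geq gderiv_def
    by (simp add: inner_prod_def inner_commute add.commute mult.commute)
qed

lemma grad_g: "y \<in> D \<Longrightarrow> grad g y = (gradf f (fst y), \<phi>1 (snd y))"
  using g_gderiv by (rule grad_eqI)

lemma g_GDERIV: "y \<in> D \<Longrightarrow> GDERIV g y :> grad g y"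
  using g_gderiv grad_g by simp

definition "Hg y w = (hessf f (fst y) *v fst w, \<phi>2 (snd y) * snd w)"

lemma grad_g_has_derivative: 
  assumes "y \<in> D" shows "(grad g has_derivative Hg y) (at y)"
proof -
  have "snd y \<in> J" using assms by (auto simp: D)
  have "((\<lambda>p. (gradf f (fst p), \<phi>1 (snd p))) has_derivative Hg y) (at y)"
    unfolding Hg_def[abs_def]
    by (intro has_derivative_Pair
        has_derivative_compose[OF has_derivative_fst[OF has_derivative_ident] gradf_has_derivative[OF sm]]
        has_derivative_compose[OF has_derivative_snd[OF has_derivative_ident]
          phi1_deriv[OF \<open>snd y \<in> J\<close>, unfolded has_field_derivative_def]])
  then show ?thesis
    by (rule has_derivative_transform_within_open[OF _ open_D assms]) (simp add: grad_g)
qed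

lemma continuous_grad_g: "continuous_on D (grad g)"
  using grad_g_has_derivative by (metis continuous_at_imp_continuous_on has_derivative_continuous)

lemma level_iff: "(x, z) \<in> level D g k \<longleftrightarrow> z \<in> J \<and> zpower \<alpha> z = k - f x"
  by (auto simp: level_def D g_apply)

end

section \<open>Gauss-Kronecker curvature of the levels\<close>

lemma linear_isometry_inner:
  fixes T :: "'a::real_inner \<Rightarrow> 'b::real_inner"
  assumes "linear T" "\<And>u. norm (T u) = norm u"
  shows "T u \<bullet> T v = u \<bullet> v"
  using assms by (simp add: dot_norm linear_add[OF assms(1), symmetric])

text \<open>\<open>frame\<close> is a choice among isometries whose existence follows from equal
  dimensions. An isometric image of full dimension fills the hyperplane, which gives the last
  claim.\<close>

lemma frame_props:
  fixes \<nu> :: "'n::finite pt"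
  assumes "\<nu> \<noteq> 0"
  shows "linear (frame \<nu>)" "norm (frame \<nu> u) = norm u" "frame \<nu> u \<bullet> \<nu> = 0"
    "frame \<nu> u \<bullet> frame \<nu> v = u \<bullet> v" "y \<bullet> \<nu> = 0 \<Longrightarrow> \<exists>u. y = frame \<nu> u"
proof -
  let ?S = "{y. \<nu> \<bullet> y = 0}"
  have S: "subspace ?S" by (rule subspace_hyperplane)
  have dS: "dim ?S = CARD('n)" using assms by (simp add: dim_hyperplane)
  have "\<exists>T :: real^'n \<Rightarrow> 'n pt. linear T \<and> (\<forall>u. norm (T u) = norm u) \<and> (\<forall>u. T u \<bullet> \<nu> = 0)"
  proof (rule isometry_subset_subspace[OF subspace_UNIV S])
    show "dim (UNIV :: (real^'n) set) \<le> dim ?S" using dS by simp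
  qed (auto simp: inner_commute Pi_iff)
  then have "linear (frame \<nu>) \<and> (\<forall>u. norm (frame \<nu> u) = norm u) \<and> (\<forall>u. frame \<nu> u \<bullet> \<nu> = 0)"
    unfolding frame_def by (rule someI_ex)
  then show l: "linear (frame \<nu>)" and n: "norm (frame \<nu> u) = norm u" and o: "frame \<nu> u \<bullet> \<nu> = 0" for u
    by auto
  show "frame \<nu> u \<bullet> frame \<nu> v = u \<bullet> v" by (rule linear_isometry_inner[OF l n])
  show "\<exists>u. y = frame \<nu> u" if "y \<bullet> \<nu> = 0"
  proof -
    have inj: "inj (frame \<nu>)" by (rule linear_isometry_inj[OF l n])
    have "dim (range (frame \<nu>)) = dim (UNIV :: (real^'n) set)"
      by (rule dim_image_eq[OF l]) (use inj in \<open>auto simp: inj_on_def\<close>)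
    then have "dim (range (frame \<nu>)) = dim ?S" using dS by simp
    moreover have "range (frame \<nu>) \<subseteq> ?S" using o by (auto simp: inner_commute)
    moreover have "subspace (range (frame \<nu>))" using l by (simp add: linear_subspace_image)
    ultimately have "range (frame \<nu>) = ?S" using S subspace_dim_equal by (metis order_refl)
    then show ?thesis using that by (auto simp: inner_commute)
  qed
qed

lemma frame_decomposition:
  fixes \<nu> :: "'n::finite pt"
  assumes n: "norm \<nu> = 1"
  obtains u where "a = frame \<nu> u + (a \<bullet> \<nu>) *\<^sub>R \<nu>"
proof -
  have "\<nu> \<noteq> 0" and nn: "\<nu> \<bullet> \<nu> = 1" using n by (auto simp: norm_eq_1)
  then have "(a - (a \<bullet> \<nu>) *\<^sub>R \<nu>) \<bullet> \<nu> = 0" by (simp add: inner_diff_left)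
  then obtain u where "a - (a \<bullet> \<nu>) *\<^sub>R \<nu> = frame \<nu> u" using frame_props(5)[OF \<open>\<nu> \<noteq> 0\<close>] by blast
  then have "a = frame \<nu> u + (a \<bullet> \<nu>) *\<^sub>R \<nu>" by (simp add: algebra_simps)
  then show ?thesis using that by blast
qed

text \<open>The images of the coordinate axes together with \<open>\<nu>\<close> form an orthonormal
  basis.\<close>

lemma frame_parseval:
  fixes \<nu> :: "'n::finite pt"
  assumes n: "norm \<nu> = 1"
  shows "a \<bullet> b = (\<Sum>k\<in>UNIV. (a \<bullet> frame \<nu> (axis k 1)) * (b \<bullet> frame \<nu> (axis k 1))) + (a \<bullet> \<nu>) * (b \<bullet> \<nu>)"
proof -
  have "\<nu> \<noteq> 0" and nn: "\<nu> \<bullet> \<nu> = 1" using n by (auto simp: norm_eq_1)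
  note fp = frame_props[OF \<open>\<nu> \<noteq> 0\<close>]
  obtain u where u: "a = frame \<nu> u + (a \<bullet> \<nu>) *\<^sub>R \<nu>" by (rule frame_decomposition[OF n])
  obtain v where v: "b = frame \<nu> v + (b \<bullet> \<nu>) *\<^sub>R \<nu>" by (rule frame_decomposition[OF n])
  have c: "a \<bullet> frame \<nu> (axis k 1) = u $ k" "b \<bullet> frame \<nu> (axis k 1) = v $ k" for k
    by (subst u v, simp add: inner_add_left fp inner_commute[of \<nu>] inner_axis)+
  have "a \<bullet> b = (frame \<nu> u + (a \<bullet> \<nu>) *\<^sub>R \<nu>) \<bullet> (frame \<nu> v + (b \<bullet> \<nu>) *\<^sub>R \<nu>)" using u v by metis
  also have "\<dots> = u \<bullet> v + (a \<bullet> \<nu>) * (b \<bullet> \<nu>)"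
    by (simp add: inner_add_left inner_add_right fp nn inner_commute[of \<nu> "frame _ _"])
  finally show ?thesis by (simp add: c inner_vec_def)
qed

context power_sum
begin

text \<open>Where \<open>\<phi>1 z\<close> is nonzero, tangent vectors are determined by their
  \<open>x\<close>-component. Up to the factor \<open>- s / m\<close> the second fundamental form is
  therefore the pullback under the projection \<open>P\<close> of the Hessian of \<open>f\<close>
  plus a rank one term in its gradient. What remains is the square of \<open>det P\<close> and the
  determinant of this form.\<close>

lemma gauss_kronecker_formula:
  assumes xz: "(x, z) \<in> D" "z \<noteq> 0" and s: "s = 1 \<or> s = - 1"
    and xi: "hessf f x *v \<xi> = gradf f x"
  shows "gauss_kronecker (\<lambda>y. s *\<^sub>R unit_grad g y) (x, z) * norm (grad g (x, z)) ^ (CARD('n) + 2)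
    = (- s) ^ CARD('n) * det (hessf f x) * ((\<phi>1 z)\<^sup>2 + \<phi>2 z * (gradf f x \<bullet> \<xi>))"
proof -
  let ?p = "(x, z)"
  have zJ: "z \<in> J" using xz by (simp add: D)
  have p1: "\<phi>1 z \<noteq> 0" using phi1_nonzero zJ xz by simp
  have gr: "grad g ?p = (gradf f x, \<phi>1 z)" using grad_g[OF xz(1)] by simp
  have n0: "grad g ?p \<noteq> 0" using p1 by (simp add: gr zero_prod_def)
  define m where "m = norm (grad g ?p)"
  have m: "m > 0" using n0 by (simp add: m_def)
  define \<nu> where "\<nu> = s *\<^sub>R unit_grad g ?p"
  have nu: "\<nu> = (s / m) *\<^sub>R grad g ?p" by (simp add: \<nu>_def unit_grad_def m_def divide_inverse)
  have nn: "norm \<nu> = 1" using s norm_unit_grad[OF n0] by (auto simp: \<nu>_def)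
  then have nu0: "\<nu> \<noteq> 0" by auto
  note fp = frame_props[OF nu0]
  define T where "T k = frame \<nu> (axis k 1)" for k
  have Tg: "T k \<bullet> grad g ?p = 0" for k
    using fp(3)[of "axis k 1"] s m by (auto simp: T_def nu)
  have snd_T: "snd (T k) = - (gradf f x \<bullet> fst (T k)) / \<phi>1 z" for k
    using Tg[of k] p1 by (simp add: gr inner_prod_def inner_commute field_simps)
  define c where "c = \<phi>2 z / (\<phi>1 z)\<^sup>2"
  define b where "b = gradf f x"
  define B where "B = (\<chi> i j. hessf f x $ i $ j + c * (b $ i * b $ j))"
  define P :: "real^'n^'n" where "P = (\<chi> i j. fst (T j) $ i)"
  have Bv: "B *v u = hessf f x *v u + (c * (b \<bullet> u)) *\<^sub>R b" for u
    by (simp add: B_def vec_eq_iff matrix_vector_mult_def inner_vec_def algebra_simps sum.distrib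
        sum_distrib_left)
  have sh: "shape_operator (\<lambda>y. s *\<^sub>R unit_grad g y) ?p (T j) \<bullet> T i
      = (- s / m) * ((B *v fst (T j)) \<bullet> fst (T i))" for i j
  proof -
    have "shape_operator (\<lambda>y. s *\<^sub>R unit_grad g y) ?p (T j) \<bullet> T i = - s * (Hg ?p (T j) \<bullet> T i) / m"
      unfolding m_def by (rule shape_operator_unit_grad[OF grad_g_has_derivative[OF xz(1)] n0 Tg])
    also have "Hg ?p (T j) \<bullet> T i = (B *v fst (T j)) \<bullet> fst (T i)"
      by (simp add: Hg_def inner_prod_def Bv snd_T c_def b_def inner_add_left power2_eq_square)
    finally show ?thesis by simp
  qed
  have mat: "(\<chi> i j. shape_operator (\<lambda>y. s *\<^sub>R unit_grad g y) ?p (T j) \<bullet> T i)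
      = (- s / m) *\<^sub>R (transpose P ** B ** P)"
  proof -
    have "(transpose P ** (B ** P)) $ i $ j = (B *v fst (T j)) \<bullet> fst (T i)" for i j
      by (simp add: matrix_matrix_mult_def transpose_def P_def matrix_vector_mult_def inner_vec_def mult.commute)
    then show ?thesis by (simp add: vec_eq_iff sh matrix_mul_assoc)
  qed
  \<comment> \<open>The entries of \<open>P\<close> are never computed. By Parseval
    \<open>P ** transpose P\<close> is the identity minus the outer square of
    \<open>fst \<nu>\<close>, and its determinant is the square of \<open>snd \<nu>\<close>.\<close>
  have detP: "det P * det P = (\<phi>1 z)\<^sup>2 / m\<^sup>2"
  proof -
    have ax: "axis j (1::real) $ i = (if i = j then 1 else 0)" for i j :: 'n by (simp add: axis_def)
    have "P ** transpose P = (\<chi> i j. (if i = j then 1 else 0) + (- fst \<nu>) $ i * fst \<nu> $ j)"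
    proof -
      have "(\<Sum>k\<in>UNIV. fst (T k) $ i * fst (T k) $ j) = (if i = j then 1 else 0) + (- fst \<nu>) $ i * fst \<nu> $ j" for i j
        using frame_parseval[OF nn, of "(axis i 1, 0)" "(axis j 1, 0)"]
        by (simp add: T_def inner_prod_def inner_axis' ax split: if_splits)
      then show ?thesis by (simp add: vec_eq_iff matrix_matrix_mult_def transpose_def P_def)
    qed
    then have "det (P ** transpose P) = 1 + (- fst \<nu>) \<bullet> fst \<nu>"
      by (simp only: det_identity_plus_outer)
    then have "det P * det P = 1 - fst \<nu> \<bullet> fst \<nu>"
      by (simp add: det_mul det_transpose)
    also have "\<dots> = (snd \<nu>)\<^sup>2" using nn by (simp add: norm_eq_1 inner_prod_def power2_eq_square)
    also have "\<dots> = (\<phi>1 z)\<^sup>2 / m\<^sup>2" using s by (auto simp: nu gr power_divide)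
    finally show ?thesis .
  qed
  have detB: "det B = det (hessf f x) * (1 + c * (\<xi> \<bullet> b))"
    unfolding B_def b_def by (rule det_plus_outer[OF xi])
  have "gauss_kronecker (\<lambda>y. s *\<^sub>R unit_grad g y) ?p = det ((- s / m) *\<^sub>R (transpose P ** B ** P))"
    unfolding gauss_kronecker_def \<nu>_def[symmetric] T_def[symmetric] mat ..
  also have "\<dots> = (- s / m) ^ CARD('n) * (det P * det P * det B)"
  proof -
    have "det (c *\<^sub>R A) = c ^ CARD('n) * det A" for c and A :: "real^'n^'n"
      using det_rows_mul[of "\<lambda>_. c" "\<lambda>i. A $ i"]
      by (simp add: scaleR_vec_def vector_scalar_mult_def scalar_mult_eq_scaleR)
    then show ?thesis by (simp only: det_mul det_transpose mult_ac)
  qed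
  finally have gk: "gauss_kronecker (\<lambda>y. s *\<^sub>R unit_grad g y) ?p * m ^ (CARD('n) + 2)
      = (- s / m) ^ CARD('n) * m ^ CARD('n) * (m\<^sup>2 * (det P * det P) * det B)"
    by (simp add: power_add power2_eq_square)
  have e1: "(- s / m) ^ CARD('n) * m ^ CARD('n) = (- s) ^ CARD('n)" using m by (simp flip: power_mult_distrib)
  have e2: "m\<^sup>2 * (det P * det P) = (\<phi>1 z)\<^sup>2" using m by (simp add: detP)
  have e3: "(\<phi>1 z)\<^sup>2 * (1 + c * (\<xi> \<bullet> b)) = (\<phi>1 z)\<^sup>2 + \<phi>2 z * (gradf f x \<bullet> \<xi>)"
    using p1 by (simp add: c_def b_def field_simps inner_commute)
  have "gauss_kronecker (\<lambda>y. s *\<^sub>R unit_grad g y) ?p * m ^ (CARD('n) + 2)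
      = (- s) ^ CARD('n) * ((\<phi>1 z)\<^sup>2 * (det (hessf f x) * (1 + c * (\<xi> \<bullet> b))))"
    unfolding gk detB e1 e2 by (rule refl)
  also have "\<dots> = (- s) ^ CARD('n) * det (hessf f x) * ((\<phi>1 z)\<^sup>2 * (1 + c * (\<xi> \<bullet> b)))"
    by (simp only: mult.left_commute[of "(\<phi>1 z)\<^sup>2"] mult.assoc)
  finally have "gauss_kronecker (\<lambda>y. s *\<^sub>R unit_grad g y) ?p * m ^ (CARD('n) + 2)
      = (- s) ^ CARD('n) * det (hessf f x) * ((\<phi>1 z)\<^sup>2 + \<phi>2 z * (gradf f x \<bullet> \<xi>))"
    unfolding e3 .
  then show ?thesis by (simp add: m_def)
qed

end

section \<open>The normal to the convex side\<close>

lemma convex_normal_unit_grad: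
  fixes D :: "'a::real_inner set"
  assumes "strictly_convex_level D g k"
  obtains s where "s = 1 \<or> s = -1" "convex_normal D g k = (\<lambda>y. s *\<^sub>R unit_grad g y)"
proof (cases "\<forall>p \<in> level D g k. \<forall>q \<in> level D g k. unit_grad g p \<bullet> (q - p) \<ge> 0")
  case True
  then have "convex_normal D g k = (\<lambda>y. 1 *\<^sub>R unit_grad g y)" by (simp add: convex_normal_def fun_eq_iff)
  then show ?thesis using that[of 1] by simp
next
  case False
  then have "convex_normal D g k = (\<lambda>y. (-1) *\<^sub>R unit_grad g y)"
    unfolding convex_normal_def fun_eq_iff by auto
  then show ?thesis using that[of "-1"] by simp
qed

lemma unit_grad_inner: "unit_grad g p \<bullet> v = (grad g p \<bullet> v) / norm (grad g p)"
  by (simp add: unit_grad_def divide_inverse mult.commute)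

context power_sum
begin

lemma level_subset: "level D g k \<subseteq> D" by (auto simp: level_def)

lemma grad_g_inner:
  "(x, z) \<in> D \<Longrightarrow> grad g (x, z) \<bullet> (v, t) = gradf f x \<bullet> v + \<phi>1 z * t"
  by (simp add: grad_g inner_prod_def)

lemma zpower_sign:
  assumes "z \<in> J" "z' \<in> J" "z * z' > 0"
  shows "zpower \<alpha> z * zpower \<alpha> z' > 0"
proof -
  have z: "z \<noteq> 0" "z' \<noteq> 0" using assms by auto
  show ?thesis
  proof (cases "z > 0")
    case True then show ?thesis using assms by (simp add: zpower_pos zero_less_mult_iff)
  next
    case False
    then have "z < 0" "z' < 0" "\<alpha> \<in> \<int>" using z assms J_nonzero by (auto simp: zero_less_mult_iff)
    then show ?thesis by (simp add: zpower_neg)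
  qed
qed

lemma phi1_same_sign:
  assumes "z \<in> J" "z' \<in> J" "z * z' > 0"
  shows "\<phi>1 z * \<phi>1 z' > 0"
proof -
  have z: "z \<noteq> 0" "z' \<noteq> 0" using assms by auto
  have "\<phi>1 z * \<phi>1 z' = \<alpha>\<^sup>2 * (zpower \<alpha> z * zpower \<alpha> z') / (z * z')"
    using assms z by (simp add: phi1_eq power2_eq_square)
  then show ?thesis using zpower_sign[OF assms] assms(3) alpha by simp
qed

text \<open>On one side of zero, selected by \<open>z0\<close>, the derivative
  \<open>\<phi>1\<close> has constant sign, so the power is strictly monotone there in the direction
  of that sign.\<close>

lemma zpower_mono_sign:
  assumes J: "z \<in> J" "z' \<in> J" "z0 \<in> J" and s: "z * z0 > 0" "z' * z0 > 0"
    and lt: "zpower \<alpha> z' < zpower \<alpha> z"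
  shows "\<phi>1 z0 * (z - z') > 0"
proof -
  have mv: "\<exists>c. c \<in> J \<and> c * z0 > 0 \<and> zpower \<alpha> b - zpower \<alpha> a = (b - a) * \<phi>1 c"
    if ab: "a < b" "a \<in> J" "b \<in> J" "a * z0 > 0" "b * z0 > 0" for a b
  proof -
    have iv: "c \<in> J \<and> c * z0 > 0" if "a \<le> c" "c \<le> b" for c
    proof
      show "c \<in> J" using ab that by (cases rule: J_cases) auto
      show "c * z0 > 0" using ab that by (auto simp: zero_less_mult_iff)
    qed
    have "\<exists>c>a. c < b \<and> zpower \<alpha> b - zpower \<alpha> a = (b - a) * \<phi>1 c"
      using ab iv by (intro MVT2) (auto intro: phi_deriv)
    then show ?thesis using iv by (meson less_imp_le)
  qed
  have "z \<noteq> z'" using lt by auto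
  then consider "z' < z" | "z < z'" by linarith
  then obtain c where c: "c \<in> J" "c * z0 > 0" "zpower \<alpha> z - zpower \<alpha> z' = (z - z') * \<phi>1 c"
  proof cases
    case 1 then show ?thesis using mv[of z' z] J s that by blast
  next
    case 2
    from mv[OF this J(1,2) s] obtain c where "c \<in> J" "c * z0 > 0"
      "zpower \<alpha> z' - zpower \<alpha> z = (z' - z) * \<phi>1 c" by blast
    then show ?thesis using that[of c] by (simp add: algebra_simps)
  qed
  have "\<phi>1 c * \<phi>1 z0 > 0" using phi1_same_sign[OF c(1) J(3) c(2)] .
  moreover have "(z - z') * \<phi>1 c > 0" using c(3) lt by simp
  ultimately show ?thesis by (auto simp: zero_less_mult_iff)
qed

text \<open>The solution is \<open>\<bar>w\<bar> powr (1 / \<alpha>)\<close> with the sign of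
  \<open>z0\<close>; the hypothesis on \<open>w\<close> makes the sign of the power come out
  right.\<close>

lemma zpower_solve:
  assumes z0: "z0 \<in> J" "z0 \<noteq> 0" and w: "w * zpower \<alpha> z0 > 0"
  obtains z where "z \<in> J" "z * z0 > 0" "zpower \<alpha> z = w"
proof -
  define r where "r = \<bar>w\<bar> powr (1 / \<alpha>)"
  have wn: "w \<noteq> 0" using w by auto
  then have r: "r > 0" "r powr \<alpha> = \<bar>w\<bar>" using alpha by (auto simp: r_def powr_powr)
  show ?thesis
  proof (cases "z0 > 0")
    case True
    then have "w > 0" using w by (simp add: zpower_pos zero_less_mult_iff)
    moreover have "r \<in> J" using True z0 r by (cases rule: J_cases) auto
    ultimately show ?thesis using that[of r] True r by (simp add: zpower_pos)
  next
    case False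
    then have z: "z0 < 0" "\<alpha> \<in> \<int>" using z0 J_nonzero by auto
    have "-r \<in> J" using z z0 r by (cases rule: J_cases) auto
    moreover have "zpower \<alpha> (- r) = w"
      using w z r by (auto simp: zpower_neg zero_less_mult_iff split: if_splits)
    ultimately show ?thesis using that[of "-r"] z r by (simp add: mult_pos_neg)
  qed
qed

context
  assumes a2: "\<alpha> = 2"
begin

lemma J_UNIV: "J = UNIV"
  using a2 by (cases rule: J_cases) auto

lemma zpower_2: "zpower \<alpha> z = z\<^sup>2"
  using a2 by (simp only: zpower_def) simp

lemma phi1_2: "\<phi>1 z = 2 * z"
proof -
  have "\<alpha> - 1 = 1" using a2 by simp
  then have "zpower (\<alpha> - 1) z = z" by (simp only: zpower_def) simp
  then have "\<phi>1 z = \<alpha> * z" by (simp only: \<phi>1_def)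
  then show ?thesis using a2 by metis
qed

lemma phi2_2: "\<phi>2 z = 2"
proof -
  have "\<alpha> - 2 = 0" using a2 by simp
  then have "zpower (\<alpha> - 2) z = 1" by (simp only: zpower_def) simp
  then have "\<phi>2 z = \<alpha> * (\<alpha> - 1)" by (simp only: \<phi>2_def mult_1_right)
  also have "\<dots> = 2" using a2 by simp
  finally show ?thesis .
qed

lemma g_above_tangent: "g y \<ge> g p + grad g p \<bullet> (y - p)"
proof -
  obtain x z x0 z0 where yp: "y = (x, z)" "p = (x0, z0)" by (cases y; cases p)
  have pD: "(x0, z0) \<in> D" by (simp add: D J_UNIV)
  have "f x \<ge> f x0 + gradf f x0 \<bullet> (x - x0)"
    using f_above_tangent[OF sm sc, of x0 x] by (cases "x = x0") auto
  moreover have "z\<^sup>2 - z0\<^sup>2 - 2 * z0 * (z - z0) = (z - z0)\<^sup>2" by (simp add: power2_eq_square algebra_simps)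
  then have "z\<^sup>2 \<ge> z0\<^sup>2 + 2 * z0 * (z - z0)" by (metis diff_ge_0_iff_ge diff_diff_eq zero_le_power2)
  ultimately show ?thesis
    by (simp add: yp grad_g_inner[OF pD] phi1_2 g_apply zpower_2)
qed

lemma Hg_pos_2:
  assumes "w \<noteq> 0" shows "Hg y w \<bullet> w > 0"
proof -
  have eq: "Hg y w \<bullet> w = (hessf f (fst y) *v fst w) \<bullet> fst w + 2 * (snd w)\<^sup>2"
    by (simp add: Hg_def inner_prod_def phi2_2 power2_eq_square)
  show ?thesis
  proof (cases "fst w = 0")
    case True
    then have "snd w \<noteq> 0" using assms by (simp add: prod_eq_iff)
    then show ?thesis using True by (simp add: eq)
  next
    case False
    then show ?thesis using hessf_pos[OF sm sc False, of "fst y"] by (simp add: eq add_pos_nonneg)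
  qed
qed

end

text \<open>With \<open>s = 1\<close> the gradient of \<open>g\<close> points to the convex side of
  the level, with \<open>s = -1\<close> away from it.\<close>

definition signed :: "real \<Rightarrow> real \<Rightarrow> bool" where
  "signed k s \<longleftrightarrow> (s = 1 \<or> s = -1) \<and> convex_normal D g k = (\<lambda>y. s *\<^sub>R unit_grad g y)"

context
  fixes k s
  assumes reg: "k \<in> regular_values D g" and sl: "strictly_convex_level D g k" and sg: "signed k s"
begin

lemma grad_g_nonzero: "p \<in> level D g k \<Longrightarrow> grad g p \<noteq> 0"
  using reg by (auto simp: regular_values_def)

lemma support: "p \<in> level D g k \<Longrightarrow> q \<in> level D g k \<Longrightarrow> s * (grad g p \<bullet> (q - p)) \<ge> 0"
proof -
  assume pq: "p \<in> level D g k" "q \<in> level D g k"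
  then have "convex_normal D g k p \<bullet> (q - p) \<ge> 0" using sl by (simp add: strictly_convex_level_def)
  then have "s * (grad g p \<bullet> (q - p)) / norm (grad g p) \<ge> 0"
    using sg by (simp add: signed_def unit_grad_inner)
  then show ?thesis using grad_g_nonzero[OF pq(1)] by (simp add: zero_le_divide_iff)
qed

lemma curvature_sign:
  assumes p: "p \<in> level D g k" and w: "w \<noteq> 0" "w \<bullet> grad g p = 0"
  shows "s * (Hg p w \<bullet> w) < 0"
proof -
  have "pos_normal_curvatures (\<lambda>y. s *\<^sub>R unit_grad g y) p"
    using sl sg p by (auto simp: strictly_convex_level_def signed_def)
  moreover have pD: "p \<in> D" and "s \<noteq> 0" using p level_subset sg by (auto simp: signed_def)
  ultimately show ?thesis
    using pos_normal_curvatures_unit_grad[OF grad_g_has_derivative[OF pD] grad_g_nonzero[OF p] \<open>s \<noteq> 0\<close>] w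
    by blast
qed

text \<open>A tangent vector on which the Hessian of \<open>g\<close> is positive rules out
  \<open>s = 1\<close>. Any nonzero \<open>u\<close> lifts to one when \<open>\<phi>1 z\<close> is
  nonzero, and the vertical direction serves when it vanishes.\<close>

lemma phi2_pos_imp_minus:
  assumes p: "(x, z) \<in> level D g k" and pos: "\<phi>2 z > 0"
  shows "s = -1"
proof -
  have pD: "(x, z) \<in> D" using p level_subset by blast
  have "\<exists>w. w \<noteq> 0 \<and> w \<bullet> grad g (x, z) = 0 \<and> Hg (x, z) w \<bullet> w > 0"
  proof (cases "\<phi>1 z = 0")
    case True
    then show ?thesis using pos
      by (intro exI[of _ "(0, 1)"]) (simp add: grad_g[OF pD] inner_prod_def Hg_def zero_prod_def)
  next
    case False
    obtain u :: "real^'n" where u: "u \<noteq> 0" by (metis axis_eq_0_iff zero_neq_one)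
    let ?t = "- (gradf f x \<bullet> u) / \<phi>1 z"
    have "Hg (x, z) (u, ?t) \<bullet> (u, ?t) = (hessf f x *v u) \<bullet> u + \<phi>2 z * ?t\<^sup>2"
      by (simp add: Hg_def inner_prod_def power2_eq_square)
    also have "\<dots> > 0" using hessf_pos[OF sm sc u, of x] pos by (simp add: add_pos_nonneg)
    finally show ?thesis using False u
      by (intro exI[of _ "(u, ?t)"]) (simp add: grad_g[OF pD] inner_prod_def inner_commute zero_prod_def)
  qed
  then obtain w where "w \<noteq> 0" "w \<bullet> grad g (x, z) = 0" "Hg (x, z) w \<bullet> w > 0" by blast
  with curvature_sign[OF p, of w] have "s < 0" by (simp add: mult_less_0_iff)
  then show ?thesis using sg by (auto simp: signed_def)
qed

text \<open>Here \<open>\<phi>2\<close> is negative, so \<open>phi2_pos_imp_minus\<close> does not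
  apply. If \<open>s\<close> were 1, the supporting hyperplane would force the level to rise at a
  linear rate when walking against the gradient of \<open>f\<close>, whereas \<open>z\<close> is
  bounded on the level.\<close>

lemma fraction_exponent_imp_minus:
  assumes a: "0 < \<alpha>" "\<alpha> < 1"
  shows "s = -1"
proof (rule ccontr)
  assume "s \<noteq> -1"
  then have s1: "s = 1" using sg by (auto simp: signed_def)
  have Jp: "J = {0<..}" using a by (cases rule: J_cases) auto
  obtain x0 z0 where p: "(x0, z0) \<in> level D g k"
    using reg by (auto simp: regular_values_def)
  then have zJ: "z0 \<in> J" and pz: "zpower \<alpha> z0 = k - f x0" by (simp_all add: level_iff)
  then have z0: "z0 > 0" "z0 \<in> J" and pD: "(x0, z0) \<in> D" by (auto simp: Jp D)
  have ph0: "zpower \<alpha> z0 > 0" using z0 by (simp add: zpower_pos)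
  have p1: "\<phi>1 z0 > 0" using phi1_eq[OF z0(2)] z0(1) ph0 a by simp
  let ?u = "- gradf f x0"
  show False
  proof (cases "gradf f x0 = 0")
    case True
    obtain u :: "real^'n" where u: "u \<noteq> 0" by (metis axis_eq_0_iff zero_neq_one)
    have "s * (Hg (x0, z0) (u, 0) \<bullet> (u, 0)) < 0"
      using u True by (intro curvature_sign p) (simp_all add: zero_prod_def grad_g[OF pD] inner_prod_def)
    then show False using hessf_pos[OF sm sc u, of x0] by (simp add: s1 Hg_def inner_prod_def)
  next
    case False
    define d where "d = gradf f x0 \<bullet> gradf f x0"
    have d: "d > 0" using False by (simp add: d_def)
    have ineq: "\<phi>1 z0 * (zq - z0) \<ge> t * d"
      if "(x0 + t *\<^sub>R ?u, zq) \<in> level D g k" for t zq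
      using support[OF p that] by (simp add: s1 grad_g_inner[OF pD] d_def algebra_simps)
    \<comment> \<open>Since \<open>f\<close> is nonnegative, \<open>Z\<close> bounds
      \<open>z\<close> on the level. At parameter \<open>T\<close> the forced rise would be
      \<open>Z + 1\<close>, which is impossible if the level reaches that far. Otherwise
      \<open>f\<close> passes on the way through a value between \<open>f x0\<close> and
      \<open>k\<close>, where the level lies below \<open>z0\<close>.\<close>
    define Z where "Z = k powr (1 / \<alpha>)"
    define T where "T = \<phi>1 z0 * (Z + 1) / d"
    have "Z \<ge> 0" by (simp add: Z_def)
    have T: "T > 0" using \<open>Z \<ge> 0\<close> p1 d by (simp add: T_def)
    show False
    proof (cases "f (x0 + T *\<^sub>R ?u) < k")
      case True
      then have "(k - f (x0 + T *\<^sub>R ?u)) * zpower \<alpha> z0 > 0" using ph0 by simp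
      then obtain zq where zq: "zq \<in> J" "zq * z0 > 0" "zpower \<alpha> zq = k - f (x0 + T *\<^sub>R ?u)"
        using zpower_solve[OF z0(2)] z0(1) by (metis less_irrefl)
      then have zq0: "zq > 0" using z0 by (simp add: zero_less_mult_iff)
      have "zq powr \<alpha> \<le> k" using zq f_nonneg[of "x0 + T *\<^sub>R ?u"] zq0 by (simp add: zpower_pos)
      then have "(zq powr \<alpha>) powr (1 / \<alpha>) \<le> Z" unfolding Z_def using a by (intro powr_mono2) auto
      then have "zq \<le> Z" using zq0 a by (simp add: powr_powr)
      moreover have "\<phi>1 z0 * (zq - z0) \<ge> \<phi>1 z0 * (Z + 1)"
        using ineq[of T zq] zq d by (simp add: level_iff T_def)
      then have "zq - z0 \<ge> Z + 1" using p1 by simp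
      ultimately show False using z0 by simp
    next
      case False
      define v where "v = (f x0 + k) / 2"
      have kf: "f x0 < k" using pz ph0 by simp
      have "\<exists>t\<ge>0. t \<le> T \<and> f (x0 + t *\<^sub>R ?u) = v"
      proof (rule IVT')
        show "continuous_on {0..T} (\<lambda>t. f (x0 + t *\<^sub>R ?u))"
          by (rule continuous_on_compose2[OF f_continuous[OF sm sc, of UNIV]]) (auto intro!: continuous_intros)
      qed (use T kf False in \<open>auto simp: v_def\<close>)
      then obtain t where t: "t \<ge> 0" "f (x0 + t *\<^sub>R ?u) = v" by blast
      have "(k - v) * zpower \<alpha> z0 > 0" using ph0 kf by (simp add: v_def)
      then obtain zq where zq: "zq \<in> J" "zq * z0 > 0" "zpower \<alpha> zq = k - v"
        using zpower_solve[OF z0(2)] z0(1) by (metis less_irrefl)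
      have "k - v < k - f x0" using kf by (simp add: v_def)
      then have "\<phi>1 z0 * (z0 - zq) > 0"
        using zpower_mono_sign[of z0 zq z0] zq z0 pz by simp
      moreover have "\<phi>1 z0 * (zq - z0) \<ge> t * d"
        using ineq[of t zq] zq t by (simp add: level_iff)
      moreover have "t * d \<ge> 0" using t d by simp
      ultimately show False by (simp add: algebra_simps)
    qed
  qed
qed

text \<open>A level all of whose points have \<open>z < 0\<close> and which lies over every point \<open>x + t \<nabla>f(x)\<close>
  (\<open>t \<sigma> > 0\<close>) would be forced up to \<open>z \<ge> 0\<close> by the wrong choice of sign.\<close>

lemma negative_level_sign:
  assumes p: "(x, z) \<in> level D g k" and z: "z < 0" and gx: "gradf f x \<noteq> 0"
    and \<sigma>: "\<sigma> * s = -1" "\<sigma> * \<phi>1 z < 0"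
    and lv: "\<And>t. t > 0 \<Longrightarrow> \<exists>zq<0. (x + (t * \<sigma>) *\<^sub>R gradf f x, zq) \<in> level D g k"
  shows False
proof -
  have pD: "(x, z) \<in> D" using p level_subset by blast
  define d where "d = gradf f x \<bullet> gradf f x"
  have d: "d > 0" using gx by (simp add: d_def)
  define m where "m = - \<sigma> * \<phi>1 z"
  have m: "m > 0" using \<sigma> by (simp add: m_def)
  define t where "t = m * (- z) / d"
  have t: "t > 0" using m z d by (simp add: t_def mult_pos_neg divide_neg_pos)
  obtain zq where zq: "zq < 0" "(x + (t * \<sigma>) *\<^sub>R gradf f x, zq) \<in> level D g k" using lv[OF t] by blast
  have "0 \<le> s * (t * \<sigma> * d + \<phi>1 z * (zq - z))"
    using support[OF p zq(2)] by (simp add: grad_g_inner[OF pD] d_def)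
  also have "\<dots> = (\<sigma> * s) * (t * d) + s * \<phi>1 z * (zq - z)" by (simp add: algebra_simps)
  also have "s * \<phi>1 z = m" using \<sigma>(1) sg by (auto simp: m_def signed_def)
  finally have "t * d \<le> m * (zq - z)" using \<sigma>(1) by simp
  moreover have "t * d = m * (- z)" using d by (simp add: t_def)
  ultimately have "m * zq \<ge> 0" by (simp add: algebra_simps)
  then show False using m zq(1) by (simp add: zero_le_mult_iff)
qed

text \<open>The point of the level at height \<open>z'\<close> over the same \<open>x\<close> lies
  in every supporting half space, and by \<open>pos\<close> the vertical move from \<open>z'\<close>
  to \<open>z\<close> goes strictly inwards.\<close>

lemma vertical_convex_side:
  assumes y: "(x, z) \<in> D" and z': "(x, z') \<in> level D g k"
    and pos: "\<And>x' z0. (x', z0) \<in> level D g k \<Longrightarrow> s * (\<phi>1 z0 * (z - z')) > 0"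
  shows "(x, z) \<in> convex_side D g k"
  unfolding convex_side_def
proof (intro CollectI ballI)
  fix p assume p: "p \<in> level D g k"
  obtain x0 z0 where pe: "p = (x0, z0)" by (cases p)
  have pD: "(x0, z0) \<in> D" using p level_subset pe by blast
  have "grad g p \<bullet> ((x, z) - p) = grad g p \<bullet> ((x, z') - p) + \<phi>1 z0 * (z - z')"
    by (simp add: pe grad_g_inner[OF pD] algebra_simps)
  then have "s * (grad g p \<bullet> ((x, z) - p)) = s * (grad g p \<bullet> ((x, z') - p)) + s * (\<phi>1 z0 * (z - z'))"
    by (simp only: distrib_left)
  then have "s * (grad g p \<bullet> ((x, z) - p)) > 0"
    using support[OF p z'] pos[OF p[unfolded pe]] by linarith
  then show "convex_normal D g k p \<bullet> ((x, z) - p) > 0"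
    using sg grad_g_nonzero[OF p] by (simp add: signed_def unit_grad_inner)
qed

text \<open>A point of the level at height zero would have a vertical tangent vector on which the
  Hessian of \<open>g\<close> vanishes, since the exponent is at least 3. So \<open>f\<close> never
  takes the value \<open>k\<close>, and as its range is an interval unbounded above it stays above
  \<open>k\<close>.\<close>

lemma flat_zero_section:
  assumes a: "\<alpha> \<in> \<nat>" "\<alpha> \<noteq> 2"
  shows "f x > k"
proof (rule ccontr)
  assume "\<not> f x > k"
  then obtain y where y: "f y = k" using f_attains[OF sm sc] by (metis not_less)
  obtain n where n: "\<alpha> = real n" using a by (auto elim: Nats_cases)
  then have "n \<noteq> 0" "n \<noteq> 1" "n \<noteq> 2" using a alpha by auto
  then have n3: "n \<ge> 3" by linarith
  have f0: "\<lfloor>real n - 2\<rfloor> = int (n - 2)" "\<lfloor>real n - 1\<rfloor> = int (n - 1)" "\<lfloor>real n\<rfloor> = int n"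
    using n3 by linarith+
  have i: "real n - 2 \<in> \<int>" "real n - 1 \<in> \<int>" by auto
  have "zpower \<alpha> 0 = 0" "zpower (\<alpha> - 1) 0 = 0" "zpower (\<alpha> - 2) 0 = 0"
    unfolding n zpower_def f0 using n3 i by (auto simp: power_int_def)
  then have 0: "zpower \<alpha> 0 = 0" "\<phi>1 0 = 0" "\<phi>2 0 = 0" by (simp_all add: \<phi>1_def \<phi>2_def)
  have JU: "J = UNIV" using a by (cases rule: J_cases) auto
  have p: "(y, 0) \<in> level D g k" using y 0 by (simp add: level_iff JU)
  have pD: "(y, 0) \<in> D" by (simp add: D JU)
  have "s * (Hg (y, 0) (0, 1) \<bullet> (0, 1)) < 0"
    using p by (rule curvature_sign) (simp_all add: zero_prod_def grad_g[OF pD] inner_prod_def 0)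
  then show False by (simp add: Hg_def inner_prod_def 0)
qed

end

end

section \<open>Orientation of all levels in a maximal range\<close>

locale power_sum_range = power_sum f \<alpha> J D g
  for f :: "real^'n::finite \<Rightarrow> real" and \<alpha> J D g +
  fixes S assumes Sg: "is_Sg D g S"
begin

lemma S_interval: "is_interval S" and S_interior: "interior S \<noteq> {}"
  and S_regular: "S \<subseteq> regular_values D g" and S_convex: "k \<in> S \<Longrightarrow> strictly_convex_level D g k"
  and S_max: "strictly_convex_range D g S' \<Longrightarrow> S \<subseteq> S' \<Longrightarrow> S' = S"
  using Sg by (auto simp: is_Sg_def strictly_convex_range_def)

lemma level_nonempty: "k \<in> S \<Longrightarrow> \<exists>x z. (x, z) \<in> level D g k"
  using S_regular by (fastforce simp: regular_values_def)

lemma obtain_sign: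
  assumes "k \<in> S" obtains s where "signed k s"
  using convex_normal_unit_grad[OF S_convex[OF assms]] by (auto simp: signed_def)

lemma S_signed_facts:
  assumes "k \<in> S" "signed k s"
  shows "k \<in> regular_values D g" "strictly_convex_level D g k" "signed k s"
  using assms S_regular S_convex by auto

text \<open>\<open>over\<close> provides a point of the level \<open>k\<close> vertically in line
  with each point of the level \<open>j\<close>, and \<open>same\<close> keeps both on one side of
  zero; monotonicity of the power then decides the direction of the vertical move.\<close>

lemma vertical_side_uniform:
  assumes z0: "z0 \<in> J" "z0 \<noteq> 0"
    and same: "\<And>k x z. k \<in> S \<Longrightarrow> (x, z) \<in> level D g k \<Longrightarrow> z * z0 > 0"
    and over: "\<And>j k x z. j \<in> S \<Longrightarrow> k \<in> S \<Longrightarrow> s * (j - k) > 0 \<Longrightarrow> (x, z) \<in> level D g j \<Longrightarrow> (k - f x) * zpower \<alpha> z0 > 0"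
    and k: "k \<in> S" "signed k s" and j: "j \<in> S" "s * (j - k) > 0"
  shows "level D g j \<subseteq> convex_side D g k"
proof clarify
  fix x z assume y: "(x, z) \<in> level D g j"
  note F = S_signed_facts[OF k]
  obtain z' where z': "z' \<in> J" "z' * z0 > 0" "zpower \<alpha> z' = k - f x"
    using zpower_solve[OF z0 over[OF j(1) k(1) j(2) y]] by metis
  have zJ: "z \<in> J" "zpower \<alpha> z = j - f x" using y by (auto simp: level_iff)
  have zz: "z * z0 > 0" using same[OF j(1) y] .
  show "(x, z) \<in> convex_side D g k"
  proof (rule vertical_convex_side[OF F])
    show "(x, z) \<in> D" using zJ by (simp add: D)
    show "(x, z') \<in> level D g k" using z' by (simp add: level_iff)
    fix x' z1 assume p: "(x', z1) \<in> level D g k"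
    have z1: "z1 \<in> J" "z1 * z0 > 0" using p same[OF k(1) p] by (auto simp: level_iff)
    have zz1: "z * z1 > 0" "z' * z1 > 0" using zz z'(2) z1(2) by (auto simp: zero_less_mult_iff)
    consider "s = 1" "k < j" | "s = -1" "j < k" using k(2) j(2) by (auto simp: signed_def)
    then show "s * (\<phi>1 z1 * (z - z')) > 0"
    proof cases
      case 1
      then have "\<phi>1 z1 * (z - z') > 0"
        using zpower_mono_sign[OF zJ(1) z'(1) z1(1) zz1] zJ z' by simp
      then show ?thesis using 1 by simp
    next
      case 2
      then have "\<phi>1 z1 * (z' - z) > 0"
        using zpower_mono_sign[OF z'(1) zJ(1) z1(1) zz1(2,1)] zJ z' by simp
      then show ?thesis using 2 by (simp add: algebra_simps)
    qed
  qed
qed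

text \<open>Besides \<alpha> = 2 there are the natural exponents at least 3, whose levels lie in
  \<open>z < 0\<close>, and the exponents on a half line, split by the sign of the power. Only a
  negative power on a half line, which needs a negative odd exponent and \<open>z < 0\<close>,
  yields \<open>s = 1\<close>.\<close>

lemma uniform_sign_and_sides:
  obtains s where "s = 1 \<or> s = -1" "\<And>k. k \<in> S \<Longrightarrow> signed k s"
    "\<And>j k. j \<in> S \<Longrightarrow> k \<in> S \<Longrightarrow> s * (j - k) > 0 \<Longrightarrow> level D g j \<subseteq> convex_side D g k"
proof (cases "\<alpha> = 2")
  case True
  have sg: "signed k (-1)" if k: "k \<in> S" for k
  proof -
    obtain s where s: "signed k s" by (rule obtain_sign[OF k])
    obtain x z where "(x, z) \<in> level D g k" using level_nonempty[OF k] by blast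
    then show ?thesis using phi2_pos_imp_minus[OF S_signed_facts[OF k s]] s by (simp add: phi2_2[OF True])
  qed
  have "level D g j \<subseteq> convex_side D g k" if jk: "j \<in> S" "k \<in> S" "j < k" for j k
  proof clarify
    fix x z assume y: "(x, z) \<in> level D g j"
    show "(x, z) \<in> convex_side D g k"
      unfolding convex_side_def
    proof (intro CollectI ballI)
      fix p assume p: "p \<in> level D g k"
      have "grad g p \<bullet> ((x, z) - p) < 0"
        using g_above_tangent[OF True, of p "(x, z)"] y p jk(3) by (simp add: level_def)
      then show "convex_normal D g k p \<bullet> ((x, z) - p) > 0"
        using sg[OF jk(2)] grad_g_nonzero[OF S_signed_facts[OF jk(2) sg[OF jk(2)]] p]
        by (simp add: signed_def unit_grad_inner divide_neg_pos)
    qed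
  qed
  then show ?thesis using that[of "-1"] sg by auto
next
  case a2: False
  show ?thesis
  proof (cases "\<alpha> \<in> \<nat>")
    case True
    then have JU: "J = UNIV" "\<alpha> \<ge> 2" by (cases rule: J_cases; auto)+
    have below: "f x > k" if "k \<in> S" for k x
    proof -
      obtain s where "signed k s" by (rule obtain_sign[OF \<open>k \<in> S\<close>])
      then show ?thesis using flat_zero_section[OF S_signed_facts[OF \<open>k \<in> S\<close>]] True a2 by blast
    qed
    have neg: "z < 0 \<and> zpower \<alpha> z < 0" if k: "k \<in> S" "(x, z) \<in> level D g k" for k x z
    proof -
      have "zpower \<alpha> z < 0" using k below[OF k(1), of x] by (auto simp: level_iff)
      moreover have "zpower \<alpha> 0 = 0" using JU(2) True alpha
        by (auto simp: zpower_def power_int_def elim!: Nats_cases)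
      ultimately show ?thesis using zpower_pos[of z \<alpha>] powr_ge_zero[of z \<alpha>]
        by (metis less_asym linorder_less_linear not_less)
    qed
    obtain k1 where k1: "k1 \<in> S" using S_interior interior_subset by blast
    obtain x1 z1 where p1: "(x1, z1) \<in> level D g k1" using level_nonempty[OF k1] by blast
    have z1: "z1 < 0" "z1 \<in> J" "zpower \<alpha> z1 < 0" using neg[OF k1 p1] JU by auto
    have ph: "\<phi>1 z > 0" if "k \<in> S" "(x, z) \<in> level D g k" for k x z
      using phi1_eq[of z] neg[OF that] JU alpha by (simp add: divide_neg_neg mult_pos_neg)
    have sg: "signed k (-1)" if k: "k \<in> S" for k
    proof -
      obtain s where s: "signed k s" by (rule obtain_sign[OF k])
      have "s \<noteq> 1"
      proof
        assume s1: "s = 1"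
        obtain x where x: "gradf f x \<noteq> 0" using exists_gradf_nonzero[OF sm sc] by blast
        \<comment> \<open>As \<open>f\<close> exceeds \<open>k\<close> everywhere, the level lies
          over every point and can be followed along any ray.\<close>
        have ex: "\<exists>zq<0. (x', zq) \<in> level D g k" for x'
        proof -
          have "(k - f x') * zpower \<alpha> z1 > 0" using below[OF k, of x'] z1 by (simp add: mult_neg_neg)
          then obtain z where "z \<in> J" "z * z1 > 0" "zpower \<alpha> z = k - f x'"
            using zpower_solve[OF z1(2)] z1(1) by (metis less_irrefl)
          then show ?thesis using z1 by (auto simp: level_iff zero_less_mult_iff)
        qed
        obtain z where z: "z < 0" "(x, z) \<in> level D g k" using ex by blast
        show False
          by (rule negative_level_sign[OF S_signed_facts[OF k s] z(2,1) x, of "-1"])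
            (use s1 ph[OF k z(2)] ex in auto)
      qed
      then show ?thesis using s by (auto simp: signed_def)
    qed
    have "level D g j \<subseteq> convex_side D g k" if jk: "j \<in> S" "k \<in> S" "-1 * (j - k) > 0" for j k
    proof (rule vertical_side_uniform[OF z1(2), where s = "-1"])
      show "z * z1 > 0" if "k \<in> S" "(x, z) \<in> level D g k" for k x z
        using neg[OF that] z1 by (simp add: mult_neg_neg)
      show "(k - f x) * zpower \<alpha> z1 > 0" if "k \<in> S" for k x
        using below[OF that, of x] z1 by (simp add: mult_neg_neg)
    qed (use jk sg z1 in auto)
    then show ?thesis using that[of "-1"] sg by blast
  next
    case aN: False
    then have half: "J = {0<..} \<or> (J = {..<0} \<and> \<alpha> \<in> \<int> \<and> \<alpha> < 0)" by (cases rule: J_cases) auto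
    obtain k1 where k1: "k1 \<in> S" using S_interior interior_subset by blast
    obtain x1 z1 where p1: "(x1, z1) \<in> level D g k1" using level_nonempty[OF k1] by blast
    have z1: "z1 \<in> J" "z1 \<noteq> 0" using p1 half by (auto simp: level_iff)
    have same: "z * z1 > 0" if "z \<in> J" for z
      using half that z1 by (auto simp: mult_neg_neg)
    have ss: "zpower \<alpha> z * zpower \<alpha> z1 > 0" if "z \<in> J" for z
      using zpower_sign[OF that z1(1) same[OF that]] .
    show ?thesis
    proof (cases "zpower \<alpha> z1 > 0")
      case True
      have pp: "zpower \<alpha> z > 0" if "z \<in> J" for z using ss[OF that] True by (simp add: zero_less_mult_iff)
      have sg: "signed k (-1)" if k: "k \<in> S" for k
      proof -
        obtain s where s: "signed k s" by (rule obtain_sign[OF k])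
        note F = S_signed_facts[OF k s]
        have "s = -1"
        \<comment> \<open>Outside this range \<open>\<phi>2\<close> has the sign of the power
          itself, and the Hessian decides.\<close>
        proof (cases "0 < \<alpha> \<and> \<alpha> < 1")
          case True then show ?thesis using fraction_exponent_imp_minus[OF F] by blast
        next
          case False
          then have "\<alpha> * (\<alpha> - 1) > 0" using alpha by (auto simp: zero_less_mult_iff)
          moreover obtain x z where p: "(x, z) \<in> level D g k" using level_nonempty[OF k] by blast
          moreover have "z \<in> J" "z \<noteq> 0" using p half by (auto simp: level_iff)
          ultimately have "\<phi>2 z > 0" using phi2_eq[of z] pp[of z] by simp
          then show ?thesis using phi2_pos_imp_minus[OF F p] by blast
        qed
        then show ?thesis using s by simp
      qed
      have "level D g j \<subseteq> convex_side D g k" if jk: "j \<in> S" "k \<in> S" "-1 * (j - k) > 0" for j k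
      proof (rule vertical_side_uniform[OF z1, where s = "-1"])
        show "z * z1 > 0" if "k \<in> S" "(x, z) \<in> level D g k" for k x z
          using that same by (auto simp: level_iff)
        show "(k - f x) * zpower \<alpha> z1 > 0" if "-1 * (j - k) > 0" "(x, z) \<in> level D g j" for j k x z
          using that pp[of z] True by (auto simp: level_iff)
      qed (use jk sg in auto)
      then show ?thesis using that[of "-1"] sg by blast
    next
      case False
      then have n1: "zpower \<alpha> z1 < 0" using zpower_nonzero[OF z1] by linarith
      then have Jn: "J = {..<0}" "\<alpha> < 0" using half z1 zpower_pos[of z1 \<alpha>] by auto
      have pn: "zpower \<alpha> z < 0" if "z \<in> J" for z using ss[OF that] n1 by (simp add: zero_less_mult_iff)
      have ph: "\<phi>1 z < 0" if "z \<in> J" for z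
      proof -
        have "z < 0" using that Jn by simp
        moreover have "\<alpha> * zpower \<alpha> z > 0" using pn[OF that] Jn by (simp add: mult_neg_neg)
        ultimately show ?thesis using phi1_eq[OF that] by (simp add: divide_pos_neg)
      qed
      have sg: "signed k 1" if k: "k \<in> S" for k
      proof -
        obtain s where s: "signed k s" by (rule obtain_sign[OF k])
        have "s \<noteq> -1"
        proof
          assume s1: "s = -1"
          have ex: "\<exists>zq<0. (x', zq) \<in> level D g k" if "f x' > k" for x'
          proof -
            have "(k - f x') * zpower \<alpha> z1 > 0" using that n1 by (simp add: mult_neg_neg)
            then obtain z where "z \<in> J" "zpower \<alpha> z = k - f x'"
              using zpower_solve[OF z1] by metis
            then show ?thesis using Jn by (auto simp: level_iff)
          qed
          obtain x0 z0 where p0: "(x0, z0) \<in> level D g k" using level_nonempty[OF k] by blast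
          then have f0: "f x0 > k" using pn[of z0] by (auto simp: level_iff)
          \<comment> \<open>If the gradient vanishes at \<open>x0\<close>, then \<open>x0\<close> is
            the minimum and any point with nonzero gradient has a larger value of \<open>f\<close>.
            Following the gradient from there never leaves the region \<open>f > k\<close>.\<close>
          obtain x where x: "gradf f x \<noteq> 0" "f x > k"
          proof (cases "gradf f x0 = 0")
            case True
            obtain x where x: "gradf f x \<noteq> 0" using exists_gradf_nonzero[OF sm sc] by blast
            then have "x0 \<noteq> x" using True by auto
            then show ?thesis using f_above_tangent[OF sm sc, of x0 x] True f0 that x by auto
          qed (use f0 that in blast)
          obtain z where z: "z < 0" "(x, z) \<in> level D g k" using ex x(2) by blast
          show False
          proof (rule negative_level_sign[OF S_signed_facts[OF k s] z(2,1) x(1), of 1])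
            show "1 * \<phi>1 z < 0" using ph z Jn by auto
            fix t :: real assume t: "t > 0"
            have "x \<noteq> x + (t * 1) *\<^sub>R gradf f x" using t x by simp
            from f_above_tangent[OF sm sc this] have "f (x + (t * 1) *\<^sub>R gradf f x) > k"
              using x(2) t by (simp add: add_nonneg_pos) (smt (verit) inner_ge_zero mult_nonneg_nonneg)
            then show "\<exists>zq<0. (x + (t * 1) *\<^sub>R gradf f x, zq) \<in> level D g k" using ex by blast
          qed (use s1 in simp)
        qed
        then show ?thesis using s by (auto simp: signed_def)
      qed
      have "level D g j \<subseteq> convex_side D g k" if jk: "j \<in> S" "k \<in> S" "1 * (j - k) > 0" for j k
      proof (rule vertical_side_uniform[OF z1, where s = 1])
        show "z * z1 > 0" if "k \<in> S" "(x, z) \<in> level D g k" for k x z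
          using that same by (auto simp: level_iff)
        show "(k - f x) * zpower \<alpha> z1 > 0" if "1 * (j - k) > 0" "(x, z) \<in> level D g j" for j k x z
          using that pn[of z] n1 by (auto simp: level_iff mult_neg_neg)
      qed (use jk sg in auto)
      then show ?thesis using that[of 1] sg by blast
    qed
  qed
qed

text \<open>An interval with points on both sides of \<open>k\<close> would contain
  \<open>k\<close>, which gives maximality. For interior \<open>k\<close> there are levels of
  \<open>S\<close> on the required side arbitrarily close to \<open>k\<close>.\<close>

lemma is_Ik_side:
  assumes s: "s = 1 \<or> s = -1" and k: "k \<in> interior S"
    and side: "\<And>j. j \<in> S \<Longrightarrow> s * (j - k) > 0 \<Longrightarrow> level D g j \<subseteq> convex_side D g k"
  shows "is_Ik D g S k {j \<in> S. s * (j - k) > 0}"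
proof -
  let ?I = "{j \<in> S. s * (j - k) > 0}"
  have iv: "is_interval ?I"
    using S_interval s unfolding is_interval_1 by (auto; metis less_le_trans le_less_trans)
  obtain e where e: "e > 0" "ball k e \<subseteq> S" using k mem_interior by blast
  have near: "\<exists>j\<in>?I. dist j k < d" if "d > 0" for d
  proof -
    define j where "j = k + s * (min d e / 2)"
    have "dist j k = min d e / 2" using s e that by (auto simp: j_def dist_real_def)
    then have "j \<in> S" "dist j k < d" using e that by (auto simp: dist_commute subset_iff)
    moreover have "s * (j - k) > 0" using s e that by (auto simp: j_def)
    ultimately show ?thesis by blast
  qed
  then have cl: "k \<in> closure ?I" by (simp add: closure_approachable)
  have 1: "convex_side_range D g S k ?I"
    unfolding convex_side_range_def using iv cl side by auto
  have "I' = ?I" if I': "convex_side_range D g S k I'" "?I \<subseteq> I'" for I'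
  proof -
    have i: "is_interval I'" "I' \<subseteq> S" "k \<notin> I'" using I' by (auto simp: convex_side_range_def)
    obtain j where j: "j \<in> ?I" using near[of 1] by auto
    have "s * (i - k) > 0" if "i \<in> I'" for i
    proof (rule ccontr)
      assume "\<not> s * (i - k) > 0"
      then have "(i \<le> k \<and> k \<le> j) \<or> (j \<le> k \<and> k \<le> i)" using s j by auto
      then have "k \<in> I'" using i(1) that j I'(2) unfolding is_interval_1 by blast
      then show False using i by simp
    qed
    then show ?thesis using i I'(2) by blast
  qed
  with 1 show ?thesis unfolding is_Ik_def by blast
qed

end

section \<open>Local shape of caps and sections\<close>

text \<open>Isolates what the local analysis at \<open>p\<close> uses: a gradient differentiable at
  \<open>p\<close> with symmetric derivative, supporting half spaces of the levels involved, and a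
  definite second fundamental form. The special form of \<open>g\<close> no longer appears.\<close>

locale cap_point =
  fixes D :: "'n::finite pt set" and g :: "'n pt \<Rightarrow> real" and k :: real and p :: "'n pt"
    and s :: real and H :: "'n pt \<Rightarrow> 'n pt" and I :: "real set"
  assumes open_D: "open D"
    and gd: "\<And>y. y \<in> D \<Longrightarrow> GDERIV g y :> grad g y"
    and cg: "continuous_on D (grad g)"
    and H: "(grad g has_derivative H) (at p)"
    and symH: "\<And>a b. H a \<bullet> b = a \<bullet> H b"
    and p: "p \<in> level D g k" and s: "s = 1 \<or> s = -1"
    and sg: "\<And>j. j \<in> insert k I \<Longrightarrow> convex_normal D g j = (\<lambda>y. s *\<^sub>R unit_grad g y)"
    and nz: "\<And>j y. j \<in> insert k I \<Longrightarrow> y \<in> level D g j \<Longrightarrow> grad g y \<noteq> 0"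
    and sup: "\<And>j y q. j \<in> insert k I \<Longrightarrow> y \<in> level D g j \<Longrightarrow> q \<in> level D g j \<Longrightarrow> s * (grad g y \<bullet> (q - y)) \<ge> 0"
    and cv: "\<And>w. w \<noteq> 0 \<Longrightarrow> w \<bullet> grad g p = 0 \<Longrightarrow> s * (H w \<bullet> w) < 0"
    and side: "\<And>j. j \<in> I \<Longrightarrow> s * (j - k) > 0 \<and> level D g j \<subseteq> convex_side D g k"
begin

definition "m = norm (grad g p)"
definition "\<nu> = s *\<^sub>R unit_grad g p"
definition "T = frame \<nu>"
text \<open>Normalised to vanish on the level \<open>k\<close> and to equal the positive number
  \<open>\<bar>j - k\<bar>\<close> on the levels \<open>j\<close> in \<open>I\<close>, whichever way
  the gradient points.\<close>

definition "G y = s * (g y - k)"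
definition "P u t = p + T u + t *\<^sub>R \<nu>"
definition "q u = - s * (H (T u) \<bullet> T u) / (2 * m)"

lemma grad_p: "grad g p \<noteq> 0" using nz[of k p] p by simp
lemma pD: "p \<in> D" and gp: "g p = k" using p by (auto simp: level_def)
lemma m_pos: "m > 0" using grad_p by (simp add: m_def)
lemma norm_nu: "norm \<nu> = 1" using s norm_unit_grad[OF grad_p] by (auto simp: \<nu>_def)
lemma nu_nz: "\<nu> \<noteq> 0" using norm_nu by auto
lemma nu_nu: "\<nu> \<bullet> \<nu> = 1" using norm_nu by (simp add: norm_eq_1)
lemma grad_nu: "s *\<^sub>R grad g p = m *\<^sub>R \<nu>"
  using m_pos by (simp add: \<nu>_def unit_grad_def m_def)
lemma ss: "s * s = 1" using s by auto

lemma T_lin: "linear T" and T_norm: "norm (T u) = norm u" and T_nu: "T u \<bullet> \<nu> = 0"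
  and T_inner: "T u \<bullet> T v = u \<bullet> v" and nu_T: "\<nu> \<bullet> T u = 0"
  using frame_props[OF nu_nz] by (auto simp: T_def inner_commute)

lemma P_surj: obtains u where "y = P u (\<nu> \<bullet> (y - p))"
proof -
  obtain u where "y - p = frame \<nu> u + ((y - p) \<bullet> \<nu>) *\<^sub>R \<nu>" by (rule frame_decomposition[OF norm_nu])
  then have "y = P u (\<nu> \<bullet> (y - p))" by (simp add: P_def T_def inner_commute algebra_simps)
  then show ?thesis using that by blast
qed

lemma nu_P: "\<nu> \<bullet> (P u t - p) = t"
  by (simp add: P_def inner_add_right nu_T nu_nu)

lemma P_affine: "P (a *\<^sub>R u + b *\<^sub>R u') (a * t + b * t') = a *\<^sub>R P u t + b *\<^sub>R P u' t'" if "a + b = 1"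
proof -
  have "p = (a + b) *\<^sub>R p" using that by simp
  then show ?thesis
    by (simp add: P_def linear_add[OF T_lin] linear_scale[OF T_lin] algebra_simps)
qed

lemma continuous_P: "continuous_on A (\<lambda>x. P (f x) (h x))"
  if "continuous_on A f" "continuous_on A h"
proof -
  have "continuous_on A (\<lambda>x. T (f x))"
    by (rule continuous_on_compose2[OF linear_continuous_on that(1)])
      (use T_lin in \<open>auto simp: linear_conv_bounded_linear\<close>)
  then show ?thesis unfolding P_def by (intro continuous_intros that)
qed

lemma lin_H: "linear H" using H by (rule has_derivative_linear)

lemma q_pos: "u \<noteq> 0 \<Longrightarrow> q u > 0"
proof -
  assume "u \<noteq> 0"
  then have "T u \<noteq> 0" using T_norm by (metis norm_eq_zero)
  moreover have "T u \<bullet> grad g p = 0"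
  proof -
    have "T u \<bullet> (s *\<^sub>R grad g p) = 0" by (simp add: grad_nu T_nu)
    then show ?thesis using s by auto
  qed
  ultimately show ?thesis using cv m_pos by (simp add: q_def divide_neg_pos)
qed

lemma q_scale: "q (c *\<^sub>R u) = c\<^sup>2 * q u"
  by (simp add: q_def linear_scale[OF T_lin] linear_scale[OF lin_H] power2_eq_square)

lemma q_nonneg: "q u \<ge> 0"
  using q_pos[of u] q_scale[of 0 u] by (cases "u = 0") auto

lemma continuous_q: "continuous_on A q"
proof -
  have T: "continuous_on A T" and HT: "continuous_on A (\<lambda>u. H (T u))"
    using T_lin linear_compose[OF T_lin lin_H]
    by (auto intro: linear_continuous_on simp: linear_conv_bounded_linear o_def)
  show ?thesis unfolding q_def by (intro continuous_intros T HT) (use m_pos in auto)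
qed

lemma q_lower: obtains c where "c > 0" "\<And>u. q u \<ge> c * (norm u)\<^sup>2"
proof -
  have "sphere (0::real^'n) 1 \<noteq> {}" by simp
  then obtain u0 where u0: "u0 \<in> sphere 0 1" "\<And>u. u \<in> sphere 0 1 \<Longrightarrow> q u0 \<le> q u"
    using continuous_attains_inf[OF compact_sphere _ continuous_q, of 0 1] by blast
  have "q u \<ge> q u0 * (norm u)\<^sup>2" for u
  proof (cases "u = 0")
    case False
    then have "q u0 \<le> q (u /\<^sub>R norm u)" by (intro u0) simp
    then show ?thesis using False by (simp add: q_scale power_inverse field_simps)
  qed (simp add: q_nonneg)
  moreover have "q u0 > 0" using u0 by (intro q_pos) auto
  ultimately show ?thesis using that by blast
qed

lemma G_p: "G p = 0" by (simp add: G_def gp)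

lemma G_level: "y \<in> level D g j \<longleftrightarrow> y \<in> D \<and> G y = s * (j - k)"
  using s by (auto simp: level_def G_def)

lemma continuous_G: "continuous_on D G"
proof -
  have "continuous_on D g"
    using gd unfolding gderiv_def by (meson continuous_at_imp_continuous_on has_derivative_continuous)
  then show ?thesis unfolding G_def by (intro continuous_intros)
qed

text \<open>Second differentiability is assumed only at \<open>p\<close> itself. The quadratic
  polynomial is therefore subtracted first, and the mean value theorem is applied just once along
  the segment.\<close>

lemma taylor:
  assumes e: "e > 0"
  obtains d where "d > 0"
    "\<And>w. norm w < d \<Longrightarrow> p + w \<in> D \<and> s * (grad g (p + w) \<bullet> \<nu>) > 0 \<and>
       \<bar>G (p + w) - m * (\<nu> \<bullet> w) - s / 2 * (H w \<bullet> w)\<bar> \<le> e * (norm w)\<^sup>2"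
proof -
  obtain d1 where d1: "d1 > 0" "ball p d1 \<subseteq> D" using open_D pD open_contains_ball by metis
  obtain d2 where d2: "d2 > 0"
    "\<And>y. norm (y - p) < d2 \<Longrightarrow> norm (grad g y - grad g p - H (y - p)) \<le> e * norm (y - p)"
    using H e unfolding has_derivative_at_alt by blast
  have "isCont (grad g) p" using cg open_D pD by (simp add: continuous_on_eq_continuous_at)
  then have "isCont (\<lambda>y. s * (grad g y \<bullet> \<nu>)) p" by (intro continuous_intros)
  moreover have "s * (grad g p \<bullet> \<nu>) = m" using arg_cong[OF grad_nu, of "\<lambda>v. v \<bullet> \<nu>"] by (simp add: nu_nu)
  ultimately have "((\<lambda>y. s * (grad g y \<bullet> \<nu>)) \<longlongrightarrow> m) (at p)" by (simp add: isCont_def)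
  then have "\<forall>\<^sub>F y in at p. s * (grad g y \<bullet> \<nu>) > 0" using m_pos by (rule order_tendstoD)
  then obtain d3 where d3: "d3 > 0" "\<And>y. y \<noteq> p \<Longrightarrow> dist y p < d3 \<Longrightarrow> s * (grad g y \<bullet> \<nu>) > 0"
    unfolding eventually_at by auto
  have gpos: "s * (grad g y \<bullet> \<nu>) > 0" if "dist y p < d3" for y
    using d3(2)[OF _ that] \<open>s * (grad g p \<bullet> \<nu>) = m\<close> m_pos by (cases "y = p") auto
  define d where "d = min d1 (min d2 d3)"
  have "p + w \<in> D \<and> s * (grad g (p + w) \<bullet> \<nu>) > 0 \<and>
       \<bar>G (p + w) - m * (\<nu> \<bullet> w) - s / 2 * (H w \<bullet> w)\<bar> \<le> e * (norm w)\<^sup>2" if w: "norm w < d" for w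
  proof (intro conjI)
    have inD: "p + t *\<^sub>R w \<in> D" "norm (t *\<^sub>R w) < d2" if "0 \<le> t" "t \<le> 1" for t
    proof -
      have "norm (t *\<^sub>R w) \<le> norm w" using that by (simp add: mult_left_le_one_le)
      then have "norm (t *\<^sub>R w) < d" using w by simp
      then have "p + t *\<^sub>R w \<in> ball p d1" "norm (t *\<^sub>R w) < d2" by (simp_all add: d_def dist_norm)
      then show "p + t *\<^sub>R w \<in> D" "norm (t *\<^sub>R w) < d2" using d1(2) by auto
    qed
    show "p + w \<in> D" using inD[of 1] by simp
    show "s * (grad g (p + w) \<bullet> \<nu>) > 0" using w by (intro gpos) (simp add: d_def dist_norm)
    define \<psi> where "\<psi> t = G (p + t *\<^sub>R w) - t * (m * (\<nu> \<bullet> w)) - t\<^sup>2 * (s / 2 * (H w \<bullet> w))" for t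
    define \<psi>' where "\<psi>' t = s * (grad g (p + t *\<^sub>R w) \<bullet> w) - m * (\<nu> \<bullet> w) - t * s * (H w \<bullet> w)" for t
    have der: "(\<psi> has_real_derivative \<psi>' t) (at t)" if "0 \<le> t" "t \<le> 1" for t
    proof -
      have l: "((\<lambda>t. p + t *\<^sub>R w) has_derivative (\<lambda>t. t *\<^sub>R w)) (at t)"
        by (auto intro!: derivative_eq_intros)
      have "((\<lambda>t. g (p + t *\<^sub>R w)) has_real_derivative grad g (p + t *\<^sub>R w) \<bullet> w) (at t)"
        using has_derivative_compose[OF l gd[OF inD(1)[OF that], unfolded gderiv_def]]
        by (simp add: has_field_derivative_def inner_commute mult_commute_abs)
      then show ?thesis unfolding \<psi>_def \<psi>'_def G_def
        by (auto intro!: derivative_eq_intros simp: algebra_simps)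
    qed
    have "\<exists>t>0. t < 1 \<and> \<psi> 1 - \<psi> 0 = (1 - 0) * \<psi>' t" by (intro MVT2) (auto intro: der)
    then obtain t where t: "0 < t" "t < 1" "\<psi> 1 = \<psi>' t" by (auto simp: \<psi>_def G_p)
    have "\<psi>' t = s * ((grad g (p + t *\<^sub>R w) - grad g p - H (t *\<^sub>R w)) \<bullet> w)"
      using arg_cong[OF grad_nu, of "\<lambda>v. v \<bullet> w"]
      by (simp add: \<psi>'_def linear_scale[OF lin_H] inner_diff_left algebra_simps)
    then have "\<bar>\<psi>' t\<bar> = \<bar>(grad g (p + t *\<^sub>R w) - grad g p - H (t *\<^sub>R w)) \<bullet> w\<bar>"
      using s by (auto simp: abs_mult)
    also have "\<dots> \<le> norm (grad g (p + t *\<^sub>R w) - grad g p - H (t *\<^sub>R w)) * norm w"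
      by (rule Cauchy_Schwarz_ineq2)
    also have "\<dots> \<le> (e * norm (t *\<^sub>R w)) * norm w"
      using d2(2)[of "p + t *\<^sub>R w"] inD(2)[of t] t by (intro mult_right_mono) auto
    also have "\<dots> = t * (e * (norm w)\<^sup>2)" using t by (simp add: power2_eq_square)
    also have "\<dots> \<le> 1 * (e * (norm w)\<^sup>2)" using t e by (intro mult_right_mono) auto
    finally show "\<bar>G (p + w) - m * (\<nu> \<bullet> w) - s / 2 * (H w \<bullet> w)\<bar> \<le> e * (norm w)\<^sup>2"
      using t(3) by (simp add: \<psi>_def)
  qed
  moreover have "d > 0" using d1 d2 d3 by (simp add: d_def)
  ultimately show ?thesis using that by blast
qed

text \<open>The error is measured against \<open>t + q u\<close>, the natural size when
  \<open>t\<close> scales like the square of \<open>u\<close>. Among the quadratic terms only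
  \<open>q\<close> has this size; the mixed term and the term in \<open>t\<close> alone are absorbed
  by a small multiple of \<open>t\<close>.\<close>

lemma taylor_P:
  assumes e: "\<eta> > 0"
  obtains r where "r > 0"
    "\<And>u t. norm u \<le> r \<Longrightarrow> 0 \<le> t \<Longrightarrow> t \<le> r \<Longrightarrow> P u t \<in> D \<and> s * (grad g (P u t) \<bullet> \<nu>) > 0 \<and>
       \<bar>G (P u t) / m - t + q u\<bar> \<le> \<eta> * (t + q u)"
proof -
  obtain c where c: "c > 0" "\<And>u. q u \<ge> c * (norm u)\<^sup>2" by (rule q_lower) blast
  obtain K where K: "K > 0" "\<And>w. norm (H w) \<le> norm w * K"
    using bounded_linear.pos_bounded lin_H by (metis linear_conv_bounded_linear)
  define e where "e = \<eta> * m * c"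
  have e0: "e > 0" using assms m_pos c by (simp add: e_def)
  obtain d where d: "d > 0" "\<And>w. norm w < d \<Longrightarrow> p + w \<in> D \<and> s * (grad g (p + w) \<bullet> \<nu>) > 0 \<and>
       \<bar>G (p + w) - m * (\<nu> \<bullet> w) - s / 2 * (H w \<bullet> w)\<bar> \<le> e * (norm w)\<^sup>2"
    by (rule taylor[OF e0]) blast
  \<comment> \<open>The second bound keeps all error terms that carry a factor \<open>t\<close>
    below \<open>\<eta> * m * t\<close>.\<close>
  define r where "r = min (d / 3) (\<eta> * m / (e + 2 * K))"
  have r: "r > 0" using d e0 K assms m_pos by (simp add: r_def)
  have r2: "e * r + 2 * K * r \<le> \<eta> * m"
  proof -
    have "r \<le> \<eta> * m / (e + 2 * K)" by (simp add: r_def)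
    then have "r * (e + 2 * K) \<le> \<eta> * m" using e0 K by (simp add: pos_le_divide_eq)
    then show ?thesis by (simp add: algebra_simps)
  qed
  have "P u t \<in> D \<and> s * (grad g (P u t) \<bullet> \<nu>) > 0 \<and> \<bar>G (P u t) / m - t + q u\<bar> \<le> \<eta> * (t + q u)"
    if ut: "norm u \<le> r" "0 \<le> t" "t \<le> r" for u t
  proof -
    define w where "w = T u + t *\<^sub>R \<nu>"
    have Pw: "P u t = p + w" by (simp add: P_def w_def add.assoc)
    have "norm w \<le> norm u + t"
      using norm_triangle_ineq[of "T u" "t *\<^sub>R \<nu>"] ut by (simp add: w_def T_norm norm_nu)
    also have "\<dots> < d" using ut d by (simp add: r_def)
    finally have wd: "norm w < d" .
    have nw: "(norm w)\<^sup>2 = (norm u)\<^sup>2 + t\<^sup>2"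
      by (simp add: w_def power2_norm_eq_inner inner_add_left inner_add_right T_nu nu_T T_inner nu_nu
          power2_eq_square[of t])
    have nuw: "\<nu> \<bullet> w = t" by (simp add: w_def inner_add_right nu_T nu_nu)
    define E where "E = t * (H (T u) \<bullet> \<nu>) + t\<^sup>2 / 2 * (H \<nu> \<bullet> \<nu>)"
    have "H w \<bullet> w = H (T u) \<bullet> T u + 2 * E"
      using symH[of \<nu> "T u"]
      by (simp add: w_def E_def linear_add[OF lin_H] linear_scale[OF lin_H] inner_add_left
          inner_add_right inner_commute[of \<nu> "H (T u)"] power2_eq_square algebra_simps)
    moreover have "s / 2 * (H (T u) \<bullet> T u) = - m * q u" using m_pos by (simp add: q_def)
    ultimately have Hw: "s / 2 * (H w \<bullet> w) = - m * q u + s * E" by (simp add: algebra_simps)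
    have b1: "\<bar>H (T u) \<bullet> \<nu>\<bar> \<le> K * r"
    proof -
      have "\<bar>H (T u) \<bullet> \<nu>\<bar> \<le> norm (H (T u)) * norm \<nu>" by (rule Cauchy_Schwarz_ineq2)
      also have "\<dots> \<le> norm u * K" using K(2)[of "T u"] by (simp add: norm_nu T_norm)
      also have "\<dots> \<le> K * r" using ut K by (simp add: mult.commute)
      finally show ?thesis .
    qed
    have b2: "\<bar>H \<nu> \<bullet> \<nu>\<bar> \<le> K"
    proof -
      have "\<bar>H \<nu> \<bullet> \<nu>\<bar> \<le> norm (H \<nu>) * norm \<nu>" by (rule Cauchy_Schwarz_ineq2)
      then show ?thesis using K(2)[of \<nu>] by (simp add: norm_nu)
    qed
    have Eb: "\<bar>s * E\<bar> \<le> t * (2 * K * r)"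
    proof -
      have "\<bar>s * E\<bar> = \<bar>E\<bar>" using s by auto
      also have "\<dots> \<le> t * \<bar>H (T u) \<bullet> \<nu>\<bar> + t * (t * \<bar>H \<nu> \<bullet> \<nu>\<bar>)"
      proof -
        have "\<bar>E\<bar> \<le> \<bar>t * (H (T u) \<bullet> \<nu>)\<bar> + \<bar>t\<^sup>2 / 2 * (H \<nu> \<bullet> \<nu>)\<bar>" unfolding E_def by (rule abs_triangle_ineq)
        also have "\<dots> = t * \<bar>H (T u) \<bullet> \<nu>\<bar> + t\<^sup>2 / 2 * \<bar>H \<nu> \<bullet> \<nu>\<bar>" using ut by (simp add: abs_mult)
        also have "t\<^sup>2 / 2 * \<bar>H \<nu> \<bullet> \<nu>\<bar> \<le> t\<^sup>2 * \<bar>H \<nu> \<bullet> \<nu>\<bar>" by (intro mult_right_mono) auto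
        finally show ?thesis by (simp add: power2_eq_square mult.assoc)
      qed
      also have "\<dots> \<le> t * (K * r) + t * (r * K)"
        using ut b1 b2 K by (intro add_mono mult_left_mono mult_mono) auto
      finally show ?thesis by (simp add: algebra_simps)
    qed
    have main: "\<bar>G (p + w) - m * t - (- m * q u + s * E)\<bar> \<le> e * ((norm u)\<^sup>2 + t\<^sup>2)"
      using d(2)[OF wd] nuw Hw nw by metis
    have m0: "m \<noteq> 0" using m_pos by simp
    have "m * \<bar>G (P u t) / m - t + q u\<bar> = \<bar>m * (G (P u t) / m - t + q u)\<bar>"
      using m_pos by (simp add: abs_mult)
    also have "m * (G (P u t) / m - t + q u) = G (p + w) - m * t + m * q u"
      using m0 by (simp add: Pw algebra_simps)
    also have "\<bar>G (p + w) - m * t + m * q u\<bar> \<le> e * ((norm u)\<^sup>2 + t\<^sup>2) + t * (2 * K * r)"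
      using main Eb by linarith
    also have "\<dots> = e * (norm u)\<^sup>2 + t * (e * t + 2 * K * r)" by (simp add: power2_eq_square algebra_simps)
    also have "\<dots> \<le> \<eta> * m * q u + t * (\<eta> * m)"
    proof (intro add_mono mult_left_mono)
      have "\<eta> * m * (c * (norm u)\<^sup>2) \<le> \<eta> * m * q u" using c(2) assms m_pos by (intro mult_left_mono) auto
      then show "e * (norm u)\<^sup>2 \<le> \<eta> * m * q u" by (simp add: e_def mult.assoc)
      have "e * t \<le> e * r" using ut e0 by simp
      then show "e * t + 2 * K * r \<le> \<eta> * m" using r2 by linarith
    qed (use ut in auto)
    also have "\<dots> = m * (\<eta> * (t + q u))" by (simp add: algebra_simps)
    finally show ?thesis using m_pos d(2)[OF wd] by (simp add: Pw)
  qed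
  with r show ?thesis using that by blast
qed

end

section \<open>Hulls of pieces of the level, and the parallel point\<close>

context cap_point
begin

text \<open>A convex set that contains the level, hence every hull formed from it, and also the
  convex side; it bounds the hulls from outside.\<close>

definition "C = {y. \<forall>y'\<in>level D g k. s * (grad g y' \<bullet> (y - y')) \<ge> 0}"

lemma level_C: "level D g k \<subseteq> C" using sup[of k] by (auto simp: C_def)

lemma convex_C: "convex C"
proof -
  have "C = (\<Inter>y'\<in>level D g k. {y. s * (grad g y' \<bullet> y) \<ge> s * (grad g y' \<bullet> y')})"
    by (auto simp: C_def inner_diff_right right_diff_distrib)
  moreover have "convex {y. s * (grad g y' \<bullet> y) \<ge> b}" for y' b
    using convex_halfspace_ge[of b "s *\<^sub>R grad g y'"] by simp
  ultimately show ?thesis by (auto intro: convex_INT)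
qed

lemma C_height: "y \<in> C \<Longrightarrow> \<nu> \<bullet> (y - p) \<ge> 0"
proof -
  assume "y \<in> C"
  then have "s * (grad g p \<bullet> (y - p)) \<ge> 0" using p by (auto simp: C_def)
  moreover have "s * (grad g p \<bullet> (y - p)) = m * (\<nu> \<bullet> (y - p))"
    using arg_cong[OF grad_nu, of "\<lambda>v. v \<bullet> (y - p)"] by simp
  ultimately show ?thesis using m_pos by (simp add: zero_le_mult_iff)
qed

lemma convex_side_C: "convex_side D g k \<subseteq> C"
proof
  fix y assume y: "y \<in> convex_side D g k"
  show "y \<in> C" unfolding C_def
  proof (intro CollectI ballI)
    fix y' assume y': "y' \<in> level D g k"
    then have "convex_normal D g k y' \<bullet> (y - y') > 0" using y by (auto simp: convex_side_def)
    then have "s * (grad g y' \<bullet> (y - y')) / norm (grad g y') > 0"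
      by (simp add: sg unit_grad_inner)
    then show "s * (grad g y' \<bullet> (y - y')) \<ge> 0" by (auto simp: zero_less_divide_iff)
  qed
qed

definition good :: "real \<Rightarrow> bool" where
  "good r \<longleftrightarrow> r > 0 \<and>
    (\<forall>u t. norm u \<le> r \<longrightarrow> 0 \<le> t \<longrightarrow> t \<le> r \<longrightarrow> P u t \<in> D \<and> s * (grad g (P u t) \<bullet> \<nu>) > 0 \<and>
       \<bar>G (P u t) / m - t + q u\<bar> \<le> 1/2 * (t + q u)) \<and>
    (\<forall>u t. norm u \<le> r \<longrightarrow> 0 \<le> t \<longrightarrow> t \<le> r \<longrightarrow> P u t \<in> C \<longrightarrow> G (P u t) \<ge> 0)"

lemma goodD:
  assumes "good r" "norm u \<le> r" "0 \<le> t" "t \<le> r"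
  shows "P u t \<in> D" "s * (grad g (P u t) \<bullet> \<nu>) > 0" "\<bar>G (P u t) / m - t + q u\<bar> \<le> 1/2 * (t + q u)"
    "P u t \<in> C \<Longrightarrow> G (P u t) \<ge> 0" "G (P u t) \<le> m * (3/2 * t - q u / 2)" "G (P u t) \<ge> m * (t / 2 - 3/2 * q u)"
proof -
  show 1: "P u t \<in> D" "s * (grad g (P u t) \<bullet> \<nu>) > 0" "\<bar>G (P u t) / m - t + q u\<bar> \<le> 1/2 * (t + q u)"
    "P u t \<in> C \<Longrightarrow> G (P u t) \<ge> 0" using assms by (auto simp: good_def)
  from 1(3) have "G (P u t) / m \<le> 3/2 * t - q u / 2" "G (P u t) / m \<ge> t / 2 - 3/2 * q u"
    unfolding abs_le_iff by (simp_all add: field_simps)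
  then show "G (P u t) \<le> m * (3/2 * t - q u / 2)" "G (P u t) \<ge> m * (t / 2 - 3/2 * q u)"
    using m_pos by (simp_all add: field_simps)
qed

lemma continuous_GP:
  assumes "continuous_on A f" "continuous_on A h" "\<And>x. x \<in> A \<Longrightarrow> P (f x) (h x) \<in> D"
  shows "continuous_on A (\<lambda>x. G (P (f x) (h x)))"
  by (rule continuous_on_compose2[OF continuous_G continuous_P[OF assms(1,2)]]) (use assms(3) in auto)

text \<open>Near \<open>p\<close> the convex set \<open>C\<close> lies on the side \<open>G \<ge> 0\<close>: from a point with \<open>G < 0\<close> the ray in
  direction \<open>\<nu>\<close> meets the level \<open>k\<close>, whose supporting half space there excludes the point.\<close>

lemma exists_good: obtains r where "good r"
proof -
  obtain r where r: "r > 0"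
    "\<And>u t. norm u \<le> r \<Longrightarrow> 0 \<le> t \<Longrightarrow> t \<le> r \<Longrightarrow> P u t \<in> D \<and> s * (grad g (P u t) \<bullet> \<nu>) > 0 \<and>
       \<bar>G (P u t) / m - t + q u\<bar> \<le> 1/2 * (t + q u)"
    using taylor_P[of "1/2"] by (metis half_gt_zero_iff zero_less_one)
  have "isCont q 0" using continuous_q[of UNIV] by (simp add: continuous_on_eq_continuous_at)
  moreover have "q 0 = 0" using q_scale[of 0 0] by simp
  ultimately obtain r' where r': "r' > 0" "\<And>u. norm u < r' \<Longrightarrow> \<bar>q u\<bar> < r / 3"
    using r(1) unfolding continuous_at_eps_delta by (metis diff_zero dist_norm dist_real_def zero_less_divide_iff zero_less_numeral)
  define r1 where "r1 = min r (r' / 2)"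
  have r1: "r1 > 0" "r1 \<le> r" using r(1) r'(1) by (auto simp: r1_def)
  have "G (P u t) \<ge> 0" if ut: "norm u \<le> r1" "0 \<le> t" "t \<le> r1" and PC: "P u t \<in> C" for u t
  proof (rule ccontr)
    assume neg: "\<not> G (P u t) \<ge> 0"
    have "\<bar>q u\<bar> < r / 3" using ut r' by (intro r') (simp add: r1_def)
    then have "q u < r / 3" by simp
    moreover have "\<bar>G (P u r) / m - r + q u\<bar> \<le> 1/2 * (r + q u)" using r(2)[of u r] ut r1 r(1) by auto
    then have "- (G (P u r) / m - r + q u) \<le> 1/2 * (r + q u)" by linarith
    ultimately have "G (P u r) / m > 0" by (simp add: field_simps)
    then have "G (P u r) > 0" using m_pos by (simp add: zero_less_divide_iff)
    then have "\<exists>\<tau>\<ge>t. \<tau> \<le> r \<and> G (P u \<tau>) = 0"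
      using neg ut r1 r by (intro IVT' continuous_GP continuous_on_const continuous_on_id) auto
    then obtain \<tau> where t: "t \<le> \<tau>" "\<tau> \<le> r" "G (P u \<tau>) = 0" by blast
    have "t \<noteq> \<tau>" using neg t by auto
    then have tt: "t < \<tau>" using t by simp
    have R: "P u \<tau> \<in> D" "s * (grad g (P u \<tau>) \<bullet> \<nu>) > 0" using r(2)[of u \<tau>] ut t r1 by auto
    then have "P u \<tau> \<in> level D g k" using t by (simp add: G_level)
    then have "s * (grad g (P u \<tau>) \<bullet> (P u t - P u \<tau>)) \<ge> 0" using PC by (auto simp: C_def)
    moreover have "P u t - P u \<tau> = (t - \<tau>) *\<^sub>R \<nu>" by (simp add: P_def algebra_simps)
    ultimately have "(t - \<tau>) * (s * (grad g (P u \<tau>) \<bullet> \<nu>)) \<ge> 0" by (simp add: mult_ac)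
    then show False using tt R(2) by (simp add: zero_le_mult_iff)
  qed
  moreover have "P u t \<in> D \<and> s * (grad g (P u t) \<bullet> \<nu>) > 0 \<and>
       \<bar>G (P u t) / m - t + q u\<bar> \<le> 1/2 * (t + q u)" if "norm u \<le> r1" "0 \<le> t" "t \<le> r1" for u t
    using r(2)[of u t] that r1 by linarith
  ultimately have "good r1" using r1(1) unfolding good_def by blast
  then show ?thesis using that by blast
qed

text \<open>The factor 3 makes the upper estimate \<open>3/2 * t - q u / 2\<close> negative on the
  wall \<open>norm u = r\<close> for all heights up to \<open>t0\<close>, so caps of this height
  cannot reach the wall.\<close>

definition fits :: "real \<Rightarrow> real \<Rightarrow> bool" where
  "fits r t0 \<longleftrightarrow> good r \<and> 0 < t0 \<and> t0 \<le> r \<and> (\<forall>u. norm u = r \<longrightarrow> q u > 3 * t0)"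

lemma exists_fits: assumes "good r" obtains t0 where "fits r t0"
proof -
  obtain c where c: "c > 0" "\<And>u. q u \<ge> c * (norm u)\<^sup>2" by (rule q_lower) blast
  have r: "r > 0" using assms by (simp add: good_def)
  define t0 where "t0 = min r (c * r\<^sup>2 / 6)"
  have t0: "t0 > 0" "3 * t0 < c * r\<^sup>2" using r c by (auto simp: t0_def min_def)
  have "q u > 3 * t0" if "norm u = r" for u using c(2)[of u] t0(2) that by simp
  then have "fits r t0" using assms t0(1) by (simp add: fits_def t0_def)
  then show ?thesis using that by blast
qed

lemma fits_mono: "fits r t0 \<Longrightarrow> 0 < t \<Longrightarrow> t \<le> t0 \<Longrightarrow> fits r t"
  unfolding fits_def by force

definition "A r t = {u. norm u \<le> r \<and> G (P u t) \<ge> 0}"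

lemma fits_boundary: "fits r t0 \<Longrightarrow> norm u = r \<Longrightarrow> 0 \<le> t \<Longrightarrow> t \<le> t0 \<Longrightarrow> G (P u t) < 0"
proof -
  assume a: "fits r t0" "norm u = r" "0 \<le> t" "t \<le> t0"
  then have "q u > 3 * t" by (fastforce simp: fits_def)
  then have "m * (3/2 * t - q u / 2) < 0" using m_pos by (simp add: mult_pos_neg)
  then show ?thesis using goodD(5)[of r u t] a by (simp add: fits_def)
qed

text \<open>The segment from \<open>p\<close> to a point of \<open>C\<close> beyond the wall would
  stay in \<open>C\<close> and cross the wall \<open>norm u = r\<close>, where \<open>G\<close> is
  negative, although \<open>C\<close> lies in \<open>G \<ge> 0\<close> near
  \<open>p\<close>.\<close>

lemma C_local:
  assumes F: "fits r t0" and PC: "P u t \<in> C" and t: "0 \<le> t" "t \<le> t0"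
  shows "u \<in> A r t"
proof -
  have gr: "good r" and tr: "t0 \<le> r" "t0 > 0" using F by (auto simp: fits_def)
  have "norm u \<le> r"
  proof (rule ccontr)
    assume nu: "\<not> norm u \<le> r"
    define l where "l = r / norm u"
    have r: "r > 0" using gr by (simp add: good_def)
    have un: "norm u > 0" using nu r by linarith
    then have l: "0 < l" "l < 1" using nu r by (auto simp: l_def divide_less_eq)
    have pP: "p = P 0 0" by (simp add: P_def linear_0[OF T_lin])
    have "P (l *\<^sub>R u + (1 - l) *\<^sub>R 0) (l * t + (1 - l) * 0) = l *\<^sub>R P u t + (1 - l) *\<^sub>R P 0 0"
      by (rule P_affine) simp
    also have "\<dots> \<in> C"
    proof (rule convexD[OF convex_C PC])
      show "P 0 0 \<in> C" using level_C p pP by auto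
    qed (use l in auto)
    finally have C': "P (l *\<^sub>R u) (l * t) \<in> C" by simp
    have n: "norm (l *\<^sub>R u) = r" using un r by (simp add: l_def)
    have lt: "0 \<le> l * t" "l * t \<le> t0" using l t by (auto intro: order_trans[OF mult_left_le_one_le])
    have "G (P (l *\<^sub>R u) (l * t)) \<ge> 0"
      by (rule goodD(4)[OF gr _ lt(1) _ C']) (use n lt tr in auto)
    then show False using fits_boundary[OF F n lt] by simp
  qed
  moreover have "G (P u t) \<ge> 0" using goodD(4)[OF gr calculation t(1) _ PC] t tr by simp
  ultimately show ?thesis by (simp add: A_def)
qed

text \<open>On the diameter through \<open>u\<close> at height \<open>t\<close>, \<open>G\<close> is
  nonnegative at \<open>u\<close> and negative at both ends, so \<open>u\<close> lies between two
  points of the level at the same height.\<close>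

lemma A_in_hull:
  assumes F: "fits r t0" and u: "u \<in> A r t" and t: "0 \<le> t" "t \<le> t0"
  shows "P u t \<in> convex hull (level D g k \<inter> {y. \<nu> \<bullet> (y - p) = t})"
proof -
  have gr: "good r" and tr: "t0 \<le> r" using F by (auto simp: fits_def)
  have r: "r > 0" using gr by (simp add: good_def)
  have un: "norm u \<le> r" "G (P u t) \<ge> 0" using u by (auto simp: A_def)
  obtain e where e: "norm e = 1" "u = norm u *\<^sub>R e"
  proof (cases "u = 0")
    case True
    have "norm (axis undefined 1 :: real^'n) = 1" by simp
    then show ?thesis using that[of "axis undefined 1"] True by simp
  next
    case False
    then show ?thesis using that[of "u /\<^sub>R norm u"] by simp
  qed
  have n1: "norm (u + a *\<^sub>R e) = \<bar>norm u + a\<bar>" for a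
  proof -
    have "u + a *\<^sub>R e = (norm u + a) *\<^sub>R e" by (subst e(2)) (simp add: algebra_simps)
    then show ?thesis using e(1) by simp
  qed
  have inD: "P (u + a *\<^sub>R e) t \<in> D" if "- r \<le> norm u + a" "norm u + a \<le> r" for a
    by (rule goodD(1)[OF gr]) (use that t tr in \<open>auto simp: n1\<close>)
  have c: "continuous_on B (\<lambda>a. G (P (u + a *\<^sub>R e) t))" if "B \<subseteq> {- r - norm u .. r - norm u}" for B
    by (intro continuous_GP continuous_intros) (use that inD in force)
  have zero: "P (u + a *\<^sub>R e) t \<in> level D g k \<inter> {y. \<nu> \<bullet> (y - p) = t}"
    if "G (P (u + a *\<^sub>R e) t) = 0" "- r \<le> norm u + a" "norm u + a \<le> r" for a
    using inD[OF that(2,3)] that by (simp add: G_level nu_P)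
  have "\<exists>a\<ge>0. a \<le> r - norm u \<and> G (P (u + a *\<^sub>R e) t) = 0"
  proof (rule IVT2')
    show "G (P (u + (r - norm u) *\<^sub>R e) t) \<le> 0"
      using fits_boundary[OF F _ t, of "u + (r - norm u) *\<^sub>R e"] r by (simp add: n1)
    have "- r \<le> norm u" using r norm_ge_zero[of u] by linarith
    then show "continuous_on {0..r - norm u} (\<lambda>a. G (P (u + a *\<^sub>R e) t))" using r by (intro c) auto
  qed (use un in auto)
  then obtain a where a: "a \<ge> 0" "a \<le> r - norm u" "G (P (u + a *\<^sub>R e) t) = 0" by blast
  have "\<exists>b\<ge>- r - norm u. b \<le> 0 \<and> G (P (u + b *\<^sub>R e) t) = 0"
  proof (rule IVT')
    show "G (P (u + (- r - norm u) *\<^sub>R e) t) \<le> 0"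
      using fits_boundary[OF F _ t, of "u + (- r - norm u) *\<^sub>R e"] r by (simp add: n1)
    show "continuous_on {- r - norm u..0} (\<lambda>a. G (P (u + a *\<^sub>R e) t))" using un by (intro c) auto
    show "- r - norm u \<le> 0" using r norm_ge_zero[of u] by linarith
  qed (use un in auto)
  then obtain b where b: "b \<ge> - r - norm u" "b \<le> 0" "G (P (u + b *\<^sub>R e) t) = 0" by blast
  let ?L = "level D g k \<inter> {y. \<nu> \<bullet> (y - p) = t}"
  have L: "P (u + a *\<^sub>R e) t \<in> ?L" "P (u + b *\<^sub>R e) t \<in> ?L"
    using zero[OF a(3)] zero[OF b(3)] a b un r by (auto simp: field_simps)
  show ?thesis
  proof (cases "a - b = 0")
    case True
    then have "a = 0" using a b by simp
    then show ?thesis using L(1) hull_inc[of _ ?L] by simp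
  next
    case False
    then have ab: "a - b > 0" using a b by simp
    define l where "l = - b / (a - b)"
    have l: "0 \<le> l" "l \<le> 1"
    proof -
      show "0 \<le> l" unfolding l_def using ab b by (intro divide_nonneg_pos) auto
      show "l \<le> 1" unfolding l_def by (subst pos_divide_le_eq[OF ab]) (use a in simp)
    qed
    have "l * a + (1 - l) * b = l * (a - b) + b" by (simp add: algebra_simps)
    also have "\<dots> = 0" using ab by (simp add: l_def)
    finally have "l *\<^sub>R (u + a *\<^sub>R e) + (1 - l) *\<^sub>R (u + b *\<^sub>R e) = u"
      using scaleR_left_distrib[of "l * a" "(1 - l) * b" e] by (simp add: algebra_simps)
    moreover have "l * t + (1 - l) * t = t" by (simp add: algebra_simps)
    ultimately have "P u t = l *\<^sub>R P (u + a *\<^sub>R e) t + (1 - l) *\<^sub>R P (u + b *\<^sub>R e) t"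
      using P_affine[of l "1 - l" "u + a *\<^sub>R e" "u + b *\<^sub>R e" t t] by simp
    then show ?thesis
      using convexD[OF convex_convex_hull, of _ ?L _ l "1 - l"] hull_inc[OF L(1)] hull_inc[OF L(2)] l
      by simp
  qed
qed

text \<open>The hull lies in \<open>C\<close>, which is controlled by \<open>C_local\<close>; the
  converse is \<open>A_in_hull\<close>. From here on a section is described by one inequality
  instead of a hull.\<close>

lemma hull_section:
  assumes F: "fits r t0" and t: "0 \<le> t" "t \<le> t0"
  shows "P u t \<in> convex hull (level D g k \<inter> {y. \<nu> \<bullet> (y - p) = t}) \<longleftrightarrow> u \<in> A r t"
proof
  assume "P u t \<in> convex hull (level D g k \<inter> {y. \<nu> \<bullet> (y - p) = t})"
  also have "\<dots> \<subseteq> C" by (intro hull_minimal convex_C) (use level_C in auto)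
  finally show "u \<in> A r t" by (rule C_local[OF F _ t])
qed (rule A_in_hull[OF F _ t])

text \<open>Each slice on the right is already in the hull of the level within its own hyperplane;
  the reverse inclusion passes through \<open>C\<close>.\<close>

lemma hull_cap:
  assumes F: "fits r t0" and t: "0 \<le> t" "t \<le> t0"
  shows "convex hull (level D g k \<inter> {y. \<nu> \<bullet> (y - p) \<ge> 0 \<and> \<nu> \<bullet> (y - p) \<le> t})
    = (\<lambda>(u, \<tau>). P u \<tau>) ` {(u, \<tau>). 0 \<le> \<tau> \<and> \<tau> \<le> t \<and> u \<in> A r \<tau>}" (is "convex hull ?L = ?X")
proof (intro subset_antisym subsetI)
  fix y assume y: "y \<in> convex hull ?L"
  have "convex {y. \<nu> \<bullet> (y - p) \<le> t}"
  proof -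
    have "{y. \<nu> \<bullet> (y - p) \<le> t} = {y. \<nu> \<bullet> y \<le> t + \<nu> \<bullet> p}" by (auto simp: inner_diff_right)
    then show ?thesis by (simp add: convex_halfspace_le)
  qed
  then have "convex hull ?L \<subseteq> C \<inter> {y. \<nu> \<bullet> (y - p) \<le> t}"
    by (intro hull_minimal convex_Int convex_C) (use level_C in auto)
  then have yC: "y \<in> C" "\<nu> \<bullet> (y - p) \<le> t" using y by auto
  obtain u where u: "y = P u (\<nu> \<bullet> (y - p))" by (rule P_surj)
  let ?\<tau> = "\<nu> \<bullet> (y - p)"
  have \<tau>: "0 \<le> ?\<tau>" "?\<tau> \<le> t0" using C_height[OF yC(1)] yC(2) t by auto
  have "P u ?\<tau> \<in> C" using yC(1) u by metis
  then have "u \<in> A r ?\<tau>" using C_local[OF F _ \<tau>] by blast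
  then show "y \<in> ?X" using u \<tau> yC(2) by (intro image_eqI[of _ _ "(u, ?\<tau>)"]) auto
next
  fix y assume "y \<in> ?X"
  then obtain u \<tau> where u: "y = P u \<tau>" "0 \<le> \<tau>" "\<tau> \<le> t" "u \<in> A r \<tau>" by auto
  then have "y \<in> convex hull (level D g k \<inter> {y. \<nu> \<bullet> (y - p) = \<tau>})"
    using A_in_hull[OF F u(4)] t by simp
  moreover have "convex hull (level D g k \<inter> {y. \<nu> \<bullet> (y - p) = \<tau>}) \<subseteq> convex hull ?L"
    using u by (intro hull_mono) auto
  ultimately show "y \<in> convex hull ?L" by blast
qed

lemma q_bound_A:
  assumes F: "fits r t0" and u: "u \<in> A r t" and t: "0 \<le> t" "t \<le> t0"
  shows "q u \<le> 3 * t"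
proof -
  have "m * (3/2 * t - q u / 2) \<ge> 0"
    using goodD(5)[of r u t] F u t by (simp add: fits_def A_def)
  then show ?thesis using m_pos by (simp add: zero_le_mult_iff)
qed

text \<open>The parallel point is found by minimising the height over \<open>{G \<ge> e}\<close> near \<open>p\<close>.\<close>

lemma parallel_point_exists:
  assumes F: "fits r t0" and e: "0 < e" "e \<le> m * t0 / 4"
  obtains u t where "norm u < r" "0 < t" "t < t0" "G (P u t) = e" "s *\<^sub>R unit_grad g (P u t) = \<nu>"
proof -
  have gr: "good r" and tr: "t0 \<le> r" and t0: "t0 > 0" using F by (auto simp: fits_def)
  have r: "r > 0" using gr by (simp add: good_def)
  define B where "B = cball (0::real^'n) r \<times> {0..t0}"
  have BD: "P u t \<in> D" if "(u, t) \<in> B" for u t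
    by (rule goodD(1)[OF gr]) (use that tr in \<open>auto simp: B_def\<close>)
  have cG: "continuous_on B (\<lambda>x. G (P (fst x) (snd x)))"
    by (intro continuous_GP continuous_on_fst continuous_on_snd continuous_on_id) (use BD in auto)
  define X where "X = B \<inter> (\<lambda>x. G (P (fst x) (snd x))) -` {e..}"
  have "compact B" unfolding B_def by (intro compact_Times) auto
  then have "closed X" unfolding X_def
    by (intro continuous_closed_preimage[OF cG]) (auto simp: compact_imp_closed)
  then have "compact X" using \<open>compact B\<close> by (metis X_def Int_left_absorb compact_Int_closed)
  \<comment> \<open>On the axis at half height the lower estimate gives \<open>m * t0 / 4\<close>,
    the origin of the bound on \<open>e\<close>.\<close>
  have "G (P 0 (t0 / 2)) \<ge> m * (t0 / 2 / 2 - 3/2 * q 0)" by (rule goodD(6)[OF gr]) (use r t0 tr in auto)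
  moreover have "q 0 = 0" using q_scale[of 0 0] by simp
  ultimately have X1: "(0, t0 / 2) \<in> X" using e t0 r by (simp add: X_def B_def)
  have "X \<noteq> {}" "continuous_on X snd" using X1 by (auto intro: continuous_on_snd continuous_on_id)
  then obtain x where x: "x \<in> X" "\<And>y. y \<in> X \<Longrightarrow> snd x \<le> snd y"
    using continuous_attains_inf[OF \<open>compact X\<close>] by blast
  obtain u t where ut: "x = (u, t)" by (cases x)
  have uX: "norm u \<le> r" "0 \<le> t" "t \<le> t0" "G (P u t) \<ge> e" using x(1) by (auto simp: ut X_def B_def)
  have t1: "t < t0" using x(2)[OF X1] t0 by (simp add: ut)
  have u1: "norm u < r" using fits_boundary[OF F _ uX(2,3), of u] uX e by force
  have tpos: "t > 0"
  proof (rule ccontr)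
    assume "\<not> t > 0"
    then have "t = 0" using uX by simp
    then have "G (P u 0) \<le> m * (3/2 * 0 - q u / 2)" using goodD(5)[OF gr uX(1), of 0] r by simp
    also have "\<dots> \<le> 0" using m_pos q_nonneg[of u] by (simp add: zero_le_mult_iff)
    finally show False using uX e \<open>t = 0\<close> by simp
  qed
  define v where "v = P u t"
  have vD: "v \<in> D" using BD[of u t] uX by (simp add: v_def B_def)
  have gn: "s * (grad g v \<bullet> \<nu>) > 0" unfolding v_def by (rule goodD(2)[OF gr]) (use uX tr in auto)
  have gv: "grad g v \<noteq> 0" using gn by auto
  \<comment> \<open>By minimality, a move that lowers the height and stays in the box must leave
    \<open>{G \<ge> e}\<close>.\<close>
  have no_descent: "G (v + a *\<^sub>R (P u' t' - p)) < e"
    if "t' < 0" "0 < a" "norm u + a * norm u' \<le> r" "0 \<le> t + a * t'" for a u' t'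
  proof (rule ccontr)
    assume *: "\<not> G (v + a *\<^sub>R (P u' t' - p)) < e"
    have "v + a *\<^sub>R (P u' t' - p) = P (u + a *\<^sub>R u') (t + a * t')"
      by (simp add: v_def P_def linear_add[OF T_lin] linear_scale[OF T_lin] algebra_simps)
    moreover have "norm (u + a *\<^sub>R u') \<le> r"
      using norm_triangle_ineq[of u "a *\<^sub>R u'"] that by simp
    moreover have "t + a * t' < t" using that by (simp add: mult_pos_neg)
    ultimately have "(u + a *\<^sub>R u', t + a * t') \<in> X" using * that t1 by (auto simp: X_def B_def)
    from x(2)[OF this] \<open>t + a * t' < t\<close> show False by (simp add: ut)
  qed
  have small: "\<forall>\<^sub>F a in at_right 0. norm u + a * norm u' \<le> r \<and> 0 \<le> t + a * t' \<and> 0 < a" for u' :: "real^'n" and t' :: real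
  proof -
    have "((\<lambda>a. norm u + a * norm u') \<longlongrightarrow> norm u + 0 * norm u') (at_right 0)"
      "((\<lambda>a. t + a * t') \<longlongrightarrow> t + 0 * t') (at_right 0)" by (intro tendsto_intros)+
    then have "\<forall>\<^sub>F a in at_right 0. norm u + a * norm u' < r" "\<forall>\<^sub>F a in at_right 0. 0 < t + a * t'"
      using u1 tpos by (auto dest: order_tendstoD)
    moreover have "\<forall>\<^sub>F a in at_right (0::real). 0 < a" by (simp add: eventually_at_right_less)
    ultimately show ?thesis by eventually_elim auto
  qed
  have Gv: "G v = e"
  proof (rule ccontr)
    assume "G v \<noteq> e"
    then have "G v > e" using uX by (simp add: v_def)
    have "isCont G v" using continuous_G open_D vD by (simp add: continuous_on_eq_continuous_at)
    then have "((\<lambda>a. G (v + a *\<^sub>R (P 0 (-1) - p))) \<longlongrightarrow> G (v + 0 *\<^sub>R (P 0 (-1) - p))) (at_right 0)"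
      by (intro isCont_tendsto_compose[where g = G] tendsto_intros) simp
    then have "\<forall>\<^sub>F a in at_right 0. G (v + a *\<^sub>R (P 0 (-1) - p)) > e"
      using \<open>G v > e\<close> by (intro order_tendstoD) auto
    with small[of 0 "-1"] have "\<forall>\<^sub>F a in at_right (0::real). False"
      by eventually_elim (use no_descent[of "-1" _ 0] in fastforce)
    then show False by simp
  qed
  define N where "N = s *\<^sub>R unit_grad g v"
  have nN: "norm N = 1" using s norm_unit_grad[OF gv] by (auto simp: N_def)
  have "N = \<nu>"
  proof (rule ccontr)
    assume ne: "N \<noteq> \<nu>"
    have "norm (N - \<nu>) > 0" using ne by simp
    then have "(N - \<nu>) \<bullet> (N - \<nu>) > 0" by simp
    moreover have "N \<bullet> N = 1" using nN by (simp add: norm_eq_1)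
    ultimately have lt: "N \<bullet> \<nu> < 1"
      by (simp add: inner_diff_left inner_diff_right nu_nu inner_commute)
    \<comment> \<open>If the unit normals differed, \<open>w\<close> would point strictly downwards
      and yet increase \<open>G\<close> to first order, against minimality.\<close>
    define w where "w = N - \<nu>"
    obtain u' where "p + w = P u' (\<nu> \<bullet> (p + w - p))" by (rule P_surj)
    then have w: "w = P u' (\<nu> \<bullet> w) - p" by (simp add: algebra_simps)
    have tw: "\<nu> \<bullet> w < 0" using lt by (simp add: w_def inner_diff_right nu_nu inner_commute)
    have dG: "((\<lambda>a. G (v + a *\<^sub>R w)) has_real_derivative s * (grad g v \<bullet> w)) (at 0)"
    proof -
      have l: "((\<lambda>a. v + a *\<^sub>R w) has_derivative (\<lambda>a. a *\<^sub>R w)) (at 0)"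
        by (auto intro!: derivative_eq_intros)
      have "(g has_derivative (\<lambda>h. h \<bullet> grad g v)) (at (v + 0 *\<^sub>R w))"
        using gd[OF vD] by (simp add: gderiv_def)
      from has_derivative_compose[OF l this]
      have "((\<lambda>a. g (v + a *\<^sub>R w)) has_real_derivative grad g v \<bullet> w) (at 0)"
        by (simp add: has_field_derivative_def inner_commute mult_commute_abs)
      then show ?thesis unfolding G_def by (auto intro!: derivative_eq_intros)
    qed
    have "s * (grad g v \<bullet> w) = norm (grad g v) * (N \<bullet> w)"
      using gv by (simp add: N_def unit_grad_inner)
    also have "\<dots> > 0" using gv lt \<open>N \<bullet> N = 1\<close> by (simp add: w_def inner_diff_right)
    finally have pos: "s * (grad g v \<bullet> w) > 0" .
    obtain d where d: "d > 0" "\<And>a. 0 < a \<Longrightarrow> a < d \<Longrightarrow> G (v + 0 *\<^sub>R w) < G (v + (0 + a) *\<^sub>R w)"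
      using DERIV_pos_inc_right[OF dG pos] by auto
    have "((\<lambda>a. a) \<longlongrightarrow> (0::real)) (at_right 0)" by (rule tendsto_ident_at)
    then have "\<forall>\<^sub>F a in at_right 0. a < d" using d(1) by (rule order_tendstoD)
    with small[of u' "\<nu> \<bullet> w"] have "\<forall>\<^sub>F a in at_right (0::real). False"
    proof eventually_elim
      case (elim a)
      then have "G (v + a *\<^sub>R (P u' (\<nu> \<bullet> w) - p)) < e" using tw by (intro no_descent) auto
      moreover have "G (v + a *\<^sub>R w) > e" using d(2)[of a] elim Gv by simp
      ultimately show ?case unfolding w[symmetric] by simp
    qed
    then show False by simp
  qed
  then show ?thesis using that[of u t] u1 tpos t1 Gv by (simp add: v_def N_def)
qed

end

section \<open>Slices between ellipsoids, and the height of the parallel hyperplane\<close>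

context cap_point
begin

definition "B = (\<chi> i j. shape_operator (\<lambda>y. s *\<^sub>R unit_grad g y) p (T (axis j 1)) \<bullet> T (axis i 1))"
definition "K = gauss_kronecker (convex_normal D g k) p"

lemma T_grad: "T u \<bullet> grad g p = 0"
proof -
  have "T u \<bullet> (s *\<^sub>R grad g p) = 0" by (simp add: grad_nu T_nu)
  then show ?thesis using s by auto
qed

lemma B_mult: "(B *v u) \<bullet> v = - s * (H (T u) \<bullet> T v) / m"
proof -
  have lT: "linear T" and lHT: "linear (\<lambda>u. H (T u))"
    using T_lin linear_compose[OF T_lin lin_H] by (auto simp: o_def)
  have Bij: "B $ i $ j = (- s / m) * (H (T (axis j 1)) \<bullet> T (axis i 1))" for i j
    using shape_operator_unit_grad[OF H grad_p T_grad] by (simp add: B_def m_def)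
  have "(B *v u) \<bullet> v = (\<Sum>i\<in>UNIV. (\<Sum>j\<in>UNIV. B $ i $ j * u $ j) * v $ i)"
    by (simp add: inner_vec_def matrix_vector_mult_def)
  also have "\<dots> = (- s / m) * (\<Sum>i\<in>UNIV. (\<Sum>j\<in>UNIV. u $ j * (H (T (axis j 1)) \<bullet> T (axis i 1))) * v $ i)"
    unfolding Bij by (simp only: sum_distrib_left sum_distrib_right mult_ac)
  also have "(\<Sum>i\<in>UNIV. (\<Sum>j\<in>UNIV. u $ j * (H (T (axis j 1)) \<bullet> T (axis i 1))) * v $ i)
      = H (T u) \<bullet> T v"
    unfolding linear_vec_expansion[OF lT, of v] linear_vec_expansion[OF lHT, of u]
    by (simp add: inner_sum_left inner_sum_right sum_distrib_left sum_distrib_right mult_ac)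
  finally show ?thesis by simp
qed

lemma q_B: "q u = ((B *v u) \<bullet> u) / 2"
  by (simp add: B_mult q_def)

lemma B_sym: "(B *v x) \<bullet> y = x \<bullet> (B *v y)"
  using symH[of "T x" "T y"] by (simp add: B_mult inner_commute[of x "B *v y"]) (metis inner_commute symH)

lemma B_pos: "x \<noteq> 0 \<Longrightarrow> (B *v x) \<bullet> x > 0"
  using q_pos[of x] by (simp add: q_B)

lemma K_det: "K = det B"
  using sg[of k] by (simp add: K_def gauss_kronecker_def B_def T_def \<nu>_def)

lemma K_pos: "K > 0"
  unfolding K_det by (rule ellipsoid_measure(1)[OF B_sym B_pos, of 0]) auto

definition "\<omega> = unit_ball_vol (real CARD('n))"

lemma measure_q:
  assumes "x \<ge> 0"
  shows "compact {u. q u \<le> x}" "measure lebesgue {u. q u \<le> x} = \<omega> / sqrt K * sqrt (2 * x) ^ CARD('n)"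
proof -
  have eq: "{u. q u \<le> x} = {u. (B *v u) \<bullet> u \<le> 2 * x}" by (auto simp: q_B)
  show "compact {u. q u \<le> x}" "measure lebesgue {u. q u \<le> x} = \<omega> / sqrt K * sqrt (2 * x) ^ CARD('n)"
    unfolding eq K_det \<omega>_def using ellipsoid_measure(2,3)[OF B_sym B_pos, of "2 * x"] assms by auto
qed

lemma compact_A:
  assumes F: "fits r t0" and t: "0 \<le> t" "t \<le> t0"
  shows "compact (A r t)"
proof -
  have "A r t = cball 0 r \<inter> (\<lambda>u. G (P u t)) -` {0..}" by (auto simp: A_def)
  moreover have "closed (cball 0 r \<inter> (\<lambda>u. G (P u t)) -` {0..})"
    by (intro continuous_closed_preimage continuous_GP continuous_intros)
      (use F t goodD(1)[of r _ t] in \<open>auto simp: fits_def\<close>)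
  ultimately show ?thesis by (metis Int_left_absorb compact_Int_closed compact_cball)
qed

text \<open>\<open>G / m\<close> lies between \<open>(1 - \<eta>) * t - (1 + \<eta>) * q u\<close>
  and \<open>(1 + \<eta>) * t - (1 - \<eta>) * q u\<close>, so the slices lie between two ellipsoids
  of \<open>q\<close>. The last two claims serve to compare the height with the value of
  \<open>G\<close>.\<close>

lemma sandwich:
  assumes F: "fits r t0" and e: "0 < \<eta>" "\<eta> < 1"
  obtains t1 where "0 < t1" "t1 \<le> t0"
    "\<And>t. 0 \<le> t \<Longrightarrow> t \<le> t1 \<Longrightarrow> {u. q u \<le> (1 - \<eta>) / (1 + \<eta>) * t} \<subseteq> A r t"
    "\<And>t. 0 \<le> t \<Longrightarrow> t \<le> t1 \<Longrightarrow> A r t \<subseteq> {u. q u \<le> (1 + \<eta>) / (1 - \<eta>) * t}"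
    "\<And>t. 0 \<le> t \<Longrightarrow> t \<le> t1 \<Longrightarrow> (1 - \<eta>) * t \<le> G (P 0 t) / m"
    "\<And>u t. 0 \<le> t \<Longrightarrow> t \<le> t1 \<Longrightarrow> u \<in> A r t \<Longrightarrow> G (P u t) / m \<le> (1 + \<eta>) * t"
proof -
  obtain re where re: "re > 0"
    "\<And>u t. norm u \<le> re \<Longrightarrow> 0 \<le> t \<Longrightarrow> t \<le> re \<Longrightarrow> P u t \<in> D \<and> s * (grad g (P u t) \<bullet> \<nu>) > 0 \<and>
       \<bar>G (P u t) / m - t + q u\<bar> \<le> \<eta> * (t + q u)"
    using taylor_P[OF e(1)] by metis
  obtain c where c: "c > 0" "\<And>u. q u \<ge> c * (norm u)\<^sup>2" by (rule q_lower) blast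
  have r: "r > 0" "good r" "0 < t0" "t0 \<le> r" using F by (auto simp: fits_def good_def)
  define r' where "r' = min r re"
  have r': "r' > 0" using r re by (simp add: r'_def)
  \<comment> \<open>At heights up to \<open>t1\<close> the bound \<open>q u \<le> 3 * t\<close>
    forces \<open>u\<close> into the region where both estimates hold.\<close>
  define t1 where "t1 = min (min t0 re) (c * r'\<^sup>2 / 3)"
  have t1: "t1 > 0" "t1 \<le> t0" "t1 \<le> re" "3 * t1 \<le> c * r'\<^sup>2" using r re c r' by (auto simp: t1_def)
  have small: "norm u \<le> r'" if "q u \<le> 3 * t" "t \<le> t1" for u t
  proof -
    have "c * (norm u)\<^sup>2 \<le> c * r'\<^sup>2" using c(2)[of u] that t1(4) by linarith
    then have "(norm u)\<^sup>2 \<le> r'\<^sup>2" using c(1) by simp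
    then show ?thesis using r' by (simp add: power2_le_iff_abs_le)
  qed
  have est: "\<bar>G (P u t) / m - t + q u\<bar> \<le> \<eta> * (t + q u)" if "q u \<le> 3 * t" "0 \<le> t" "t \<le> t1" for u t
    using re(2)[of u t] small[OF that(1,3)] that t1 by (auto simp: r'_def)
  have up: "G (P u t) / m \<le> (1 + \<eta>) * t - (1 - \<eta>) * q u" and lo: "(1 - \<eta>) * t - (1 + \<eta>) * q u \<le> G (P u t) / m"
    if "q u \<le> 3 * t" "0 \<le> t" "t \<le> t1" for u t
    using est[OF that] unfolding abs_le_iff by (simp_all add: algebra_simps)
  have q0: "q 0 = 0" using q_scale[of 0 0] by simp
  show ?thesis
  proof (rule that[OF t1(1,2)])
    fix t assume t: "0 \<le> t" "t \<le> t1"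
    show "{u. q u \<le> (1 - \<eta>) / (1 + \<eta>) * t} \<subseteq> A r t"
    proof
      fix u assume "u \<in> {u. q u \<le> (1 - \<eta>) / (1 + \<eta>) * t}"
      then have qu: "(1 + \<eta>) * q u \<le> (1 - \<eta>) * t" using e by (simp add: field_simps)
      moreover have "q u \<le> (1 + \<eta>) * q u" using e q_nonneg[of u] by (simp add: algebra_simps)
      moreover have "(1 - \<eta>) * t \<le> t" using e t by (simp add: algebra_simps)
      ultimately have q3: "q u \<le> 3 * t" using t by linarith
      have "G (P u t) / m \<ge> 0" using lo[OF q3 t] qu by linarith
      then show "u \<in> A r t" using m_pos small[OF q3 t(2)] by (simp add: A_def r'_def zero_le_divide_iff)
    qed
    have q3: "q u \<le> 3 * t" if "u \<in> A r t" for u using q_bound_A[OF F that] t t1 by simp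
    show "A r t \<subseteq> {u. q u \<le> (1 + \<eta>) / (1 - \<eta>) * t}"
    proof
      fix u assume u: "u \<in> A r t"
      then have "G (P u t) / m \<ge> 0" using m_pos by (simp add: A_def)
      then have "(1 - \<eta>) * q u \<le> (1 + \<eta>) * t" using up[OF q3[OF u] t] by linarith
      then show "u \<in> {u. q u \<le> (1 + \<eta>) / (1 - \<eta>) * t}" using e by (simp add: field_simps)
    qed
    show "(1 - \<eta>) * t \<le> G (P 0 t) / m" using lo[of 0 t] t by (simp add: q0)
    fix u assume u: "u \<in> A r t"
    have "0 \<le> (1 - \<eta>) * q u" using e q_nonneg[of u] by simp
    then show "G (P u t) / m \<le> (1 + \<eta>) * t" using up[OF q3[OF u] t] by linarith
  qed
qed

definition "v h = parallel_point D g k p h"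
text \<open>The signed distance from the hyperplane Psi to the parallel hyperplane Phi.\<close>

definition "ht h = \<nu> \<bullet> (v h - p)"

text \<open>\<open>parallel_point\<close> is an unspecified choice, but the hyperplane through it
  supports the level \<open>k + h\<close>, so it lies no higher than the point of that level on the
  normal axis. From below, the chosen point lies in \<open>C\<close> and hence in a slice
  \<open>A\<close>, where the value of \<open>G\<close> bounds its height.\<close>

lemma parallel_point_height:
  assumes F: "fits r t0" and e: "0 < \<eta>" "\<eta> < 1"
  obtains d where "d > 0"
    "\<And>h. k + h \<in> I \<Longrightarrow> \<bar>h\<bar> < d \<Longrightarrow> 0 < ht h \<and> ht h \<le> t0 \<and>
      \<bar>h\<bar> / ((1 + \<eta>) * m) \<le> ht h \<and> ht h \<le> \<bar>h\<bar> / ((1 - \<eta>) * m)"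
proof -
  obtain t1 where t1: "0 < t1" "t1 \<le> t0"
    and lo: "\<And>t. 0 \<le> t \<Longrightarrow> t \<le> t1 \<Longrightarrow> (1 - \<eta>) * t \<le> G (P 0 t) / m"
    and up: "\<And>u t. 0 \<le> t \<Longrightarrow> t \<le> t1 \<Longrightarrow> u \<in> A r t \<Longrightarrow> G (P u t) / m \<le> (1 + \<eta>) * t"
    using sandwich[OF F e] by metis
  have F1: "fits r t1" by (rule fits_mono[OF F t1])
  have gr: "good r" and r: "r > 0" "t1 \<le> r" using F1 by (auto simp: fits_def good_def)
  define d where "d = min (m * t1 / 4) (m * ((1 - \<eta>) * t1))"
  have "0 < ht h \<and> ht h \<le> t0 \<and> \<bar>h\<bar> / ((1 + \<eta>) * m) \<le> ht h \<and> ht h \<le> \<bar>h\<bar> / ((1 - \<eta>) * m)"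
    if hI: "k + h \<in> I" and hd: "\<bar>h\<bar> < d" for h
  proof -
    have sh: "s * h > 0" and sub: "level D g (k + h) \<subseteq> convex_side D g k" using side[OF hI] by auto
    then have ah: "\<bar>h\<bar> = s * h" "\<bar>h\<bar> > 0" using s by auto
    have nk: "convex_normal D g (k + h) = (\<lambda>y. s *\<^sub>R unit_grad g y)" using sg hI by blast
    have nu: "convex_normal D g k p = \<nu>" using sg[of k] by (simp add: \<nu>_def)
    have lev: "y \<in> level D g (k + h) \<longleftrightarrow> y \<in> D \<and> G y = \<bar>h\<bar>" for y by (simp add: G_level ah)
    obtain u t where "norm u < r" "0 < t" "t < t1" "G (P u t) = \<bar>h\<bar>" "s *\<^sub>R unit_grad g (P u t) = \<nu>"
      using parallel_point_exists[OF F1 ah(2)] hd by (auto simp: d_def)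
    moreover then have "P u t \<in> D" using goodD(1)[OF gr, of u t] r by simp
    ultimately have "\<exists>v. v \<in> level D g (k + h) \<and> convex_normal D g (k + h) v = convex_normal D g k p"
      unfolding nk nu lev by blast
    then have vv: "v h \<in> level D g (k + h)" "s *\<^sub>R unit_grad g (v h) = \<nu>"
      using someI_ex[of "\<lambda>v. v \<in> level D g (k + h) \<and> convex_normal D g (k + h) v = convex_normal D g k p"]
      unfolding v_def parallel_point_def nk nu by auto
    have "convex_normal D g k p \<bullet> (v h - p) > 0" using vv(1) sub p by (auto simp: convex_side_def)
    then have pos: "ht h > 0" by (simp add: nu ht_def)
    have vC: "v h \<in> C" using vv(1) sub convex_side_C by blast
    have cont: "continuous_on {0..t1} (\<lambda>t. G (P 0 t))"
      by (intro continuous_GP continuous_intros) (use goodD(1)[OF gr, of 0] r in auto)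
    have "\<exists>\<tau>\<ge>0. \<tau> \<le> t1 \<and> G (P 0 \<tau>) = \<bar>h\<bar>"
    proof (rule IVT'[OF _ _ _ cont])
      show "G (P 0 0) \<le> \<bar>h\<bar>" by (simp add: P_def linear_0[OF T_lin] G_p)
      have "m * ((1 - \<eta>) * t1) \<le> m * (G (P 0 t1) / m)" using lo[of t1] t1 m_pos by (intro mult_left_mono) auto
      then show "\<bar>h\<bar> \<le> G (P 0 t1)" using hd m_pos by (simp add: d_def)
    qed (use t1 in auto)
    then obtain \<tau> where \<tau>: "0 \<le> \<tau>" "\<tau> \<le> t1" "G (P 0 \<tau>) = \<bar>h\<bar>" by blast
    have "P 0 \<tau> \<in> D" using goodD(1)[OF gr, of 0 \<tau>] r \<tau> by simp
    then have "P 0 \<tau> \<in> level D g (k + h)" using \<tau> by (simp add: lev)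
    then have "s * (grad g (v h) \<bullet> (P 0 \<tau> - v h)) \<ge> 0" using sup[OF _ vv(1)] hI by blast
    moreover have gv: "grad g (v h) \<noteq> 0" using nz[OF _ vv(1)] hI by blast
    moreover have "s * (grad g (v h) \<bullet> (P 0 \<tau> - v h)) = norm (grad g (v h)) * (\<nu> \<bullet> (P 0 \<tau> - v h))"
      unfolding vv(2)[symmetric] using gv by (simp add: unit_grad_inner)
    ultimately have "\<nu> \<bullet> (P 0 \<tau> - v h) \<ge> 0" by (simp add: zero_le_mult_iff)
    moreover have "\<nu> \<bullet> (P 0 \<tau> - v h) = \<nu> \<bullet> (P 0 \<tau> - p) - \<nu> \<bullet> (v h - p)" by (simp add: inner_diff_right)
    ultimately have le: "ht h \<le> \<tau>" by (simp add: nu_P ht_def)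
    have "(1 - \<eta>) * \<tau> * m \<le> \<bar>h\<bar>" using lo[OF \<tau>(1,2)] \<tau>(3) m_pos by (simp add: pos_le_divide_eq)
    then have "\<tau> \<le> \<bar>h\<bar> / ((1 - \<eta>) * m)" using e m_pos by (simp add: pos_le_divide_eq mult_ac)
    moreover obtain u where u: "v h = P u (ht h)" using P_surj[of "v h"] unfolding ht_def by metis
    have ht1: "0 \<le> ht h" "ht h \<le> t1" using pos le \<tau> by auto
    have "u \<in> A r (ht h)" using C_local[OF F1 _ ht1, of u] vC u by metis
    from up[OF ht1 this] have "\<bar>h\<bar> / m \<le> (1 + \<eta>) * ht h" using vv(1) u lev by metis
    then have "\<bar>h\<bar> \<le> ht h * ((1 + \<eta>) * m)" using m_pos by (simp add: pos_divide_le_eq mult_ac)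
    then have "\<bar>h\<bar> / ((1 + \<eta>) * m) \<le> ht h" using e m_pos by (subst pos_divide_le_eq) simp_all
    ultimately show ?thesis using pos le \<tau> t1 by auto
  qed
  moreover have "d > 0" using m_pos t1 e by (simp add: d_def)
  ultimately show ?thesis using that by blast
qed

text \<open>The measuring coordinates are centred at the parallel point instead of on the normal
  axis; translation invariance removes the difference.\<close>

lemma section_area_eq:
  assumes F: "fits r t0" and t: "0 \<le> ht h" "ht h \<le> t0"
  shows "section_area D g k p h = measure lebesgue (A r (ht h))"
proof -
  have nu: "convex_normal D g k p = \<nu>" using sg[of k] by (simp add: \<nu>_def)
  obtain u0 where u0: "v h = P u0 (ht h)" using P_surj[of "v h"] unfolding ht_def by metis
  have "{y. \<nu> \<bullet> (y - v h) = 0} = {y. \<nu> \<bullet> (y - p) = ht h}" by (auto simp: ht_def inner_diff_right)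
  moreover have "v h + T u = P (u0 + u) (ht h)" for u
    by (simp add: u0 P_def linear_add[OF T_lin])
  ultimately have "section_area D g k p h
      = measure lebesgue {u. P (u0 + u) (ht h) \<in> convex hull (level D g k \<inter> {y. \<nu> \<bullet> (y - p) = ht h})}"
    by (simp add: section_area_def nu v_def[symmetric] T_def[symmetric] Let_def)
  also have "\<dots> = measure lebesgue {u. u0 + u \<in> A r (ht h)}" by (simp add: hull_section[OF F t])
  finally show ?thesis by (simp add: measure_translation_vimage)
qed

lemma P_image_measure:
  assumes "compact X"
  shows "measure lebesgue ((\<lambda>(u, t). P u t) ` X) = measure lebesgue X"
proof -
  define \<Theta> where "\<Theta> = (\<lambda>(u, t). T u + t *\<^sub>R \<nu>)"
  have l: "linear \<Theta>" unfolding \<Theta>_def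
    by (rule linearI) (auto simp: linear_add[OF T_lin] linear_scale[OF T_lin] algebra_simps)
  have n: "norm (\<Theta> x) = norm x" for x
  proof -
    have "\<Theta> x \<bullet> \<Theta> x = x \<bullet> x"
      by (cases x) (simp add: \<Theta>_def inner_add_left inner_add_right T_nu nu_T T_inner nu_nu)
    then show ?thesis by (simp add: norm_eq_sqrt_inner)
  qed
  have "(\<lambda>(u, t). P u t) ` X = (+) p ` (\<Theta> ` X)"
    unfolding image_image by (rule image_cong) (auto simp: \<Theta>_def P_def add.assoc)
  then show ?thesis by (simp add: measure_translation measure_isometry_image[OF l n assms])
qed

definition "cap_set r t = {(u, \<tau>). 0 \<le> \<tau> \<and> \<tau> \<le> t \<and> u \<in> A r \<tau>}"

lemma compact_cap_set:
  assumes F: "fits r t0" and t: "0 \<le> t" "t \<le> t0"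
  shows "compact (cap_set r t)"
proof -
  define X where "X = cball (0::real^'n) r \<times> {0..t}"
  have c: "compact X" unfolding X_def by (intro compact_Times) auto
  have "cap_set r t = X \<inter> (\<lambda>x. G (P (fst x) (snd x))) -` {0..}"
    by (auto simp: cap_set_def A_def X_def)
  moreover have "closed (X \<inter> (\<lambda>x. G (P (fst x) (snd x))) -` {0..})"
    by (intro continuous_closed_preimage continuous_GP continuous_on_fst continuous_on_snd continuous_on_id)
      (use F t goodD(1)[of r] c in \<open>auto simp: fits_def X_def compact_imp_closed\<close>)
  ultimately show ?thesis using compact_Int_closed[OF c, of "cap_set r t"] by simp
qed

lemma cap_volume_eq:
  assumes F: "fits r t0" and t: "0 \<le> ht h" "ht h \<le> t0"
  shows "cap_volume D g k p h = measure lebesgue (cap_set r (ht h))"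
proof -
  have nu: "convex_normal D g k p = \<nu>" using sg[of k] by (simp add: \<nu>_def)
  have "\<nu> \<bullet> (y - v h) \<le> 0 \<longleftrightarrow> \<nu> \<bullet> (y - p) \<le> ht h" for y by (auto simp: ht_def inner_diff_right)
  then have "cap_volume D g k p h = measure lebesgue
      (convex hull (level D g k \<inter> {y. \<nu> \<bullet> (y - p) \<ge> 0 \<and> \<nu> \<bullet> (y - p) \<le> ht h}))"
    by (simp add: cap_volume_def nu v_def[symmetric] Let_def)
  then show ?thesis
    unfolding hull_cap[OF F t] cap_set_def[symmetric]
    by (simp add: P_image_measure compact_cap_set[OF F t])
qed

text \<open>The slice at height \<tau> is an ellipsoid whose measure is proportional to \<tau> to
  the power \<open>CARD('n) / 2\<close>; integration raises the exponent by one.\<close>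

lemma paraboloid_measure:
  assumes c: "c \<ge> 0" and t: "t \<ge> 0"
  shows "measure lebesgue {(u, \<tau>). 0 \<le> \<tau> \<and> \<tau> \<le> t \<and> q u \<le> c * \<tau>}
      = \<omega> / sqrt K * sqrt (2 * c) ^ CARD('n) * (t powr (real CARD('n) / 2 + 1) / (real CARD('n) / 2 + 1))"
    "compact {(u, \<tau>). 0 \<le> \<tau> \<and> \<tau> \<le> t \<and> q u \<le> c * \<tau>}"
proof -
  let ?X = "{(u, \<tau>). 0 \<le> \<tau> \<and> \<tau> \<le> t \<and> q u \<le> c * \<tau>}"
  have eq: "?X = ({u. q u \<le> c * t} \<times> {0..t}) \<inter> (\<lambda>x. q (fst x) - c * snd x) -` {..0}"
    using mult_left_mono[OF _ c, of _ t] by (auto intro: order_trans)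
  have "compact ({u. q u \<le> c * t} \<times> {0..t})" using c t by (intro compact_Times measure_q) auto
  moreover have "closed ((\<lambda>x. q (fst x) - c * snd x) -` {..0})"
    by (intro closed_vimage continuous_intros continuous_on_compose2[OF continuous_q[of UNIV]]) auto
  ultimately show comp: "compact ?X" unfolding eq by (rule compact_Int_closed)
  let ?a = "real CARD('n) / 2"
  let ?k = "\<omega> / sqrt K * sqrt (2 * c) ^ CARD('n)"
  have sl: "measure lebesgue {u. (u, \<tau>) \<in> ?X} = (if \<tau> \<in> {0..t} then ?k * \<tau> powr ?a else 0)" for \<tau>
  proof (cases "\<tau> \<in> {0..t}")
    case True
    then have "measure lebesgue {u. (u, \<tau>) \<in> ?X} = \<omega> / sqrt K * sqrt (2 * (c * \<tau>)) ^ CARD('n)"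
      using measure_q(2)[of "c * \<tau>"] c by simp
    also have "sqrt (2 * (c * \<tau>)) ^ CARD('n) = sqrt (2 * c) ^ CARD('n) * sqrt \<tau> ^ CARD('n)"
      by (simp add: real_sqrt_mult power_mult_distrib mult_ac)
    also have "sqrt \<tau> ^ CARD('n) = \<tau> powr ?a"
    proof (cases "\<tau> = 0")
      case False
      then have "sqrt \<tau> ^ CARD('n) = (\<tau> powr (1/2)) powr real CARD('n)"
        using True by (simp add: powr_half_sqrt powr_realpow)
      then show ?thesis by (simp add: powr_powr)
    qed (use zero_less_card_finite in simp)
    finally show ?thesis unfolding if_P[OF True] mult.assoc .
  next
    case False
    then have "{u. (u, \<tau>) \<in> ?X} = {}" by auto
    then show ?thesis unfolding if_not_P[OF False] by (simp only: measure_empty)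
  qed
  have "((\<lambda>\<tau>. \<tau> powr ?a) has_integral (t powr (?a + 1) / (?a + 1))) {0..t}"
    using t by (intro has_integral_powr_from_0) auto
  then have "((\<lambda>\<tau>. ?k * \<tau> powr ?a) has_integral ?k * (t powr (?a + 1) / (?a + 1))) {0..t}"
    by (rule has_integral_mult_right)
  then have "((\<lambda>\<tau>. if \<tau> \<in> {0..t} then ?k * \<tau> powr ?a else 0) has_integral ?k * (t powr (?a + 1) / (?a + 1))) UNIV"
    by (simp only: has_integral_restrict_UNIV)
  then show "measure lebesgue ?X = ?k * (t powr (?a + 1) / (?a + 1))"
    by (rule measure_slices[where f = "\<lambda>\<tau>. if \<tau> \<in> {0..t} then ?k * \<tau> powr ?a else 0", OF comp sl])
qed

end

text \<open>For each fixed \<eta> the bounds need to hold only eventually, so how far along the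
  filter one has to go may depend on \<eta>.\<close>

lemma tendsto_sandwich_param:
  fixes f :: "'a \<Rightarrow> real"
  assumes b: "\<And>\<eta>. 0 < \<eta> \<Longrightarrow> \<eta> < 1 \<Longrightarrow> \<forall>\<^sub>F h in F. lo \<eta> \<le> f h \<and> f h \<le> up \<eta>"
    and lo: "(lo \<longlongrightarrow> l) (at_right 0)" and up: "(up \<longlongrightarrow> l) (at_right (0::real))"
  shows "(f \<longlongrightarrow> l) F"
proof (rule order_tendstoI)
  have e01: "\<forall>\<^sub>F \<eta> in at_right (0::real). 0 < \<eta> \<and> \<eta> < 1"
    using eventually_at_right_real[of 0 1] by simp
  fix a assume "a < l"
  then have "\<forall>\<^sub>F \<eta> in at_right 0. a < lo \<eta>" by (rule order_tendstoD[OF lo])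
  with e01 have "\<forall>\<^sub>F \<eta> in at_right (0::real). 0 < \<eta> \<and> \<eta> < 1 \<and> a < lo \<eta>" by eventually_elim auto
  then obtain \<eta> :: real where "0 < \<eta>" "\<eta> < 1" "a < lo \<eta>"
    using eventually_happens[of _ "at_right (0::real)"] by auto
  then show "\<forall>\<^sub>F h in F. a < f h" using b[of \<eta>] by (auto elim: eventually_mono)
next
  have e01: "\<forall>\<^sub>F \<eta> in at_right (0::real). 0 < \<eta> \<and> \<eta> < 1"
    using eventually_at_right_real[of 0 1] by simp
  fix a assume "l < a"
  then have "\<forall>\<^sub>F \<eta> in at_right 0. up \<eta> < a" by (rule order_tendstoD[OF up])
  with e01 have "\<forall>\<^sub>F \<eta> in at_right (0::real). 0 < \<eta> \<and> \<eta> < 1 \<and> up \<eta> < a" by eventually_elim auto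
  then obtain \<eta> :: real where "0 < \<eta>" "\<eta> < 1" "up \<eta> < a"
    using eventually_happens[of _ "at_right (0::real)"] by auto
  then show "\<forall>\<^sub>F h in F. f h < a" using b[of \<eta>] by (auto elim!: eventually_mono)
qed

section \<open>Asymptotics of section areas and cap volumes\<close>

context cap_point
begin

abbreviation "hfilter \<equiv> at 0 within {h. k + h \<in> I}"

lemma near_h:
  assumes "d > 0" "\<And>h. k + h \<in> I \<Longrightarrow> \<bar>h\<bar> < d \<Longrightarrow> h \<noteq> 0 \<Longrightarrow> Q h"
  shows "\<forall>\<^sub>F h in hfilter. Q h"
  unfolding eventually_at using assms by (intro exI[of _ d]) auto

lemma height_sandwich:
  assumes e: "0 < \<eta>" "\<eta> < 1"
  obtains r t1 d where "fits r t1" "d > 0"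
    "\<And>t. 0 \<le> t \<Longrightarrow> t \<le> t1 \<Longrightarrow> {u. q u \<le> (1 - \<eta>) / (1 + \<eta>) * t} \<subseteq> A r t"
    "\<And>t. 0 \<le> t \<Longrightarrow> t \<le> t1 \<Longrightarrow> A r t \<subseteq> {u. q u \<le> (1 + \<eta>) / (1 - \<eta>) * t}"
    "\<And>h. k + h \<in> I \<Longrightarrow> \<bar>h\<bar> < d \<Longrightarrow> 0 < ht h \<and> ht h \<le> t1 \<and>
      \<bar>h\<bar> / ((1 + \<eta>) * m) \<le> ht h \<and> ht h \<le> \<bar>h\<bar> / ((1 - \<eta>) * m)"
proof -
  obtain r where "good r" by (rule exists_good)
  then obtain t0 where F0: "fits r t0" by (rule exists_fits)
  obtain t1 where t1: "0 < t1" "t1 \<le> t0"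
    and s: "\<And>t. 0 \<le> t \<Longrightarrow> t \<le> t1 \<Longrightarrow> {u. q u \<le> (1 - \<eta>) / (1 + \<eta>) * t} \<subseteq> A r t"
    "\<And>t. 0 \<le> t \<Longrightarrow> t \<le> t1 \<Longrightarrow> A r t \<subseteq> {u. q u \<le> (1 + \<eta>) / (1 - \<eta>) * t}"
    using sandwich[OF F0 e] by metis
  have F: "fits r t1" by (rule fits_mono[OF F0 t1])
  obtain d where "d > 0" "\<And>h. k + h \<in> I \<Longrightarrow> \<bar>h\<bar> < d \<Longrightarrow> 0 < ht h \<and> ht h \<le> t1 \<and>
      \<bar>h\<bar> / ((1 + \<eta>) * m) \<le> ht h \<and> ht h \<le> \<bar>h\<bar> / ((1 - \<eta>) * m)"
    using parallel_point_height[OF F e] by metis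
  then show ?thesis using that[OF F _ s] by blast
qed

lemma omega_pos: "\<omega> > 0" by (simp add: \<omega>_def)

text \<open>The slice at height \<open>t\<close> is close to the ellipsoid
  \<open>q u \<le> t\<close>, and \<open>t\<close> behaves like \<open>\<bar>h\<bar> / m\<close>.
  The outer and inner bounds come from \<open>height_sandwich\<close> and merge as \<eta> tends to
  0.\<close>

lemma section_area_tendsto:
  "((\<lambda>h. section_area D g k p h / sqrt (2 * \<bar>h\<bar>) ^ CARD('n)) \<longlongrightarrow>
     \<omega> / sqrt K * sqrt (1 / m) ^ CARD('n)) hfilter"
proof (rule tendsto_sandwich_param)
  let ?k = "\<omega> / sqrt K"
  have k0: "?k \<ge> 0" using omega_pos K_pos by simp
  show "\<forall>\<^sub>F h in hfilter. ?k * sqrt ((1 - \<eta>) / (1 + \<eta>) / ((1 + \<eta>) * m)) ^ CARD('n)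
        \<le> section_area D g k p h / sqrt (2 * \<bar>h\<bar>) ^ CARD('n) \<and>
      section_area D g k p h / sqrt (2 * \<bar>h\<bar>) ^ CARD('n)
        \<le> ?k * sqrt ((1 + \<eta>) / (1 - \<eta>) / ((1 - \<eta>) * m)) ^ CARD('n)"
    if e: "0 < \<eta>" "\<eta> < 1" for \<eta>
  proof -
    obtain r t1 d where F: "fits r t1" "d > 0"
      and s: "\<And>t. 0 \<le> t \<Longrightarrow> t \<le> t1 \<Longrightarrow> {u. q u \<le> (1 - \<eta>) / (1 + \<eta>) * t} \<subseteq> A r t"
      "\<And>t. 0 \<le> t \<Longrightarrow> t \<le> t1 \<Longrightarrow> A r t \<subseteq> {u. q u \<le> (1 + \<eta>) / (1 - \<eta>) * t}"
      and ht: "\<And>h. k + h \<in> I \<Longrightarrow> \<bar>h\<bar> < d \<Longrightarrow> 0 < ht h \<and> ht h \<le> t1 \<and>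
        \<bar>h\<bar> / ((1 + \<eta>) * m) \<le> ht h \<and> ht h \<le> \<bar>h\<bar> / ((1 - \<eta>) * m)"
      using height_sandwich[OF e] by metis
    show ?thesis
    proof (rule near_h[OF F(2)])
      fix h assume h: "k + h \<in> I" "\<bar>h\<bar> < d" "h \<noteq> 0"
      define \<rho> \<rho>' where "\<rho> = (1 - \<eta>) / (1 + \<eta>)" and "\<rho>' = (1 + \<eta>) / (1 - \<eta>)"
      have rho: "\<rho> \<ge> 0" "\<rho>' \<ge> 0" using e by (auto simp: \<rho>_def \<rho>'_def)
      let ?t = "ht h"
      have t: "0 \<le> ?t" "?t \<le> t1" "\<bar>h\<bar> / ((1 + \<eta>) * m) \<le> ?t" "?t \<le> \<bar>h\<bar> / ((1 - \<eta>) * m)"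
        using ht[OF h(1,2)] by auto
      have pos: "sqrt (2 * \<bar>h\<bar>) ^ CARD('n) > 0" using h by simp
      have eq: "section_area D g k p h = measure lebesgue (A r ?t)" by (rule section_area_eq[OF F(1) t(1,2)])
      note cA = compact_A[OF F(1) t(1,2)]
      have "?k * sqrt (\<rho> / ((1 + \<eta>) * m)) ^ CARD('n) * sqrt (2 * \<bar>h\<bar>) ^ CARD('n)
          = ?k * sqrt (2 * (\<rho> * (\<bar>h\<bar> / ((1 + \<eta>) * m)))) ^ CARD('n)"
        by (simp only: mult.assoc power_mult_distrib[symmetric] real_sqrt_mult[symmetric]) (simp add: mult_ac)
      also have "\<dots> \<le> ?k * sqrt (2 * (\<rho> * ?t)) ^ CARD('n)"
        using k0 rho t e m_pos by (intro mult_left_mono power_mono real_sqrt_le_mono) auto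
      also have "\<dots> = measure lebesgue {u. q u \<le> \<rho> * ?t}" using rho t by (simp add: measure_q(2))
      also have "\<dots> \<le> measure lebesgue (A r ?t)"
        using s(1)[OF t(1,2)] cA rho t measure_q(1)[of "\<rho> * ?t"]
        by (intro measure_mono_fmeasurable) (auto simp: \<rho>_def[symmetric] lmeasurable_compact fmeasurableD)
      finally have 1: "?k * sqrt (\<rho> / ((1 + \<eta>) * m)) ^ CARD('n) \<le> section_area D g k p h / sqrt (2 * \<bar>h\<bar>) ^ CARD('n)"
        unfolding eq by (subst pos_le_divide_eq[OF pos])
      have "measure lebesgue (A r ?t) \<le> measure lebesgue {u. q u \<le> \<rho>' * ?t}"
        using s(2)[OF t(1,2)] cA rho t measure_q(1)[of "\<rho>' * ?t"]
        by (intro measure_mono_fmeasurable) (auto simp: \<rho>'_def[symmetric] lmeasurable_compact fmeasurableD)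
      also have "\<dots> = ?k * sqrt (2 * (\<rho>' * ?t)) ^ CARD('n)" using rho t by (simp add: measure_q(2))
      also have "\<dots> \<le> ?k * sqrt (2 * (\<rho>' * (\<bar>h\<bar> / ((1 - \<eta>) * m)))) ^ CARD('n)"
        using k0 rho t e m_pos by (intro mult_left_mono power_mono real_sqrt_le_mono) auto
      also have "\<dots> = ?k * sqrt (\<rho>' / ((1 - \<eta>) * m)) ^ CARD('n) * sqrt (2 * \<bar>h\<bar>) ^ CARD('n)"
        by (simp only: mult.assoc power_mult_distrib[symmetric] real_sqrt_mult[symmetric]) (simp add: mult_ac)
      finally have 2: "section_area D g k p h / sqrt (2 * \<bar>h\<bar>) ^ CARD('n) \<le> ?k * sqrt (\<rho>' / ((1 - \<eta>) * m)) ^ CARD('n)"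
        unfolding eq by (subst pos_divide_le_eq[OF pos])
      show "?k * sqrt ((1 - \<eta>) / (1 + \<eta>) / ((1 + \<eta>) * m)) ^ CARD('n)
        \<le> section_area D g k p h / sqrt (2 * \<bar>h\<bar>) ^ CARD('n) \<and>
      section_area D g k p h / sqrt (2 * \<bar>h\<bar>) ^ CARD('n)
        \<le> ?k * sqrt ((1 + \<eta>) / (1 - \<eta>) / ((1 - \<eta>) * m)) ^ CARD('n)"
        using 1 2 unfolding \<rho>_def \<rho>'_def by blast
    qed
  qed
  have "((\<lambda>\<eta>. ?k * sqrt ((1 - \<eta>) / (1 + \<eta>) / ((1 + \<eta>) * m)) ^ CARD('n)) \<longlongrightarrow>
      ?k * sqrt ((1 - 0) / (1 + 0) / ((1 + 0) * m)) ^ CARD('n)) (at_right 0)"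
    by (intro tendsto_intros) (use m_pos in auto)
  then show "((\<lambda>\<eta>. ?k * sqrt ((1 - \<eta>) / (1 + \<eta>) / ((1 + \<eta>) * m)) ^ CARD('n)) \<longlongrightarrow>
      ?k * sqrt (1 / m) ^ CARD('n)) (at_right 0)" by simp
  have "((\<lambda>\<eta>. ?k * sqrt ((1 + \<eta>) / (1 - \<eta>) / ((1 - \<eta>) * m)) ^ CARD('n)) \<longlongrightarrow>
      ?k * sqrt ((1 + 0) / (1 - 0) / ((1 - 0) * m)) ^ CARD('n)) (at_right 0)"
    by (intro tendsto_intros) (use m_pos in auto)
  then show "((\<lambda>\<eta>. ?k * sqrt ((1 + \<eta>) / (1 - \<eta>) / ((1 - \<eta>) * m)) ^ CARD('n)) \<longlongrightarrow>
      ?k * sqrt (1 / m) ^ CARD('n)) (at_right 0)" by simp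
qed

lemma cap_volume_tendsto:
  fixes N defines "N \<equiv> real CARD('n) / 2 + 1"
  shows "((\<lambda>h. cap_volume D g k p h / \<bar>h\<bar> powr N) \<longlongrightarrow>
     \<omega> / sqrt K * sqrt 2 ^ CARD('n) * ((1 / m) powr N / N)) hfilter"
proof (rule tendsto_sandwich_param)
  let ?k = "\<omega> / sqrt K"
  have k0: "?k \<ge> 0" using omega_pos K_pos by simp
  have N: "N > 0" unfolding N_def by (simp add: add_nonneg_pos)
  show "\<forall>\<^sub>F h in hfilter. ?k * sqrt (2 * ((1 - \<eta>) / (1 + \<eta>))) ^ CARD('n) * ((1 / ((1 + \<eta>) * m)) powr N / N)
        \<le> cap_volume D g k p h / \<bar>h\<bar> powr N \<and>
      cap_volume D g k p h / \<bar>h\<bar> powr N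
        \<le> ?k * sqrt (2 * ((1 + \<eta>) / (1 - \<eta>))) ^ CARD('n) * ((1 / ((1 - \<eta>) * m)) powr N / N)"
    if e: "0 < \<eta>" "\<eta> < 1" for \<eta>
  proof -
    obtain r t1 d where F: "fits r t1" "d > 0"
      and s: "\<And>t. 0 \<le> t \<Longrightarrow> t \<le> t1 \<Longrightarrow> {u. q u \<le> (1 - \<eta>) / (1 + \<eta>) * t} \<subseteq> A r t"
      "\<And>t. 0 \<le> t \<Longrightarrow> t \<le> t1 \<Longrightarrow> A r t \<subseteq> {u. q u \<le> (1 + \<eta>) / (1 - \<eta>) * t}"
      and ht: "\<And>h. k + h \<in> I \<Longrightarrow> \<bar>h\<bar> < d \<Longrightarrow> 0 < ht h \<and> ht h \<le> t1 \<and>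
        \<bar>h\<bar> / ((1 + \<eta>) * m) \<le> ht h \<and> ht h \<le> \<bar>h\<bar> / ((1 - \<eta>) * m)"
      using height_sandwich[OF e] by metis
    show ?thesis
    proof (rule near_h[OF F(2)])
      fix h assume h: "k + h \<in> I" "\<bar>h\<bar> < d" "h \<noteq> 0"
      define \<rho> \<rho>' where "\<rho> = (1 - \<eta>) / (1 + \<eta>)" and "\<rho>' = (1 + \<eta>) / (1 - \<eta>)"
      have rho: "\<rho> \<ge> 0" "\<rho>' \<ge> 0" using e by (auto simp: \<rho>_def \<rho>'_def)
      let ?t = "ht h"
      let ?Q = "\<lambda>c. {(u, \<tau>). 0 \<le> \<tau> \<and> \<tau> \<le> ?t \<and> q u \<le> c * \<tau>}"
      have t: "0 \<le> ?t" "?t \<le> t1" "\<bar>h\<bar> / ((1 + \<eta>) * m) \<le> ?t" "?t \<le> \<bar>h\<bar> / ((1 - \<eta>) * m)"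
        using ht[OF h(1,2)] by auto
      have pos: "\<bar>h\<bar> powr N > 0" using h by simp
      have eq: "cap_volume D g k p h = measure lebesgue (cap_set r ?t)" by (rule cap_volume_eq[OF F(1) t(1,2)])
      note cA = compact_cap_set[OF F(1) t(1,2)]
      have pw: "(1 / a) powr N * \<bar>h\<bar> powr N = (\<bar>h\<bar> / a) powr N" if "a > 0" for a
        using that by (simp add: powr_mult[symmetric])
      have a1: "(1 + \<eta>) * m > 0" "(1 - \<eta>) * m > 0" using e m_pos by auto
      have "?k * sqrt (2 * \<rho>) ^ CARD('n) * ((1 / ((1 + \<eta>) * m)) powr N / N) * \<bar>h\<bar> powr N
          = ?k * sqrt (2 * \<rho>) ^ CARD('n) * ((\<bar>h\<bar> / ((1 + \<eta>) * m)) powr N / N)"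
        unfolding pw[OF a1(1), symmetric] by simp
      also have "\<dots> \<le> ?k * sqrt (2 * \<rho>) ^ CARD('n) * (?t powr N / N)"
        using k0 rho t a1 N omega_pos K_pos by (intro mult_left_mono divide_right_mono powr_mono2) auto
      also have "\<dots> = measure lebesgue (?Q \<rho>)" using rho t by (simp only: paraboloid_measure(1) N_def)
      also have "\<dots> \<le> measure lebesgue (cap_set r ?t)"
      proof (intro measure_mono_fmeasurable)
        show "?Q \<rho> \<subseteq> cap_set r ?t" using s(1) t by (fastforce simp: cap_set_def \<rho>_def)
      qed (use cA paraboloid_measure(2)[OF rho(1) t(1)] in \<open>auto simp: lmeasurable_compact fmeasurableD\<close>)
      finally have 1: "?k * sqrt (2 * \<rho>) ^ CARD('n) * ((1 / ((1 + \<eta>) * m)) powr N / N) \<le> cap_volume D g k p h / \<bar>h\<bar> powr N"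
        unfolding eq by (subst pos_le_divide_eq[OF pos])
      have "measure lebesgue (cap_set r ?t) \<le> measure lebesgue (?Q \<rho>')"
      proof (intro measure_mono_fmeasurable)
        show "cap_set r ?t \<subseteq> ?Q \<rho>'" using s(2) t by (fastforce simp: cap_set_def \<rho>'_def)
      qed (use cA paraboloid_measure(2)[OF rho(2) t(1)] in \<open>auto simp: lmeasurable_compact fmeasurableD\<close>)
      also have "\<dots> = ?k * sqrt (2 * \<rho>') ^ CARD('n) * (?t powr N / N)"
        using rho t by (simp only: paraboloid_measure(1) N_def)
      also have "\<dots> \<le> ?k * sqrt (2 * \<rho>') ^ CARD('n) * ((\<bar>h\<bar> / ((1 - \<eta>) * m)) powr N / N)"
        using k0 rho t a1 N omega_pos K_pos by (intro mult_left_mono divide_right_mono powr_mono2) auto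
      also have "\<dots> = ?k * sqrt (2 * \<rho>') ^ CARD('n) * ((1 / ((1 - \<eta>) * m)) powr N / N) * \<bar>h\<bar> powr N"
        unfolding pw[OF a1(2), symmetric] by simp
      finally have 2: "cap_volume D g k p h / \<bar>h\<bar> powr N \<le> ?k * sqrt (2 * \<rho>') ^ CARD('n) * ((1 / ((1 - \<eta>) * m)) powr N / N)"
        unfolding eq by (subst pos_divide_le_eq[OF pos])
      show "?k * sqrt (2 * ((1 - \<eta>) / (1 + \<eta>))) ^ CARD('n) * ((1 / ((1 + \<eta>) * m)) powr N / N)
        \<le> cap_volume D g k p h / \<bar>h\<bar> powr N \<and>
      cap_volume D g k p h / \<bar>h\<bar> powr N
        \<le> ?k * sqrt (2 * ((1 + \<eta>) / (1 - \<eta>))) ^ CARD('n) * ((1 / ((1 - \<eta>) * m)) powr N / N)"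
        using 1 2 unfolding \<rho>_def \<rho>'_def by blast
    qed
  qed
  have "((\<lambda>\<eta>. ?k * sqrt (2 * ((1 - \<eta>) / (1 + \<eta>))) ^ CARD('n) * ((1 / ((1 + \<eta>) * m)) powr N / N)) \<longlongrightarrow>
      ?k * sqrt (2 * ((1 - 0) / (1 + 0))) ^ CARD('n) * ((1 / ((1 + 0) * m)) powr N / N)) (at_right 0)"
    by (intro tendsto_intros) (use m_pos N in auto)
  then show "((\<lambda>\<eta>. ?k * sqrt (2 * ((1 - \<eta>) / (1 + \<eta>))) ^ CARD('n) * ((1 / ((1 + \<eta>) * m)) powr N / N)) \<longlongrightarrow>
      ?k * sqrt 2 ^ CARD('n) * ((1 / m) powr N / N)) (at_right 0)" by simp
  have "((\<lambda>\<eta>. ?k * sqrt (2 * ((1 + \<eta>) / (1 - \<eta>))) ^ CARD('n) * ((1 / ((1 - \<eta>) * m)) powr N / N)) \<longlongrightarrow>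
      ?k * sqrt (2 * ((1 + 0) / (1 - 0))) ^ CARD('n) * ((1 / ((1 - 0) * m)) powr N / N)) (at_right 0)"
    by (intro tendsto_intros) (use m_pos N in auto)
  then show "((\<lambda>\<eta>. ?k * sqrt (2 * ((1 + \<eta>) / (1 - \<eta>))) ^ CARD('n) * ((1 / ((1 - \<eta>) * m)) powr N / N)) \<longlongrightarrow>
      ?k * sqrt 2 ^ CARD('n) * ((1 / m) powr N / N)) (at_right 0)" by simp
qed

text \<open>Squaring removes the roots. Both limits, the first after division by \<open>m\<close>,
  thus determine the product of the curvature and \<open>m ^ (CARD('n) + 2)\<close>, as the right
  sides do not depend on \<open>p\<close>.\<close>

lemma curvature_from_limits:
  shows "(\<omega> / sqrt K * sqrt (1 / m) ^ CARD('n) / m)\<^sup>2 * (K * m ^ (CARD('n) + 2)) = \<omega>\<^sup>2"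
    and "(\<omega> / sqrt K * sqrt 2 ^ CARD('n) * ((1 / m) powr (real CARD('n) / 2 + 1) / (real CARD('n) / 2 + 1)))\<^sup>2
      * (K * m ^ (CARD('n) + 2)) = (\<omega> * sqrt 2 ^ CARD('n) / (real CARD('n) / 2 + 1))\<^sup>2"
proof -
  have K0: "K > 0" "m > 0" by (rule K_pos, rule m_pos)
  have "(sqrt (1 / m) ^ CARD('n))\<^sup>2 = (1 / m) ^ CARD('n)"
    using K0 by (simp flip: power_mult power2_eq_square add: mult.commute[of _ 2] power_mult)
  then show "(\<omega> / sqrt K * sqrt (1 / m) ^ CARD('n) / m)\<^sup>2 * (K * m ^ (CARD('n) + 2)) = \<omega>\<^sup>2"
    using K0 by (simp add: power_mult_distrib power_divide power_add) (simp add: power2_eq_square)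
  let ?N = "real CARD('n) / 2 + 1"
  have "((1 / m) powr ?N)\<^sup>2 = (1 / m) powr (real (CARD('n) + 2))"
    by (simp add: power2_eq_square powr_add[symmetric] add.commute)
  also have "\<dots> = (1 / m) ^ (CARD('n) + 2)" using K0 by (subst powr_realpow) auto
  finally have *: "((1 / m) powr ?N)\<^sup>2 = (1 / m) ^ (CARD('n) + 2)" .
  have "(\<omega> / sqrt K * sqrt 2 ^ CARD('n) * ((1 / m) powr ?N / ?N))\<^sup>2 * (K * m ^ (CARD('n) + 2))
      = (\<omega> * sqrt 2 ^ CARD('n) / ?N)\<^sup>2 * (((1 / sqrt K)\<^sup>2 * K) * (((1 / m) powr ?N)\<^sup>2 * m ^ (CARD('n) + 2)))"
    by (simp only: power_mult_distrib divide_inverse mult_1_left mult_ac)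
  also have "(1 / sqrt K)\<^sup>2 * K = 1" using K0 by (simp add: power_divide)
  also have "((1 / m) powr ?N)\<^sup>2 * m ^ (CARD('n) + 2) = 1" unfolding * using K0 by (simp flip: power_mult_distrib)
  finally show "(\<omega> / sqrt K * sqrt 2 ^ CARD('n) * ((1 / m) powr ?N / ?N))\<^sup>2
      * (K * m ^ (CARD('n) + 2)) = (\<omega> * sqrt 2 ^ CARD('n) / ?N)\<^sup>2" by simp
qed

end

section \<open>From caps and sections to curvature\<close>

context power_sum
begin

lemma Hg_symmetric: "Hg y a \<bullet> b = a \<bullet> Hg y b"
  by (simp add: Hg_def inner_prod_def hessf_inner_commute[OF sm] mult_ac)

end

context power_sum_range
begin

definition curv :: "real \<Rightarrow> 'n pt \<Rightarrow> real" where
  "curv k p = gauss_kronecker (convex_normal D g k) p * norm (grad g p) ^ (CARD('n) + 2)"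

lemma cap_point_at_level:
  assumes k: "k \<in> S" and p: "p \<in> level D g k" and s: "\<And>k. k \<in> S \<Longrightarrow> signed k s"
    and side: "\<And>j k. j \<in> S \<Longrightarrow> k \<in> S \<Longrightarrow> s * (j - k) > 0 \<Longrightarrow> level D g j \<subseteq> convex_side D g k"
  shows "cap_point D g k p s (Hg p) {j \<in> S. s * (j - k) > 0}"
proof
  have jS: "j \<in> S" if "j \<in> insert k {j \<in> S. s * (j - k) > 0}" for j using that k by auto
  have pD: "p \<in> D" using p level_subset by blast
  show "open D" by (rule open_D)
  show "GDERIV g y :> grad g y" if "y \<in> D" for y by (rule g_GDERIV[OF that])
  show "continuous_on D (grad g)" by (rule continuous_grad_g)
  show "(grad g has_derivative Hg p) (at p)" by (rule grad_g_has_derivative[OF pD])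
  show "Hg p a \<bullet> b = a \<bullet> Hg p b" for a b by (rule Hg_symmetric)
  show "p \<in> level D g k" by (rule p)
  show "s = 1 \<or> s = -1" using s[OF k] by (simp add: signed_def)
  fix j assume j: "j \<in> insert k {j \<in> S. s * (j - k) > 0}"
  note F = S_signed_facts[OF jS[OF j] s[OF jS[OF j]]]
  show "convex_normal D g j = (\<lambda>y. s *\<^sub>R unit_grad g y)" using s[OF jS[OF j]] by (simp add: signed_def)
  show "grad g y \<noteq> 0" if "y \<in> level D g j" for y by (rule grad_g_nonzero[OF F that])
  show "s * (grad g y \<bullet> (q - y)) \<ge> 0" if "y \<in> level D g j" "q \<in> level D g j" for y q
    by (rule support[OF F that])
next
  note F = S_signed_facts[OF k s[OF k]]
  show "s * (Hg p w \<bullet> w) < 0" if "w \<noteq> 0" "w \<bullet> grad g p = 0" for w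
    by (rule curvature_sign[OF F p that])
next
  fix j assume "j \<in> {j \<in> S. s * (j - k) > 0}"
  then show "s * (j - k) > 0 \<and> level D g j \<subseteq> convex_side D g k" using side k by auto
qed

lemma point_independent_eventually:
  assumes "point_independent D g S F" "k \<in> S" "is_Ik D g S k I" "p \<in> level D g k" "q \<in> level D g k"
  shows "\<forall>\<^sub>F h in at 0 within {h. k + h \<in> I}. F k p h = F k q h"
proof -
  from assms(1) obtain \<phi> where "\<forall>k\<in>S. \<forall>I. is_Ik D g S k I \<longrightarrow>
      (\<forall>p\<in>level D g k. \<forall>\<^sub>F h in at 0 within {h. k + h \<in> I}. F k p h = \<phi> k h)"
    unfolding point_independent_def by blast
  with assms(2-5) have "\<forall>\<^sub>F h in at 0 within {h. k + h \<in> I}. F k p h = \<phi> k h"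
    "\<forall>\<^sub>F h in at 0 within {h. k + h \<in> I}. F k q h = \<phi> k h" by blast+
  then show ?thesis by eventually_elim simp
qed

lemma is_Ik_filter_nontrivial:
  assumes "is_Ik D g S k I"
  shows "at 0 within {h. k + h \<in> I} \<noteq> bot"
proof -
  have I: "k \<notin> I" "k \<in> closure I" using assms by (auto simp: is_Ik_def convex_side_range_def)
  have "0 \<in> closure ({h. k + h \<in> I} - {0})"
    unfolding closure_approachable
  proof (intro allI impI)
    fix e :: real assume "e > 0"
    then obtain j where j: "j \<in> I" "dist j k < e" using I(2) closure_approachable by blast
    then show "\<exists>y\<in>{h. k + h \<in> I} - {0}. dist y 0 < e"
      using I(1) by (intro bexI[of _ "j - k"]) (auto simp: dist_real_def)
  qed
  then show ?thesis by (simp add: at_within_eq_bot_iff)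
qed

text \<open>The quotients at \<open>p\<close> and \<open>q\<close> agree near \<open>h = 0\<close>,
  so their limits along the same nontrivial filter agree. For interior \<open>k\<close> the lemma
  \<open>is_Ik_side\<close> supplies the interval.\<close>

lemma curv_const_if_cond:
  assumes cond: "condA D g S \<or> condV D g S" and k: "k \<in> interior S"
    and p: "p \<in> level D g k" and q: "q \<in> level D g k"
  shows "curv k p = curv k q"
proof -
  obtain s where s: "s = 1 \<or> s = -1" "\<And>k. k \<in> S \<Longrightarrow> signed k s"
    and side: "\<And>j k. j \<in> S \<Longrightarrow> k \<in> S \<Longrightarrow> s * (j - k) > 0 \<Longrightarrow> level D g j \<subseteq> convex_side D g k"
    by (rule uniform_sign_and_sides) blast
  have kS: "k \<in> S" using k interior_subset by blast
  define I where "I = {j \<in> S. s * (j - k) > 0}"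
  have Ik: "is_Ik D g S k I" unfolding I_def using s(1) k side[OF _ kS] by (rule is_Ik_side)
  interpret p: cap_point D g k p s "Hg p" I unfolding I_def by (rule cap_point_at_level[OF kS p s(2) side])
  interpret q: cap_point D g k q s "Hg q" I unfolding I_def by (rule cap_point_at_level[OF kS q s(2) side])
  note nb = is_Ik_filter_nontrivial[OF Ik]
  have mp: "p.m = norm (grad g p)" "q.m = norm (grad g q)" by (simp_all add: p.m_def q.m_def)
  have cpq: "curv k p = p.K * p.m ^ (CARD('n) + 2)" "curv k q = q.K * q.m ^ (CARD('n) + 2)"
    by (simp_all add: curv_def p.K_def q.K_def mp)
  have w0: "p.\<omega> > 0" by (rule p.omega_pos)
  have fin: "x = y" if "a\<^sup>2 * x = c" "b\<^sup>2 * y = c" "a = b" "c \<noteq> 0" for a b x y c :: real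
    using that by auto
  show ?thesis
  proof (cases "condA D g S")
    case True
    let ?n = "\<lambda>h::real. sqrt (2 * \<bar>h\<bar>) ^ CARD('n)"
    have "\<forall>\<^sub>F h in at 0 within {h. k + h \<in> I}. section_area D g k p h / norm (grad g p)
        = section_area D g k q h / norm (grad g q)"
      using point_independent_eventually[OF True[unfolded condA_def] kS Ik p q] .
    then have ev: "\<forall>\<^sub>F h in at 0 within {h. k + h \<in> I}.
        section_area D g k p h / ?n h / p.m = section_area D g k q h / ?n h / q.m"
    proof eventually_elim
      case (elim h)
      have sw: "x / ?n h / m = x / m / ?n h" for x m by simp
      show ?case unfolding sw mp elim ..
    qed
    have "((\<lambda>h. section_area D g k p h / ?n h / p.m) \<longlongrightarrow> p.\<omega> / sqrt p.K * sqrt (1 / p.m) ^ CARD('n) / p.m)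
        (at 0 within {h. k + h \<in> I})"
      using p.m_pos by (intro tendsto_divide p.section_area_tendsto tendsto_const) auto
    then have lim1: "((\<lambda>h. section_area D g k q h / ?n h / q.m) \<longlongrightarrow> p.\<omega> / sqrt p.K * sqrt (1 / p.m) ^ CARD('n) / p.m)
        (at 0 within {h. k + h \<in> I})"
      by (rule Lim_transform_eventually[OF _ ev])
    have "((\<lambda>h. section_area D g k q h / ?n h / q.m) \<longlongrightarrow> q.\<omega> / sqrt q.K * sqrt (1 / q.m) ^ CARD('n) / q.m)
        (at 0 within {h. k + h \<in> I})"
      using q.m_pos by (intro tendsto_divide q.section_area_tendsto tendsto_const) auto
    note eq = tendsto_unique[OF nb lim1 this]
    show ?thesis
      unfolding cpq by (rule fin[OF p.curvature_from_limits(1) q.curvature_from_limits(1) eq]) (use w0 in simp)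
  next
    case False
    then have V: "condV D g S" using cond by blast
    let ?N = "real CARD('n) / 2 + 1"
    have "\<forall>\<^sub>F h in at 0 within {h. k + h \<in> I}. cap_volume D g k p h = cap_volume D g k q h"
      using point_independent_eventually[OF V[unfolded condV_def] kS Ik p q] .
    then have ev: "\<forall>\<^sub>F h in at 0 within {h. k + h \<in> I}.
        cap_volume D g k p h / \<bar>h\<bar> powr ?N = cap_volume D g k q h / \<bar>h\<bar> powr ?N"
      by eventually_elim simp
    have N0: "?N \<noteq> 0" by (metis add_nonneg_pos divide_nonneg_pos less_irrefl of_nat_0_le_iff zero_less_numeral zero_less_one)
    note lim1 = Lim_transform_eventually[OF p.cap_volume_tendsto ev]
    note eq = tendsto_unique[OF nb lim1 q.cap_volume_tendsto]
    show ?thesis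
      unfolding cpq by (rule fin[OF p.curvature_from_limits(2) q.curvature_from_limits(2) eq]) (use w0 N0 in simp)
  qed
qed

lemma curv_const_if_condK:
  assumes "condK D g S" "k \<in> S" "p \<in> level D g k" "q \<in> level D g k"
  shows "curv k p = curv k q"
  using assms by (auto simp: condK_def curv_def)

end

section \<open>The equation \<open>\<nabla>f \<bullet> (Hess f)\<^sup>-\<^sup>1 \<nabla>f = 2 (f - C)\<close>\<close>

text \<open>The squared norm of \<open>e\<close> is weighted so that the differential inequality
  makes \<open>y\<close> nondecreasing; vanishing at the right end, it is nonpositive at the left
  end.\<close>

lemma gronwall_zero:
  fixes e :: "real \<Rightarrow> 'a::real_inner"
  assumes ab: "a \<le> b"
    and d: "\<And>s. a \<le> s \<Longrightarrow> s \<le> b \<Longrightarrow> (e has_vector_derivative e' s) (at s)"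
    and le: "\<And>s. a \<le> s \<Longrightarrow> s \<le> b \<Longrightarrow> norm (e' s) \<le> L * norm (e s)"
    and b0: "e b = 0"
  shows "e a = 0"
proof -
  define y where "y s = (e s \<bullet> e s) * exp (2 * L * s)" for s
  have "\<exists>z. (y has_real_derivative z) (at s) \<and> 0 \<le> z" if s: "a \<le> s" "s \<le> b" for s
  proof (intro exI conjI)
    have "((\<lambda>s. e s \<bullet> e s) has_vector_derivative e s \<bullet> e' s + e' s \<bullet> e s) (at s)"
      using bounded_bilinear.has_vector_derivative[OF bounded_bilinear_inner d[OF s] d[OF s]] .
    then have "((\<lambda>s. e s \<bullet> e s) has_real_derivative 2 * (e' s \<bullet> e s)) (at s)"
      by (simp add: has_real_derivative_iff_has_vector_derivative inner_commute)
    then show "(y has_real_derivative (2 * (e' s \<bullet> e s) + 2 * L * (e s \<bullet> e s)) * exp (2 * L * s)) (at s)"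
      unfolding y_def by (auto intro!: derivative_eq_intros simp: algebra_simps)
    have "\<bar>e' s \<bullet> e s\<bar> \<le> norm (e' s) * norm (e s)" by (rule Cauchy_Schwarz_ineq2)
    also have "\<dots> \<le> (L * norm (e s)) * norm (e s)" using le[OF s] by (rule mult_right_mono) simp
    also have "\<dots> = L * (e s \<bullet> e s)" by (simp add: dot_square_norm power2_eq_square)
    finally show "0 \<le> (2 * (e' s \<bullet> e s) + 2 * L * (e s \<bullet> e s)) * exp (2 * L * s)" by simp
  qed
  then have "y a \<le> y b" by (intro DERIV_nonneg_imp_nondecreasing[OF ab]) blast
  then have "y a \<le> 0" by (simp add: y_def b0)
  then have "e a \<bullet> e a \<le> 0" by (simp add: y_def mult_le_0_iff)
  then show ?thesis by (metis inner_eq_zero_iff inner_ge_zero order_antisym)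
qed

definition newton :: "(real^'n::finite \<Rightarrow> real) \<Rightarrow> real^'n \<Rightarrow> real^'n" where
  "newton f x = matrix_inv (hessf f x) *v gradf f x"

context
  fixes f :: "real^'n::finite \<Rightarrow> real"
  assumes sm: "smooth f" and sc: "strictly_convex_fun f"
begin

lemma det_hessf_pos: "det (hessf f x) > 0"
  by (rule ellipsoid_measure(1)[OF hessf_inner_commute[OF sm] hessf_pos[OF sm sc], of 0]) auto

lemma hessf_newton: "hessf f x *v newton f x = gradf f x"
proof -
  have "invertible (hessf f x)" using det_hessf_pos[of x] by (simp add: invertible_det_nz)
  then have "hessf f x ** matrix_inv (hessf f x) = mat 1"
    unfolding invertible_def matrix_inv_def by (rule someI2_ex) blast
  then show ?thesis by (simp add: newton_def matrix_vector_mul_assoc)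
qed

lemma newton_inner_pos: "gradf f x \<noteq> 0 \<Longrightarrow> gradf f x \<bullet> newton f x > 0"
  using hessf_newton[of x] hessf_pos[OF sm sc, of "newton f x" x] by fastforce

text \<open>Completing the square: the left side is a concave quadratic in \<open>v\<close> with its
  maximum at \<open>newton f x\<close>.\<close>

lemma gradf_newton_max:
  "2 * (gradf f x \<bullet> v) - (hessf f x *v v) \<bullet> v \<le> gradf f x \<bullet> newton f x"
proof -
  let ?w = "v - newton f x"
  have "0 \<le> (hessf f x *v ?w) \<bullet> ?w"
    using hessf_pos[OF sm sc, of ?w x] by (cases "?w = 0") auto
  also have "\<dots> = (hessf f x *v v) \<bullet> v - 2 * (gradf f x \<bullet> v) + gradf f x \<bullet> newton f x"
    using hessf_inner_commute[OF sm, of x v "newton f x"]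
    by (simp add: matrix_vector_mult_diff_distrib inner_diff_left inner_diff_right hessf_newton inner_commute)
  finally show ?thesis by simp
qed

lemma hessf_lower_bound:
  assumes "compact X" "X \<noteq> {}"
  obtains c where "c > 0" "\<And>x u. x \<in> X \<Longrightarrow> c * (norm u)\<^sup>2 \<le> (hessf f x *v u) \<bullet> u"
proof -
  let ?F = "\<lambda>y. (hessf f (fst y) *v snd y) \<bullet> snd y"
  have ch: "continuous_on UNIV (\<lambda>x. hessf f x *v a)" for a
    using hessf_mult_has_derivative[OF sm] by (meson continuous_at_imp_continuous_on has_derivative_continuous)
  have "hessf f (fst y) *v snd y = (\<Sum>j\<in>UNIV. snd y $ j *\<^sub>R (hessf f (fst y) *v axis j 1))" for y :: "(real^'n) \<times> (real^'n)"
    by (rule linear_vec_expansion[OF matrix_vector_mul_linear])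
  then have "?F = (\<lambda>y. (\<Sum>j\<in>UNIV. snd y $ j *\<^sub>R (hessf f (fst y) *v axis j 1)) \<bullet> snd y)" by (simp add: fun_eq_iff)
  moreover have "continuous_on (X \<times> sphere 0 1) (\<lambda>y. (\<Sum>j\<in>UNIV. snd y $ j *\<^sub>R (hessf f (fst y) *v axis j 1)) \<bullet> snd y)"
    by (intro continuous_intros continuous_on_compose2[OF ch]) auto
  ultimately have c: "continuous_on (X \<times> sphere 0 1) ?F" by (simp only:)
  have "compact (X \<times> sphere (0::real^'n) 1)" "X \<times> sphere (0::real^'n) 1 \<noteq> {}"
    using assms by (auto intro: compact_Times)
  then obtain y0 where y0: "y0 \<in> X \<times> sphere 0 1" "\<And>y. y \<in> X \<times> sphere 0 1 \<Longrightarrow> ?F y0 \<le> ?F y"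
    using continuous_attains_inf[OF _ _ c] by blast
  have "?F y0 > 0" using y0(1) by (intro hessf_pos[OF sm sc]) auto
  moreover have "?F y0 * (norm u)\<^sup>2 \<le> (hessf f x *v u) \<bullet> u" if "x \<in> X" for x u
  proof (cases "u = 0")
    case False
    then have "?F y0 \<le> ?F (x, u /\<^sub>R norm u)" using that by (intro y0(2)) auto
    also have "\<dots> = ((hessf f x *v u) \<bullet> u) / (norm u)\<^sup>2"
      by (simp add: matrix_vector_mult_scaleR power2_eq_square divide_inverse)
    finally show ?thesis using False by (simp add: pos_le_divide_eq)
  qed simp
  ultimately show ?thesis using that by blast
qed

context
  fixes C
  assumes Q: "\<And>x. gradf f x \<bullet> newton f x = 2 * (f x - C)"
begin

text \<open>For fixed \<open>v = newton f x\<close> the function \<open>2 (f - C) - (2 \<nabla>f \<bullet> v - Hess f (v, v))\<close> is nonnegative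
  and vanishes at \<open>x\<close>, so its derivative vanishes there.\<close>

lemma thirdf_newton: "thirdf f x (newton f x) (newton f x) = 0"
proof -
  define v where "v = newton f x"
  define \<psi> where "\<psi> y = 2 * (f y - C) - (2 * (gradf f y \<bullet> v) - (hessf f y *v v) \<bullet> v)" for y
  have "\<psi> y \<ge> 0" for y unfolding \<psi>_def Q[symmetric] using gradf_newton_max[of y v] by simp
  moreover have "\<psi> x = 0" unfolding \<psi>_def Q[symmetric] by (simp add: v_def hessf_newton)
  moreover have d: "(\<psi> has_derivative (\<lambda>w. 2 * (gradf f x \<bullet> w) -
      (2 * ((hessf f x *v w) \<bullet> v) - thirdf f x v w \<bullet> v))) (at x)"
    unfolding \<psi>_def
    by (auto intro!: derivative_eq_intros f_has_derivative[OF sm] gradf_has_derivative[OF sm]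
        hessf_mult_has_derivative[OF sm])
  ultimately have "(\<lambda>w. 2 * (gradf f x \<bullet> w) - (2 * ((hessf f x *v w) \<bullet> v) - thirdf f x v w \<bullet> v)) = (\<lambda>w. 0)"
    by (intro differential_zero_maxmin[OF _ open_UNIV d]) auto
  then have "2 * (gradf f x \<bullet> w) - (2 * ((hessf f x *v w) \<bullet> v) - thirdf f x v w \<bullet> v) = 0" for w
    by (rule fun_cong)
  moreover have "(hessf f x *v w) \<bullet> v = gradf f x \<bullet> w" for w
  proof -
    have "(hessf f x *v w) \<bullet> v = w \<bullet> (hessf f x *v v)" by (rule hessf_inner_commute[OF sm])
    also have "hessf f x *v v = gradf f x" by (simp add: v_def hessf_newton)
    finally show ?thesis by (simp add: inner_commute)
  qed
  ultimately have z: "thirdf f x v w \<bullet> v = 0" for w by simp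
  have "thirdf f x v v \<bullet> w = 0" for w
    using z[of w] thirdf_inner_commute[OF sm, of x w v v] thirdf_commute[OF sm, of x v w] by simp
  then show ?thesis unfolding v_def[symmetric] by (metis inner_eq_zero_iff)
qed

lemma thirdf_add_left: "thirdf f x (a + b) w = thirdf f x a w + thirdf f x b w"
  using linear_add[OF linear_thirdf[OF sm]] thirdf_commute[OF sm] by metis

text \<open>The Newton direction is constant along its own line, by uniqueness for the linear ODE satisfied
  by the defect \<open>e\<close>.\<close>

lemma gradf_newton_step: "gradf f (x0 - newton f x0) = 0"
proof -
  define v where "v = newton f x0"
  \<comment> \<open>\<open>X\<close> runs from the Newton step at \<open>s = 0\<close> to
    \<open>x0\<close> at \<open>s = 1\<close>. The Hessian takes the difference of
    \<open>s *\<^sub>R v\<close> and the Newton direction at \<open>X s\<close> to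
    \<open>e s\<close>.\<close>
  define X where "X s = x0 + (s - 1) *\<^sub>R v" for s
  define e where "e s = s *\<^sub>R (hessf f (X s) *v v) - gradf f (X s)" for s
  define e' where "e' s = s *\<^sub>R thirdf f (X s) v v" for s
  have dX: "(X has_derivative (\<lambda>t. t *\<^sub>R v)) (at s)" for s
    unfolding X_def by (auto intro!: derivative_eq_intros)
  have de: "(e has_vector_derivative e' s) (at s)" for s
  proof -
    have "(e has_derivative (\<lambda>t. (s *\<^sub>R thirdf f (X s) v (t *\<^sub>R v) + t *\<^sub>R (hessf f (X s) *v v)) - hessf f (X s) *v (t *\<^sub>R v))) (at s)"
      unfolding e_def
      by (intro has_derivative_diff has_derivative_scaleR has_derivative_ident
          has_derivative_compose[OF dX hessf_mult_has_derivative[OF sm]]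
          has_derivative_compose[OF dX gradf_has_derivative[OF sm]])
    then show ?thesis
      by (simp add: has_vector_derivative_def e'_def linear_scale[OF linear_thirdf[OF sm]]
          matrix_vector_mult_scaleR mult.commute)
  qed
  have e1: "e 1 = 0" by (simp add: e_def X_def v_def hessf_newton)
  let ?K = "X ` {0..1}"
  have K: "compact ?K" "?K \<noteq> {}"
    using dX by (auto intro!: compact_continuous_image continuous_at_imp_continuous_on has_derivative_continuous)
  obtain M where M: "M \<ge> 0" "\<And>x a b. x \<in> ?K \<Longrightarrow> norm (thirdf f x a b) \<le> M * norm a * norm b"
    by (rule thirdf_bounded[OF sm K(1)]) blast
  obtain c where c: "c > 0" "\<And>x u. x \<in> ?K \<Longrightarrow> c * (norm u)\<^sup>2 \<le> (hessf f x *v u) \<bullet> u"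
    by (rule hessf_lower_bound[OF K]) blast
  have inv: "norm u \<le> norm (hessf f x *v u) / c" if "x \<in> ?K" for x u
  proof (cases "u = 0")
    case False
    have "c * (norm u)\<^sup>2 \<le> norm (hessf f x *v u) * norm u"
      using c(2)[OF that, of u] norm_cauchy_schwarz[of "hessf f x *v u" u] by linarith
    then have "c * norm u \<le> norm (hessf f x *v u)" using False by (simp add: power2_eq_square)
    then show ?thesis using c(1) by (simp add: pos_le_divide_eq mult.commute)
  qed (use c in simp)
  have "continuous_on ?K (gradf f)"
    using gradf_has_derivative[OF sm] by (meson continuous_at_imp_continuous_on has_derivative_continuous)
  then have "bounded (gradf f ` ?K)" by (intro compact_imp_bounded compact_continuous_image[OF _ K(1)])
  then obtain G where G: "\<And>x. x \<in> ?K \<Longrightarrow> norm (gradf f x) \<le> G" by (auto simp: bounded_iff)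
  \<comment> \<open>The Lipschitz constant below carries a factor \<open>1 / a\<close>, so the
    uniqueness argument runs on \<open>[a, 1]\<close> and the value at 0 follows by
    continuity.\<close>
  have zero: "e a = 0" if a: "0 < a" "a \<le> 1" for a
  proof -
    define L where "L = M * (norm v + G / c) / (c * a)"
    show ?thesis
    proof (rule gronwall_zero[OF a(2), where e' = e' and L = L])
      fix s assume s: "a \<le> s" "s \<le> 1"
      then have XK: "X s \<in> ?K" and s0: "s > 0" using a by auto
      define \<xi> \<delta> where "\<xi> = newton f (X s)" and "\<delta> = s *\<^sub>R v - \<xi>"
      have "hessf f (X s) *v \<delta> = e s"
        by (simp add: \<delta>_def e_def matrix_vector_mult_diff_distrib matrix_vector_mult_scaleR \<xi>_def hessf_newton)
      then have d: "norm \<delta> \<le> norm (e s) / c" using inv[OF XK, of \<delta>] by simp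
      have x: "norm \<xi> \<le> G / c"
        using inv[OF XK, of \<xi>] G[OF XK] c(1) by (simp add: \<xi>_def hessf_newton) (meson divide_right_mono less_imp_le order_trans)
      have "s *\<^sub>R e' s = thirdf f (X s) (s *\<^sub>R v) (s *\<^sub>R v)"
      proof -
        have "thirdf f (X s) (s *\<^sub>R v) (s *\<^sub>R v) = s *\<^sub>R thirdf f (X s) (s *\<^sub>R v) v"
          by (rule linear_scale[OF linear_thirdf[OF sm]])
        also have "thirdf f (X s) (s *\<^sub>R v) v = thirdf f (X s) v (s *\<^sub>R v)"
          by (rule thirdf_commute[OF sm])
        also have "\<dots> = s *\<^sub>R thirdf f (X s) v v" by (rule linear_scale[OF linear_thirdf[OF sm]])
        finally show ?thesis by (simp add: e'_def)
      qed
      \<comment> \<open>The third derivative vanishes on the pair \<open>(\<xi>, \<xi>)\<close>, so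
        its value on \<open>s *\<^sub>R v\<close>, the sum of \<xi> and \<delta>, keeps a factor
        \<delta>. This is what makes the inequality for \<open>e\<close> linear.\<close>
      also have "\<dots> = thirdf f (X s) (s *\<^sub>R v + \<xi>) \<delta>"
      proof -
        have sv: "s *\<^sub>R v = \<xi> + \<delta>" by (simp add: \<delta>_def)
        have "thirdf f (X s) (\<xi> + \<delta>) (\<xi> + \<delta>) = thirdf f (X s) (\<xi> + \<delta>) \<xi> + thirdf f (X s) (\<xi> + \<delta>) \<delta>"
          by (rule linear_add[OF linear_thirdf[OF sm]])
        also have "thirdf f (X s) (\<xi> + \<delta>) \<xi> = thirdf f (X s) \<xi> \<delta>"
          using thirdf_newton[of "X s"] by (simp add: thirdf_add_left \<xi>_def[symmetric] thirdf_commute[OF sm, of _ \<delta>])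
        finally show ?thesis unfolding sv thirdf_add_left[of "X s" "\<xi> + \<delta>" \<xi>] by (simp only: add.commute)
      qed
      finally have "s * norm (e' s) = norm (thirdf f (X s) (s *\<^sub>R v + \<xi>) \<delta>)"
        using s0 by (metis abs_of_pos norm_scaleR)
      also have "\<dots> \<le> M * norm (s *\<^sub>R v + \<xi>) * norm \<delta>" by (rule M(2)[OF XK])
      also have "\<dots> \<le> M * (norm v + G / c) * (norm (e s) / c)"
      proof (intro mult_mono mult_left_mono)
        have "norm (s *\<^sub>R v + \<xi>) \<le> s * norm v + norm \<xi>" using norm_triangle_ineq[of "s *\<^sub>R v" \<xi>] s0 by simp
        also have "s * norm v \<le> norm v" using s s0 by (simp add: mult_left_le_one_le)
        finally show "norm (s *\<^sub>R v + \<xi>) \<le> norm v + G / c" using x by linarith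
        have "0 \<le> G / c" using x norm_ge_zero order_trans by blast
        then show "0 \<le> M * (norm v + G / c)" using M(1) by simp
      qed (use M d in auto)
      finally have ub: "s * norm (e' s) \<le> M * (norm v + G / c) * (norm (e s) / c)" .
      have "a * norm (e' s) \<le> s * norm (e' s)" using s by (intro mult_right_mono) auto
      with ub have "a * norm (e' s) \<le> M * (norm v + G / c) * (norm (e s) / c)" by linarith
      then have "norm (e' s) \<le> M * (norm v + G / c) * (norm (e s) / c) / a"
        by (subst pos_le_divide_eq[OF a(1)]) (simp add: mult.commute)
      then show "norm (e' s) \<le> L * norm (e s)" by (simp add: L_def mult_ac)
    qed (use de e1 in auto)
  qed
  have "isCont e 0" using de has_vector_derivative_continuous by blast
  then have "(e \<longlongrightarrow> e 0) (at_right 0)" by (simp add: isCont_def filterlim_at_split)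
  moreover have "\<forall>\<^sub>F a in at_right 0. e a = 0"
    using eventually_at_right_real[of 0 1] by (rule eventually_mono) (use zero in auto)
  then have "(e \<longlongrightarrow> 0) (at_right 0)" by (simp add: tendsto_eventually)
  ultimately have "e 0 = 0" using tendsto_unique trivial_limit_at_right_real by blast
  then show ?thesis by (simp add: e_def X_def v_def)
qed

text \<open>All Newton steps end at the unique critical point \<open>b\<close>, so
  \<open>newton f x\<close> is \<open>x - b\<close>. The third derivative then vanishes on
  \<open>(x - b, x - b)\<close>, hence the Hessian form at \<open>x - b\<close> is constant along
  the ray from \<open>b\<close>, and \<open>Q\<close> turns its value into that of
  \<open>f\<close>.\<close>

theorem f_quadratic:
  obtains b where "gradf f b = 0" "\<And>x. f x = C + ((hessf f b *v (x - b)) \<bullet> (x - b)) / 2"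
proof -
  define b where "b = 0 - newton f 0"
  have b: "gradf f b = 0" unfolding b_def by (rule gradf_newton_step)
  have nx: "newton f x = x - b" for x
    using gradf_zero_unique[OF sm sc gradf_newton_step b, of x] by (simp add: algebra_simps)
  have "f x = C + ((hessf f b *v (x - b)) \<bullet> (x - b)) / 2" for x
  proof -
    define d where "d = x - b"
    let ?F = "\<lambda>t. (hessf f (b + t *\<^sub>R d) *v d) \<bullet> d"
    have der: "(?F has_real_derivative thirdf f (b + t *\<^sub>R d) d d \<bullet> d) (at t)" for t
    proof -
      have l: "((\<lambda>t. b + t *\<^sub>R d) has_derivative (\<lambda>t. t *\<^sub>R d)) (at t)"
        by (auto intro!: derivative_eq_intros)
      show ?thesis
        using has_derivative_inner_left[OF has_derivative_compose[OF l hessf_mult_has_derivative[OF sm]], of d]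
        by (simp add: has_field_derivative_def linear_scale[OF linear_thirdf[OF sm]] mult_commute_abs)
    qed
    have "thirdf f (b + t *\<^sub>R d) d d \<bullet> d = 0" if "t > 0" for t
    proof -
      have "thirdf f (b + t *\<^sub>R d) (t *\<^sub>R d) (t *\<^sub>R d) = 0"
        using thirdf_newton[of "b + t *\<^sub>R d"] by (simp add: nx)
      then have "t *\<^sub>R (t *\<^sub>R thirdf f (b + t *\<^sub>R d) d d) = 0"
        by (metis linear_scale[OF linear_thirdf[OF sm]] thirdf_commute[OF sm])
      then show ?thesis using that by simp
    qed
    then have "(?F has_real_derivative 0) (at t)" if "t > 0" for t using der[of t] that by simp
    moreover have "continuous_on {0..1} ?F"
      using der by (intro continuous_at_imp_continuous_on ballI DERIV_isCont) blast
    ultimately have "?F 1 = ?F 0" by (intro DERIV_isconst_end) auto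
    then have "(hessf f x *v d) \<bullet> d = (hessf f b *v d) \<bullet> d" by (simp add: d_def)
    moreover have "2 * (f x - C) = (hessf f x *v d) \<bullet> d"
      using Q[of x] hessf_newton[of x] by (simp add: nx d_def)
    ultimately show ?thesis by (simp add: d_def)
  qed
  with b show ?thesis using that by blast
qed

end

end

section \<open>Constant curvature quantity forces an ellipsoid\<close>

text \<open>The difference of both sides is a polynomial with infinitely many zeros, so it may be
  evaluated at \<open>t1\<close> and \<open>t2\<close> even if they lie outside the interval. At
  each of them one side vanishes, and together the two values force
  \<open>c1 + c2 = 0\<close>.\<close>

lemma cubic_identity_rigid:
  fixes \<beta> \<alpha> t1 t2 c1 c2 a b :: real
  assumes ab: "a < b" and \<alpha>: "\<alpha> \<noteq> 0" and \<beta>: "\<beta> \<noteq> 0" and t: "t1 \<noteq> t2"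
    and c: "c1 \<noteq> 0" "c2 \<noteq> 0" "c1 + c2 \<noteq> 0"
    and eq: "\<And>k. a < k \<Longrightarrow> k < b \<Longrightarrow>
      (\<beta> * (\<alpha> * (k - t1) + c1) + \<alpha> * (k - t1)) * ((k - t2) * (\<alpha> * (k - t2) + c2))
      = (\<beta> * (\<alpha> * (k - t2) + c2) + \<alpha> * (k - t2)) * ((k - t1) * (\<alpha> * (k - t1) + c1))"
  shows False
proof -
  define w where "w t = [:- t, 1::real:]" for t
  define A where "A t c = smult \<alpha> (w t) + [:c:]" for t c
  define p where "p = (smult \<beta> (A t1 c1) + smult \<alpha> (w t1)) * (w t2 * A t2 c2)
    - (smult \<beta> (A t2 c2) + smult \<alpha> (w t2)) * (w t1 * A t1 c1)"
  have pv: "poly p k = (\<beta> * (\<alpha> * (k - t1) + c1) + \<alpha> * (k - t1)) * ((k - t2) * (\<alpha> * (k - t2) + c2))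
      - (\<beta> * (\<alpha> * (k - t2) + c2) + \<alpha> * (k - t2)) * ((k - t1) * (\<alpha> * (k - t1) + c1))" for k
  proof -
    have wv: "poly (w t) k = k - t" for t by (simp add: w_def)
    have Av: "poly (A t c) k = \<alpha> * (k - t) + c" for t c by (simp add: A_def wv)
    show ?thesis by (simp only: p_def poly_diff poly_mult poly_add poly_smult wv Av)
  qed
  have "p = 0"
  proof (rule ccontr)
    assume "p \<noteq> 0"
    then have "finite {k. poly p k = 0}" by (rule poly_roots_finite)
    moreover have "{a<..<b} \<subseteq> {k. poly p k = 0}" using eq by (auto simp: pv)
    ultimately have "finite {a<..<b}" using finite_subset by blast
    then show False using ab by (simp add: infinite_Ioo)
  qed
  then have z: "poly p k = 0" for k by simp
  have "\<beta> * c1 * ((t1 - t2) * (\<alpha> * (t1 - t2) + c2)) = 0" using z[of t1] unfolding pv by simp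
  then have 1: "\<alpha> * (t1 - t2) + c2 = 0" using \<beta> c t by simp
  have "\<beta> * c2 * ((t2 - t1) * (\<alpha> * (t2 - t1) + c1)) = 0" using z[of t2] unfolding pv by simp
  then have 2: "\<alpha> * (t2 - t1) + c1 = 0" using \<beta> c t by simp
  have "c1 + c2 = 0" using 1 2 by (simp add: algebra_simps)
  then show False using c by simp
qed

text \<open>Comparing logarithmic derivatives in \<open>k\<close> eliminates the factors
  \<open>D1\<close> and \<open>D2\<close>. Clearing denominators leaves the identity of
  \<open>cubic_identity_rigid\<close>, which is contradictory unless the exponent
  \<open>1 - 2 / \<alpha>\<close> is zero.\<close>

lemma curvature_profile_rigid:
  fixes \<alpha> t1 t2 Q1 Q2 D1 D2 a b \<epsilon> :: real
  assumes ab: "a < b" and \<alpha>: "\<alpha> \<noteq> 0" "\<alpha> \<noteq> 1" and t: "t1 \<noteq> t2" and Q: "Q1 > 0" "Q2 > 0"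
    and D: "D1 > 0" "D2 > 0" and \<epsilon>: "\<epsilon> = 1 \<or> \<epsilon> = -1"
    and pos: "\<And>k. a < k \<Longrightarrow> k < b \<Longrightarrow> \<epsilon> * (k - t1) > 0 \<and> \<epsilon> * (k - t2) > 0"
    and eq: "\<And>k. a < k \<Longrightarrow> k < b \<Longrightarrow>
      D1 * (\<epsilon> * (k - t1)) powr (1 - 2 / \<alpha>) * (\<alpha> * (k - t1) + (\<alpha> - 1) * Q1)
      = D2 * (\<epsilon> * (k - t2)) powr (1 - 2 / \<alpha>) * (\<alpha> * (k - t2) + (\<alpha> - 1) * Q2)"
  shows "\<alpha> = 2"
proof (rule ccontr)
  assume a2: "\<alpha> \<noteq> 2"
  define \<beta> where "\<beta> = 1 - 2 / \<alpha>"
  have b0: "\<beta> \<noteq> 0" using a2 \<alpha> by (simp add: \<beta>_def)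
  define F where "F D t c k = D * (\<epsilon> * (k - t)) powr \<beta> * (\<alpha> * (k - t) + c)" for D t c k
  have eps: "\<epsilon> * \<epsilon> = 1" using \<epsilon> by auto
  \<comment> \<open>The logarithmic derivative is stated with cleared denominators, because the
    factor \<open>\<alpha> * (k - t) + c\<close> may vanish.\<close>
  have dF: "\<exists>F'. (F D t c has_real_derivative F') (at k) \<and>
      F' * ((k - t) * (\<alpha> * (k - t) + c)) = F D t c k * (\<beta> * (\<alpha> * (k - t) + c) + \<alpha> * (k - t))"
    if "\<epsilon> * (k - t) > 0" for D t c k
  proof -
    define y where "y = \<epsilon> * (k - t)"
    have y: "y > 0" "k - t = \<epsilon> * y" using that eps by (auto simp: y_def mult.assoc[symmetric])
    have "((\<lambda>k. \<epsilon> * (k - t)) has_real_derivative \<epsilon>) (at k)" by (auto intro!: derivative_eq_intros)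
    moreover have "((\<lambda>z. z powr \<beta>) has_real_derivative \<beta> * y powr (\<beta> - 1)) (at (\<epsilon> * (k - t)))"
      using has_real_derivative_powr[OF y(1)] by (simp add: y_def)
    ultimately have dp: "((\<lambda>k. (\<epsilon> * (k - t)) powr \<beta>) has_real_derivative \<beta> * y powr (\<beta> - 1) * \<epsilon>) (at k)"
      by (rule DERIV_chain2[where f = "\<lambda>z. z powr \<beta>" and g = "\<lambda>k. \<epsilon> * (k - t)", rotated])
    have "(F D t c has_real_derivative
        D * (\<beta> * y powr (\<beta> - 1) * \<epsilon>) * (\<alpha> * (k - t) + c) + D * y powr \<beta> * \<alpha>) (at k)"
      unfolding F_def[abs_def] using that by (auto intro!: derivative_eq_intros dp simp: y_def)
    moreover have "(D * (\<beta> * y powr (\<beta> - 1) * \<epsilon>) * (\<alpha> * (k - t) + c) + D * y powr \<beta> * \<alpha>) * ((k - t) * (\<alpha> * (k - t) + c))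
        = F D t c k * (\<beta> * (\<alpha> * (k - t) + c) + \<alpha> * (k - t))"
    proof -
      have p1: "y powr (\<beta> - 1) * \<epsilon> * (k - t) = y powr \<beta>"
      proof -
        have "y powr (\<beta> - 1) * \<epsilon> * (k - t) = y powr (\<beta> - 1) * y" by (simp add: y_def)
        also have "\<dots> = y powr \<beta>" using y(1) by (simp add: powr_diff)
        finally show ?thesis .
      qed
      have "(D * (\<beta> * y powr (\<beta> - 1) * \<epsilon>) * (\<alpha> * (k - t) + c) + D * y powr \<beta> * \<alpha>) * ((k - t) * (\<alpha> * (k - t) + c))
          = D * (\<beta> * (y powr (\<beta> - 1) * \<epsilon> * (k - t)) * (\<alpha> * (k - t) + c)) * (\<alpha> * (k - t) + c)
            + D * y powr \<beta> * \<alpha> * ((k - t) * (\<alpha> * (k - t) + c))" by (simp add: algebra_simps)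
      also have "\<dots> = D * y powr \<beta> * (\<alpha> * (k - t) + c) * (\<beta> * (\<alpha> * (k - t) + c) + \<alpha> * (k - t))"
        unfolding p1 by (simp add: algebra_simps)
      finally show ?thesis by (simp add: F_def y_def)
    qed
    ultimately show ?thesis by blast
  qed
  define c1 c2 where "c1 = (\<alpha> - 1) * Q1" and "c2 = (\<alpha> - 1) * Q2"
  have F12: "F D1 t1 c1 k = F D2 t2 c2 k" if "a < k" "k < b" for k
    using eq[OF that] by (simp add: F_def \<beta>_def c1_def c2_def)
  show False
  proof (rule cubic_identity_rigid[OF ab \<alpha>(1) b0 t, of c1 c2])
    show "c1 \<noteq> 0" "c2 \<noteq> 0" using Q \<alpha> by (auto simp: c1_def c2_def)
    have "c1 + c2 = (\<alpha> - 1) * (Q1 + Q2)" by (simp add: c1_def c2_def algebra_simps)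
    then show "c1 + c2 \<noteq> 0" using Q \<alpha> by simp
    fix k assume k: "a < k" "k < b"
    define A1 A2 where "A1 = \<alpha> * (k - t1) + c1" and "A2 = \<alpha> * (k - t2) + c2"
    obtain F1 where F1: "(F D1 t1 c1 has_real_derivative F1) (at k)"
      "F1 * ((k - t1) * A1) = F D1 t1 c1 k * (\<beta> * A1 + \<alpha> * (k - t1))"
      using dF[of k t1 D1 c1] pos[OF k] unfolding A1_def by blast
    obtain F2 where F2: "(F D2 t2 c2 has_real_derivative F2) (at k)"
      "F2 * ((k - t2) * A2) = F D2 t2 c2 k * (\<beta> * A2 + \<alpha> * (k - t2))"
      using dF[of k t2 D2 c2] pos[OF k] unfolding A2_def by blast
    have "(F D1 t1 c1 has_real_derivative F2) (at k)"
      by (rule DERIV_cong_ev[THEN iffD1, OF refl _ refl F2(1)])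
        (use k F12 in \<open>auto simp: eventually_nhds intro!: exI[of _ "{a<..<b}"]\<close>)
    then have F21: "F2 = F1" using F1(1) DERIV_unique by blast
    have fk: "F D1 t1 c1 k = F D2 t2 c2 k" by (rule F12[OF k])
    have "(\<beta> * A1 + \<alpha> * (k - t1)) * ((k - t2) * A2) = (\<beta> * A2 + \<alpha> * (k - t2)) * ((k - t1) * A1)"
    \<comment> \<open>Where the common value is zero it cannot be cancelled, but then both linear
      factors vanish at \<open>k\<close> and with them both sides.\<close>
    proof (cases "F D1 t1 c1 k = 0")
      case True
      have "\<epsilon> * (k - t1) > 0" "\<epsilon> * (k - t2) > 0" using pos[OF k] by auto
      then have "A1 = 0" "A2 = 0" using True fk D by (auto simp: F_def A1_def A2_def)
      then show ?thesis by simp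
    next
      case False
      have "F D1 t1 c1 k * ((\<beta> * A1 + \<alpha> * (k - t1)) * ((k - t2) * A2))
          = F1 * ((k - t1) * A1) * ((k - t2) * A2)" using F1(2) by simp
      also have "\<dots> = F1 * ((k - t2) * A2) * ((k - t1) * A1)" by (simp only: mult_ac)
      also have "\<dots> = F D1 t1 c1 k * ((\<beta> * A2 + \<alpha> * (k - t2)) * ((k - t1) * A1))"
        using F2(2) F21 fk by simp
      finally show ?thesis using False by simp
    qed
    then show "(\<beta> * (\<alpha> * (k - t1) + c1) + \<alpha> * (k - t1)) * ((k - t2) * (\<alpha> * (k - t2) + c2))
      = (\<beta> * (\<alpha> * (k - t2) + c2) + \<alpha> * (k - t2)) * ((k - t1) * (\<alpha> * (k - t1) + c1))"
      unfolding A1_def A2_def .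
  qed
qed

context power_sum_range
begin

definition Q where "Q x = gradf f x \<bullet> newton f x"

text \<open>On the level \<open>zpower \<alpha> z\<close> is \<open>k - f x\<close>, so
  \<open>z\<^sup>2\<close> is a power of \<open>\<bar>k - f x\<bar>\<close> and the height
  \<open>z\<close> can be eliminated.\<close>

lemma curv_eq:
  assumes k: "k \<in> S" "signed k s" and p: "(x, z) \<in> level D g k" and z: "z \<noteq> 0"
  shows "curv k (x, z) = (- s) ^ CARD('n) * \<alpha> * sgn (k - f x) *
    (det (hessf f x) * \<bar>k - f x\<bar> powr (1 - 2 / \<alpha>) * (\<alpha> * (k - f x) + (\<alpha> - 1) * Q x))"
proof -
  have zJ: "z \<in> J" and w: "zpower \<alpha> z = k - f x" using p by (simp_all add: level_iff)
  have pD: "(x, z) \<in> D" using p level_subset by blast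
  define w' where "w' = k - f x"
  have w0: "w' \<noteq> 0" using zpower_nonzero[OF zJ z] w by (simp add: w'_def)
  have az: "\<bar>w'\<bar> = \<bar>z\<bar> powr \<alpha>" using abs_zpower[OF J_nonzero[OF zJ z]] w by (simp add: w'_def)
  have z2: "z\<^sup>2 = \<bar>w'\<bar> powr (2 / \<alpha>)"
  proof -
    have "\<bar>w'\<bar> powr (2 / \<alpha>) = \<bar>z\<bar> powr 2" unfolding az using alpha by (simp add: powr_powr)
    also have "\<dots> = z\<^sup>2" using z by (simp add: powr_numeral)
    finally show ?thesis by simp
  qed
  have wz: "w' / z\<^sup>2 = sgn w' * \<bar>w'\<bar> powr (1 - 2 / \<alpha>)"
    using w0 by (simp add: z2 powr_diff) (simp add: sgn_if)
  have "curv k (x, z) = (- s) ^ CARD('n) * det (hessf f x) * ((\<phi>1 z)\<^sup>2 + \<phi>2 z * Q x)"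
    unfolding curv_def Q_def using k(2) gauss_kronecker_formula[OF pD z _ hessf_newton[OF sm sc], of s]
    by (simp add: signed_def)
  also have "(\<phi>1 z)\<^sup>2 + \<phi>2 z * Q x = \<alpha> * (w' / z\<^sup>2) * (\<alpha> * w' + (\<alpha> - 1) * Q x)"
    using z by (simp add: phi1_eq[OF zJ z] phi2_eq[OF zJ z] w w'_def[symmetric] power2_eq_square field_simps)
  finally show ?thesis unfolding wz by (simp add: w'_def)
qed

lemma alpha_eq_2:
  assumes cc: "\<And>k p q. k \<in> interior S \<Longrightarrow> p \<in> level D g k \<Longrightarrow> q \<in> level D g k \<Longrightarrow> curv k p = curv k q"
  shows "\<alpha> = 2"
proof (rule ccontr)
  assume a2: "\<alpha> \<noteq> 2"
  obtain s where s: "s = 1 \<or> s = -1" "\<And>k. k \<in> S \<Longrightarrow> signed k s"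
    by (rule uniform_sign_and_sides) blast
  obtain k0 where k0: "k0 \<in> interior S" using S_interior by blast
  then have k0S: "k0 \<in> S" using interior_subset by blast
  obtain x0 z0 where p0: "(x0, z0) \<in> level D g k0" using level_nonempty[OF k0S] by blast
  have z0J: "z0 \<in> J" and w0: "zpower \<alpha> z0 = k0 - f x0" using p0 by (auto simp: level_iff)
  have z0: "z0 \<noteq> 0"
  proof (cases "\<alpha> \<in> \<nat>")
    case True
    then have "f x0 > k0" using flat_zero_section[OF S_signed_facts[OF k0S s(2)[OF k0S]]] a2 by blast
    moreover have "zpower \<alpha> 0 = 0" using True alpha
      by (auto simp: zpower_def power_int_def elim!: Nats_cases)
    ultimately show ?thesis using w0 by auto
  next
    case False
    then show ?thesis using z0J by (cases rule: J_cases) auto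
  qed
  define w where "w = k0 - f x0"
  have wn: "w \<noteq> 0" using zpower_nonzero[OF z0J z0] w0 by (simp add: w_def)
  define \<epsilon> where "\<epsilon> = sgn w"
  have eps: "\<epsilon> = 1 \<or> \<epsilon> = -1" "\<epsilon> * w = \<bar>w\<bar>" using wn by (auto simp: \<epsilon>_def sgn_if)
  obtain e where e: "e > 0" "ball k0 e \<subseteq> S" using k0 mem_interior by blast
  have ballint: "ball k0 e \<subseteq> interior S" using e by (intro interior_maximal) auto
  \<comment> \<open>Along \<open>v\<close> the function \<open>f\<close> increases strictly from
    \<open>x0\<close> on, even if \<open>x0\<close> is its minimum.\<close>
  obtain v :: "real^'n" where v: "v \<noteq> 0" "gradf f x0 \<bullet> v \<ge> 0"
  proof -
    obtain u :: "real^'n" where u: "u \<noteq> 0" by (metis axis_eq_0_iff zero_neq_one)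
    show ?thesis using that[of u] that[of "-u"] u by (cases "gradf f x0 \<bullet> u \<ge> 0") auto
  qed
  have "isCont (\<lambda>t. f (x0 + t *\<^sub>R v)) 0" using line_derivative[OF sm sc] DERIV_isCont by blast
  then have "\<exists>d>0. \<forall>t. dist t 0 < d \<longrightarrow> dist (f (x0 + t *\<^sub>R v)) (f (x0 + 0 *\<^sub>R v)) < \<bar>w\<bar> / 4"
    using wn unfolding continuous_at by (metis (no_types, lifting) continuous_at_eps_delta isCont_def
      continuous_at \<open>isCont (\<lambda>t. f (x0 + t *\<^sub>R v)) 0\<close> dist_real_def zero_less_abs_iff zero_less_divide_iff zero_less_numeral)
  then obtain d where d: "d > 0" "\<And>t. \<bar>t\<bar> < d \<Longrightarrow> \<bar>f (x0 + t *\<^sub>R v) - f x0\<bar> < \<bar>w\<bar> / 4"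
    by (auto simp: dist_real_def)
  \<comment> \<open>Two points beyond \<open>x0\<close> on that ray have nonzero gradients and
    different values of \<open>f\<close>, so close to \<open>f x0\<close> that
    \<open>k - f x\<close> keeps the sign of \<open>w\<close> for \<open>k\<close> near
    \<open>k0\<close>.\<close>
  define x1 x2 where "x1 = x0 + (d / 4) *\<^sub>R v" and "x2 = x0 + (d / 2) *\<^sub>R v"
  have near: "\<bar>f x1 - f x0\<bar> < \<bar>w\<bar> / 4" "\<bar>f x2 - f x0\<bar> < \<bar>w\<bar> / 4"
    unfolding x1_def x2_def using d(1) by (intro d(2); simp)+
  have m1: "gradf f x1 \<bullet> v > 0" and m2: "gradf f x2 \<bullet> v > 0"
    using gradf_strict_mono[OF sm sc v(1), of 0 "d / 4" x0] gradf_strict_mono[OF sm sc v(1), of 0 "d / 2" x0] v(2) d(1)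
    by (auto simp: x1_def x2_def)
  have g12: "gradf f x1 \<noteq> 0" "gradf f x2 \<noteq> 0" using m1 m2 by auto
  have "x2 - x1 = (d / 4) *\<^sub>R v" by (simp add: x1_def x2_def flip: scaleR_diff_left)
  then have "x1 \<noteq> x2" "gradf f x1 \<bullet> (x2 - x1) > 0" using d v m1 by auto
  then have f12: "f x1 < f x2" using f_above_tangent[OF sm sc, of x1 x2] by auto
  have Qp: "Q x1 > 0" "Q x2 > 0" using newton_inner_pos[OF sm sc] g12 by (auto simp: Q_def)
  define e' where "e' = min e (\<bar>w\<bar> / 4)"
  have e': "e' > 0" using e wn by (simp add: e'_def)
  have sameside: "\<epsilon> * (k - f x) > 0" if "\<bar>k - k0\<bar> < \<bar>w\<bar> / 4" "\<bar>f x - f x0\<bar> < \<bar>w\<bar> / 4" for k x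
    using that eps unfolding w_def by (auto simp: abs_less_iff abs_if split: if_splits)
  have "\<alpha> = 2"
  proof (rule curvature_profile_rigid[of "k0 - e'" "k0 + e'" \<alpha> "f x1" "f x2" "Q x1" "Q x2"
        "det (hessf f x1)" "det (hessf f x2)" \<epsilon>])
    show "k0 - e' < k0 + e'" using e' by simp
    show "\<alpha> \<noteq> 0" "\<alpha> \<noteq> 1" by (rule alpha)+
    show "f x1 \<noteq> f x2" using f12 by simp
    show "det (hessf f x1) > 0" "det (hessf f x2) > 0" by (rule det_hessf_pos[OF sm sc])+
    fix k assume k: "k0 - e' < k" "k < k0 + e'"
    then have "\<bar>k - k0\<bar> < e'" by (simp add: abs_less_iff)
    moreover have "e' \<le> \<bar>w\<bar> / 4" "e' \<le> e" by (simp_all add: e'_def)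
    ultimately have kw: "\<bar>k - k0\<bar> < \<bar>w\<bar> / 4" and "k \<in> ball k0 e" by (auto simp: dist_real_def abs_minus_commute)
    then have kI: "k \<in> interior S" and kS: "k \<in> S" using ballint e by auto
    show pp: "\<epsilon> * (k - f x1) > 0 \<and> \<epsilon> * (k - f x2) > 0" using sameside[OF kw] near by blast
    have sol: "\<exists>z. (x, z) \<in> level D g k \<and> z \<noteq> 0" if "\<epsilon> * (k - f x) > 0" for x
    proof -
      have "(k - f x) * zpower \<alpha> z0 > 0"
        using that eps wn unfolding w0 w_def[symmetric] by (auto simp: \<epsilon>_def sgn_if mult_neg_neg split: if_splits)
      then obtain z where "z \<in> J" "z * z0 > 0" "zpower \<alpha> z = k - f x" using zpower_solve[OF z0J z0] by metis
      then show ?thesis by (auto simp: level_iff)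
    qed
    obtain z1 where z1: "(x1, z1) \<in> level D g k" "z1 \<noteq> 0" using sol pp by blast
    obtain z2 where z2: "(x2, z2) \<in> level D g k" "z2 \<noteq> 0" using sol pp by blast
    have ab: "\<bar>k - f x\<bar> = \<epsilon> * (k - f x)" "sgn (k - f x) = \<epsilon>" if "\<epsilon> * (k - f x) > 0" for x
      using that eps(1) by (auto simp: sgn_if)
    have "curv k (x1, z1) = curv k (x2, z2)" by (rule cc[OF kI z1(1) z2(1)])
    moreover have "s \<noteq> 0" "\<epsilon> \<noteq> 0" using s(1) eps(1) by auto
    ultimately show "det (hessf f x1) * (\<epsilon> * (k - f x1)) powr (1 - 2 / \<alpha>) * (\<alpha> * (k - f x1) + (\<alpha> - 1) * Q x1)
      = det (hessf f x2) * (\<epsilon> * (k - f x2)) powr (1 - 2 / \<alpha>) * (\<alpha> * (k - f x2) + (\<alpha> - 1) * Q x2)"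
      using curv_eq[OF kS s(2)[OF kS] z1] curv_eq[OF kS s(2)[OF kS] z2] pp alpha
      by (simp add: ab)
  qed (use Qp eps in auto)
  then show False using a2 by simp
qed

end

lemma convex_sublevel: "convex_on UNIV f \<Longrightarrow> convex {x. f x \<le> c}"
  unfolding convex_def convex_on_def
proof (safe, goal_cases)
  case (1 x y u v)
  then have "f (u *\<^sub>R x + v *\<^sub>R y) \<le> u * f x + v * f y" by simp
  also have "\<dots> \<le> c" using 1 by (intro convex_bound_le)
  finally show ?case .
qed

section \<open>The levels for the exponent 2\<close>

context power_sum
begin

context
  assumes a2: "\<alpha> = 2"
begin

lemma D_UNIV: "D = UNIV" by (simp add: D J_UNIV[OF a2])

lemma level_iff_2: "(x, z) \<in> level D g k \<longleftrightarrow> z\<^sup>2 = k - f x"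
  by (simp add: level_iff J_UNIV[OF a2] zpower_2[OF a2])

lemma sqrt_level: "f x \<le> k \<Longrightarrow> (x, sqrt (k - f x)) \<in> level D g k" "f x \<le> k \<Longrightarrow> (x, - sqrt (k - f x)) \<in> level D g k"
  by (simp_all add: level_iff_2)

lemma grad_g_2: "grad g (x, z) = (gradf f x, 2 * z)"
  using grad_g[of "(x, z)"] by (simp add: D_UNIV phi1_2[OF a2])

lemma minimum_if_critical: "gradf f x = 0 \<Longrightarrow> f x \<le> f y"
  using f_above_tangent[OF sm sc, of x y] by (cases "x = y") auto

lemma exists_lower: assumes "gradf f x \<noteq> 0" shows "\<exists>y. f y < f x"
proof -
  let ?u = "- gradf f x"
  have "((\<lambda>t. f (x + t *\<^sub>R ?u)) has_real_derivative gradf f (x + 0 *\<^sub>R ?u) \<bullet> ?u) (at 0)"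
    by (rule line_derivative[OF sm sc])
  moreover have "gradf f (x + 0 *\<^sub>R ?u) \<bullet> ?u < 0" using assms by simp
  ultimately obtain d where d: "d > 0" "\<And>h. 0 < h \<Longrightarrow> h < d \<Longrightarrow> f (x + 0 *\<^sub>R ?u) > f (x + (0 + h) *\<^sub>R ?u)"
    using DERIV_neg_dec_right by blast
  show ?thesis using d(2)[of "d / 2"] d(1) by (intro exI[of _ "x + (0 + d / 2) *\<^sub>R ?u"]) simp
qed

text \<open>A critical point of \<open>g\<close> has height zero and lies over the minimum of
  \<open>f\<close>, so no level strictly above the infimum of \<open>f\<close> contains one; a level
  at a minimum value consists of it alone.\<close>

lemma regular_values_2: "regular_values D g = {k. \<exists>x. f x < k}"
proof (intro subset_antisym subsetI)
  fix k assume k: "k \<in> regular_values D g"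
  then obtain x z where p: "(x, z) \<in> level D g k" by (auto simp: regular_values_def)
  then have "z\<^sup>2 = k - f x" and n: "grad g (x, z) \<noteq> 0" using k by (auto simp: level_iff_2 regular_values_def)
  then have le: "f x \<le> k" by (metis diff_ge_0_iff_ge zero_le_power2)
  show "k \<in> {k. \<exists>x. f x < k}"
  proof (cases "f x = k")
    case True
    then have "z = 0" using \<open>z\<^sup>2 = k - f x\<close> by simp
    then have "gradf f x \<noteq> 0" using n by (auto simp: grad_g_2 zero_prod_def)
    then show ?thesis using exists_lower True by auto
  next
    case False
    then show ?thesis using le by (intro CollectI exI[of _ x]) simp
  qed
next
  fix k assume "k \<in> {k. \<exists>x. f x < k}"
  then obtain x where x: "f x < k" by auto
  have "grad g y \<noteq> 0" if "y \<in> level D g k" for y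
  proof
    assume z: "grad g y = 0"
    obtain x' z' where y: "y = (x', z')" by (cases y)
    have "gradf f x' = 0" "z' = 0" using z by (auto simp: y grad_g_2 zero_prod_def)
    then have "f x' = k" "f x' \<le> f x" using that minimum_if_critical by (auto simp: y level_iff_2)
    then show False using x by simp
  qed
  moreover have "level D g k \<noteq> {}" using sqrt_level(1)[of x k] x by auto
  ultimately show "k \<in> regular_values D g" by (simp add: regular_values_def)
qed

text \<open>Over \<open>x\<close> the level has two points, and the chord from the upper to the
  lower one runs against the gradient, which excludes the positive sign.\<close>

lemma signed_2:
  assumes "f x < k" shows "signed k (-1)"
proof -
  let ?p = "(x, sqrt (k - f x))" and ?q = "(x, - sqrt (k - f x))"
  have "grad g ?p \<bullet> (?q - ?p) = - 4 * (sqrt (k - f x) * sqrt (k - f x))"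
    by (simp add: grad_g_2 inner_prod_def)
  also have "\<dots> < 0" using assms by simp
  finally have neg: "grad g ?p \<bullet> (?q - ?p) < 0" .
  then have "grad g ?p \<noteq> 0" by auto
  then have "unit_grad g ?p \<bullet> (?q - ?p) < 0" using neg by (simp add: unit_grad_inner divide_neg_pos)
  moreover have "?p \<in> level D g k" "?q \<in> level D g k" using sqrt_level assms by auto
  ultimately have "\<not> (\<forall>p \<in> level D g k. \<forall>q \<in> level D g k. unit_grad g p \<bullet> (q - p) \<ge> 0)"
    by (metis not_less)
  then have "convex_normal D g k = (\<lambda>y. - unit_grad g y)"
    unfolding convex_normal_def by (simp only: if_False)
  then show ?thesis by (simp add: signed_def)
qed

text \<open>The level consists of two graphs over the convex sublevel set of \<open>f\<close>. They
  meet over the points where \<open>f\<close> equals \<open>k\<close>, which exist by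
  \<open>f_attains\<close>.\<close>

lemma connected_level_2:
  assumes "f x < k" shows "connected (level D g k)"
proof -
  let ?B = "{x. f x \<le> k}"
  have "connected ?B"
    using sc by (intro convex_connected convex_sublevel) (simp add: strictly_convex_fun_def)
  have cs: "continuous_on ?B (\<lambda>x. sqrt (k - f x))"
    by (intro continuous_intros f_continuous[OF sm sc])
  let ?U = "(\<lambda>x. (x, sqrt (k - f x))) ` ?B" and ?L = "(\<lambda>x. (x, - sqrt (k - f x))) ` ?B"
  have "connected ?U" "connected ?L"
    by (intro connected_continuous_image \<open>connected ?B\<close> continuous_on_Pair continuous_on_id
        continuous_on_minus cs)+
  moreover obtain x' where "f x' = k" using f_attains[OF sm sc, of x k] assms by auto
  then have "(x', 0) \<in> ?U \<inter> ?L" by (auto intro!: image_eqI[of _ _ x'])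
  then have "?U \<inter> ?L \<noteq> {}" by blast
  ultimately have "connected (?U \<union> ?L)" by (intro connected_Un)
  moreover have "level D g k = ?U \<union> ?L"
  proof (intro subset_antisym subsetI)
    fix y assume y: "y \<in> level D g k"
    obtain x z where yz: "y = (x, z)" by (cases y)
    then have z: "z\<^sup>2 = k - f x" using y by (simp add: level_iff_2)
    then have "f x \<le> k" by (metis diff_ge_0_iff_ge zero_le_power2)
    moreover have "\<bar>z\<bar> = sqrt (k - f x)" by (simp flip: z)
    then have "z = sqrt (k - f x) \<or> z = - sqrt (k - f x)" by linarith
    ultimately show "y \<in> ?U \<union> ?L" unfolding yz by blast
  qed (use sqrt_level in auto)
  ultimately show ?thesis by simp
qed

lemma strictly_convex_level_2:
  assumes x: "f x < k" shows "strictly_convex_level D g k"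
proof -
  have cn: "convex_normal D g k = (\<lambda>y. (-1) *\<^sub>R unit_grad g y)" using signed_2[OF x] by (simp add: signed_def)
  have n0: "grad g p \<noteq> 0" if "p \<in> level D g k" for p
    using x that regular_values_2 by (auto simp: regular_values_def)
  have "convex_normal D g k p \<bullet> (q - p) \<ge> 0" if "p \<in> level D g k" "q \<in> level D g k" for p q
    using g_above_tangent[OF a2, of p q] that
    by (simp add: cn unit_grad_inner level_def divide_nonpos_nonneg)
  moreover have "pos_normal_curvatures (convex_normal D g k) p" if "p \<in> level D g k" for p
  proof -
    have "p \<in> D" using that level_subset by blast
    have "pos_normal_curvatures (\<lambda>y. (-1) *\<^sub>R unit_grad g y) p"
      using Hg_pos_2[OF a2]
      by (subst pos_normal_curvatures_unit_grad[OF grad_g_has_derivative[OF \<open>p \<in> D\<close>] n0[OF that]]) auto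
    then show ?thesis by (simp add: cn)
  qed
  ultimately show ?thesis using connected_level_2[OF x] by (simp add: strictly_convex_level_def)
qed

lemma strictly_convex_range_2: "strictly_convex_range D g {k. \<exists>x. f x < k}"
proof -
  have "is_interval {k. \<exists>x. f x < k}"
    unfolding is_interval_1 by (auto intro: less_le_trans)
  moreover have "ball (f 0 + 1) 1 \<subseteq> {k. \<exists>x. f x < k}"
    by (auto simp: dist_real_def intro!: exI[of _ 0])
  then have "interior {k. \<exists>x. f x < k} \<noteq> {}"
    by (metis centre_in_ball empty_iff interior_maximal open_ball subsetD zero_less_one)
  ultimately show ?thesis
    using strictly_convex_level_2 by (auto simp: strictly_convex_range_def regular_values_2)
qed

end

text \<open>On \<open>J\<close> the power agrees with \<open>z\<^sup>2\<close> up to a constant.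
  Comparing first and second derivatives at some nonzero \<open>z\<close> gives
  \<open>\<alpha> - 1 = 1\<close>.\<close>

lemma ellipsoid_form_imp:
  assumes E: "ellipsoid_form D g C a"
  shows "\<alpha> = 2" "\<exists>T b. orthogonal_transformation T \<and> (\<forall>x. f x = C + (\<Sum>i\<in>UNIV. (a $ i)\<^sup>2 * (T (x - b) $ i)\<^sup>2))"
proof -
  obtain T b where T: "orthogonal_transformation T"
    and eq: "\<And>x z. (x, z) \<in> D \<Longrightarrow> g (x, z) = C + z\<^sup>2 + (\<Sum>i\<in>UNIV. (a $ i)\<^sup>2 * (T (x - b) $ i)\<^sup>2)"
    using E unfolding ellipsoid_form_def by blast
  have lT: "linear T" using T by (simp add: orthogonal_transformation_def)
  have zz: "zpower \<alpha> z = C - f b + z\<^sup>2" if "z \<in> J" for z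
    using eq[of b z] that by (simp add: D g_apply linear_0[OF lT])
  have p1: "\<phi>1 z = 2 * z" if z: "z \<in> J" for z
  proof -
    have "((\<lambda>z. C - f b + z\<^sup>2) has_real_derivative 2 * z) (at z)" by (auto intro!: derivative_eq_intros)
    then have "(zpower \<alpha> has_real_derivative 2 * z) (at z)"
      by (rule has_field_derivative_transform_within_open[OF _ open_J z]) (simp add: zz)
    then show ?thesis using phi_deriv[OF z] DERIV_unique by blast
  qed
  have p2: "\<phi>2 z = 2" if z: "z \<in> J" for z
  proof -
    have "((\<lambda>z. 2 * z) has_real_derivative 2) (at z)" by (auto intro!: derivative_eq_intros)
    then have "(\<phi>1 has_real_derivative 2) (at z)"
      by (rule has_field_derivative_transform_within_open[OF _ open_J z]) (simp add: p1)
    then show ?thesis using phi1_deriv[OF z] DERIV_unique by blast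
  qed
  obtain z where z: "z \<in> J" "z \<noteq> 0"
  proof (cases rule: J_cases)
    case 1 then show ?thesis using that[of 1] by simp
  next
    case 2 then show ?thesis using that[of 1] by simp
  next
    case 3 then show ?thesis using that[of "-1"] by simp
  qed
  have "\<alpha> * zpower \<alpha> z = 2 * z\<^sup>2" using p1[OF z(1)] phi1_eq[OF z] z by (simp add: field_simps power2_eq_square)
  moreover have "(\<alpha> - 1) * (\<alpha> * zpower \<alpha> z) = 2 * z\<^sup>2"
    using p2[OF z(1)] phi2_eq[OF z] z by (simp add: field_simps)
  ultimately have "(\<alpha> - 1) * (2 * z\<^sup>2) = 1 * (2 * z\<^sup>2)" by simp
  then have "\<alpha> - 1 = 1" using z(2) by simp
  then show a2: "\<alpha> = 2" by simp
  have "f x = C + (\<Sum>i\<in>UNIV. (a $ i)\<^sup>2 * (T (x - b) $ i)\<^sup>2)" for x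
    using eq[of x 0] by (simp add: D_UNIV[OF a2] g_apply zpower_2[OF a2])
  then show "\<exists>T b. orthogonal_transformation T \<and> (\<forall>x. f x = C + (\<Sum>i\<in>UNIV. (a $ i)\<^sup>2 * (T (x - b) $ i)\<^sup>2))"
    using T by blast
qed

end

context power_sum_range
begin

lemma S_eq_2: "\<alpha> = 2 \<Longrightarrow> S = {k. \<exists>x. f x < k}"
  using S_max[OF strictly_convex_range_2] S_regular regular_values_2 by blast

lemma interior_S_2: assumes "\<alpha> = 2" shows "interior S = S"
proof -
  have "S = (\<Union>x. {f x<..})" using S_eq_2[OF assms] by auto
  then have "open S" by (simp add: open_UN)
  then show ?thesis by (rule interior_open)
qed

theorem ellipsoid_if_curv_const:
  assumes cc: "\<And>k p q. k \<in> interior S \<Longrightarrow> p \<in> level D g k \<Longrightarrow> q \<in> level D g k \<Longrightarrow> curv k p = curv k q"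
  shows "\<exists>C a. ellipsoid_form D g C a"
proof -
  have a2: "\<alpha> = 2" using cc by (rule alpha_eq_2)
  have rel: "det (hessf f x1) * (2 * (k - f x1) + Q x1) = det (hessf f x2) * (2 * (k - f x2) + Q x2)"
    if k: "f x1 < k" "f x2 < k" for k x1 x2
  proof -
    have kS: "k \<in> S" "k \<in> interior S" using k S_eq_2[OF a2] interior_S_2[OF a2] by auto
    have c: "curv k (x, sqrt (k - f x)) = (- (-1)) ^ CARD('n) * 2 * (det (hessf f x) * (2 * (k - f x) + Q x))"
      if x: "f x < k" for x
      using curv_eq[OF kS(1) signed_2[OF a2 x] sqrt_level(1)[OF a2, of x k]] x
      by (simp add: a2)
    have "curv k (x1, sqrt (k - f x1)) = curv k (x2, sqrt (k - f x2))"
      using k by (intro cc kS sqrt_level(1)[OF a2]) auto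
    then show ?thesis by (simp add: c k)
  qed
  have Qdiff: "2 * f x1 - Q x1 = 2 * f x2 - Q x2" for x1 x2
  proof -
    \<comment> \<open>Both sides of \<open>rel\<close> are affine in \<open>k\<close>. Comparing
      \<open>k\<close> and \<open>k + 1\<close> gives equal slopes, so the Hessian determinants
      agree, and then the constant terms give the claim.\<close>
    define k where "k = max (f x1) (f x2) + 1"
    have k: "f x1 < k" "f x2 < k" "f x1 < k + 1" "f x2 < k + 1" by (auto simp: k_def)
    let ?D1 = "det (hessf f x1)" and ?D2 = "det (hessf f x2)"
    have "?D1 * (2 * (k + 1 - f x1) + Q x1) - ?D1 * (2 * (k - f x1) + Q x1) = 2 * ?D1"
      "?D2 * (2 * (k + 1 - f x2) + Q x2) - ?D2 * (2 * (k - f x2) + Q x2) = 2 * ?D2"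
      by (simp_all add: algebra_simps)
    then have "?D1 = ?D2" using rel[OF k(1,2)] rel[OF k(3,4)] by linarith
    then have "2 * (k - f x1) + Q x1 = 2 * (k - f x2) + Q x2"
      using rel[OF k(1,2)] det_hessf_pos[OF sm sc, of x2] by simp
    then show ?thesis by simp
  qed
  define C where "C = f 0 - Q 0 / 2"
  have "gradf f x \<bullet> newton f x = 2 * (f x - C)" for x
    using Qdiff[of x 0] by (simp add: C_def Q_def field_simps)
  then obtain b where b: "\<And>x. f x = C + ((hessf f b *v (x - b)) \<bullet> (x - b)) / 2"
    using f_quadratic[OF sm sc] by metis
  obtain V :: "real^'n \<Rightarrow> real^'n" and l where V: "orthogonal_transformation V"
    and HV: "\<And>y. hessf f b *v V y = V (\<chi> i. l i * y $ i)"
    by (rule selfadjoint_orthogonal_diagonal[of "\<lambda>x. hessf f b *v x"]) (auto simp: hessf_inner_commute[OF sm])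
  have inV: "V y \<bullet> V z = y \<bullet> z" for y z using V by (simp add: orthogonal_transformation_def)
  have quad: "(hessf f b *v V y) \<bullet> V y = (\<Sum>i\<in>UNIV. l i * (y $ i)\<^sup>2)" for y
    unfolding HV inV by (simp add: inner_vec_def power2_eq_square mult.assoc)
  have lpos: "l i > 0" for i
  proof -
    have "norm (V (axis i 1)) = 1" using inV[of "axis i 1" "axis i 1"] by (simp add: norm_eq_1 inner_axis_axis)
    then have "V (axis i 1) \<noteq> 0" by auto
    from hessf_pos[OF sm sc this, of b] have "(\<chi> j. l j * axis i 1 $ j) \<bullet> axis i 1 > 0" by (simp only: HV inV)
    then show ?thesis by (simp add: inner_axis)
  qed
  \<comment> \<open>The factor 1/2 in front of the quadratic form of \<open>f\<close> is absorbed
    here.\<close>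
  define a where "a = (\<chi> i. sqrt (l i / 2))"
  have "orthogonal_transformation (inv V)" using V by (rule orthogonal_transformation_inv)
  moreover have "g (x, z) = C + z\<^sup>2 + (\<Sum>i\<in>UNIV. (a $ i)\<^sup>2 * (inv V (x - b) $ i)\<^sup>2)" for x z
  proof -
    have "V (inv V (x - b)) = x - b"
      using orthogonal_transformation_surj[OF V] by (simp add: surj_f_inv_f)
    then have "(hessf f b *v (x - b)) \<bullet> (x - b) / 2 = (\<Sum>i\<in>UNIV. l i * (inv V (x - b) $ i)\<^sup>2) / 2"
      using quad[of "inv V (x - b)"] by simp
    also have "\<dots> = (\<Sum>i\<in>UNIV. (a $ i)\<^sup>2 * (inv V (x - b) $ i)\<^sup>2)"
      using lpos by (simp add: a_def sum_divide_distrib less_imp_le)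
    finally show ?thesis by (simp add: g_apply zpower_2[OF a2] b)
  qed
  ultimately have "ellipsoid_form D g C a"
    unfolding ellipsoid_form_def using lpos by (auto simp: a_def)
  then show ?thesis by blast
qed

end

section \<open>Ellipsoids\<close>

text \<open>Reflection in the hyperplane orthogonal to \<open>a - b\<close>.\<close>

lemma isometry_between:
  fixes a b :: "'a::real_inner"
  assumes "norm a = norm b"
  obtains R where "linear R" "\<And>x. norm (R x) = norm x" "\<And>x y. R x \<bullet> R y = x \<bullet> y" "R a = b"
proof (cases "a = b")
  case True
  show ?thesis by (rule that[of "\<lambda>x. x"]) (auto simp: True linear_id[unfolded id_def])
next
  case False
  define d where "d = a - b"
  define R where "R x = x - (2 * (x \<bullet> d) / (d \<bullet> d)) *\<^sub>R d" for x
  have d: "d \<bullet> d \<noteq> 0" using False by (simp add: d_def)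
  have ab: "a \<bullet> a = b \<bullet> b" using assms by (simp add: norm_eq_sqrt_inner)
  have "d \<bullet> d = 2 * (a \<bullet> d)" unfolding d_def using ab
    by (simp add: inner_diff_left inner_diff_right inner_commute)
  then have "R a = b" using d by (simp add: R_def) (simp add: d_def)
  moreover have "linear R"
  proof (rule linearI)
    show "R (x + y) = R x + R y" for x y
      by (simp add: R_def inner_add_left add_divide_distrib distrib_left scaleR_add_left)
    show "R (c *\<^sub>R x) = c *\<^sub>R R x" for c x
      by (simp add: R_def scaleR_diff_right mult.left_commute)
  qed
  moreover have ip: "R x \<bullet> R y = x \<bullet> y" for x y
  proof -
    define N where "N = d \<bullet> d"
    have "R x \<bullet> R y = x \<bullet> y - (2 * (y \<bullet> d) / N) * (x \<bullet> d) - (2 * (x \<bullet> d) / N) * (y \<bullet> d)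
        + (2 * (x \<bullet> d) / N) * ((2 * (y \<bullet> d) / N) * N)"
      unfolding R_def N_def[symmetric]
      by (simp add: inner_diff_left inner_diff_right inner_commute[of d x] inner_commute[of d y] N_def[symmetric])
    also have "(2 * (y \<bullet> d) / N) * N = 2 * (y \<bullet> d)" using d by (simp add: N_def)
    finally show ?thesis by simp
  qed
  moreover have "norm (R x) = norm x" for x by (simp add: norm_eq_sqrt_inner ip)
  ultimately show ?thesis using that by blast
qed

text \<open>Expresses a section area by a volume, on which a linear map acts by a constant factor.\<close>

lemma oblique_cylinder_measure:
  fixes \<nu> :: "'n::finite pt"
  assumes n: "norm \<nu> = 1" and K: "compact K" "K \<subseteq> {y. \<nu> \<bullet> (y - v) = 0}" and d: "\<nu> \<bullet> d < 0"
  shows "measure lebesgue ((\<lambda>(y, s). y + s *\<^sub>R d) ` (K \<times> {0..1}))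
    = measure lebesgue {u. v + frame \<nu> u \<in> K} * (- (\<nu> \<bullet> d))"
proof -
  have nu0: "\<nu> \<noteq> 0" and nn: "\<nu> \<bullet> \<nu> = 1" using n by (auto simp: norm_eq_1)
  note fp = frame_props[OF nu0]
  define T where "T = frame \<nu>"
  have lT: "linear T" and TT: "\<And>u w. T u \<bullet> T w = u \<bullet> w" and Tn: "\<And>u. T u \<bullet> \<nu> = 0" "\<And>u. \<nu> \<bullet> T u = 0"
    using fp by (auto simp: T_def inner_commute)
  have inj: "T u = T w \<longleftrightarrow> u = w" for u w
    using linear_isometry_inj[OF fp(1,2)] by (auto simp: T_def inj_on_def)
  define \<tau> where "\<tau> = \<nu> \<bullet> d"
  obtain ud where ud: "d = T ud + \<tau> *\<^sub>R \<nu>"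
    using frame_decomposition[OF n, of d] by (metis T_def \<tau>_def inner_commute)
  define A where "A = {u. v + T u \<in> K}"
  have KA: "y \<in> K \<Longrightarrow> \<exists>u\<in>A. y = v + T u" for y
  proof -
    assume y: "y \<in> K"
    then have "(y - v) \<bullet> \<nu> = 0" using K(2) by (auto simp: inner_commute)
    from fp(5)[OF this] obtain u where "y - v = T u" by (auto simp: T_def)
    then have "y = v + T u" by (simp add: algebra_simps)
    then show ?thesis using y by (auto simp: A_def)
  qed
  have cA: "compact A"
  proof -
    define U where "U y = (\<chi> i. (y - v) \<bullet> T (axis i 1))" for y
    have U: "U (v + T u) = u" for u by (simp add: U_def TT inner_axis vec_eq_iff)
    have "A = U ` K"
    proof (intro subset_antisym subsetI)
      fix u assume "u \<in> A"
      then show "u \<in> U ` K" by (intro image_eqI[of _ _ "v + T u"]) (simp_all add: U A_def)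
    next
      fix u assume "u \<in> U ` K"
      then obtain y where "y \<in> K" "u = U y" by blast
      then show "u \<in> A" using KA[of y] U by auto
    qed
    moreover have "continuous_on K U" unfolding U_def by (intro continuous_intros)
    ultimately show ?thesis using K(1) by (simp add: compact_continuous_image)
  qed
  define X where "X = (\<lambda>(u, s). (u + s *\<^sub>R ud, s * \<tau>)) ` (A \<times> {0..1})"
  have cX: "compact X" unfolding X_def
    by (intro compact_continuous_image compact_Times cA compact_Icc)
      (auto simp: case_prod_beta intro!: continuous_intros)
  define \<Theta> where "\<Theta> = (\<lambda>(u, t). T u + t *\<^sub>R \<nu>)"
  have l: "linear \<Theta>" unfolding \<Theta>_def
    by (rule linearI) (auto simp: linear_add[OF lT] linear_scale[OF lT] algebra_simps)
  have nT: "norm (\<Theta> x) = norm x" for x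
  proof -
    have "\<Theta> x \<bullet> \<Theta> x = x \<bullet> x"
      by (cases x) (simp add: \<Theta>_def inner_add_left inner_add_right Tn TT nn)
    then show ?thesis by (simp add: norm_eq_sqrt_inner)
  qed
  have "(\<lambda>(y, s). y + s *\<^sub>R d) ` (K \<times> {0..1}) = (+) v ` (\<Theta> ` X)"
  proof -
    have K': "K = (\<lambda>u. v + T u) ` A" using KA by (auto simp: A_def)
    have "(\<lambda>(y, s). y + s *\<^sub>R d) ` (K \<times> {0..1}) = (\<lambda>(u, s). v + T u + s *\<^sub>R d) ` (A \<times> {0..1})"
      unfolding K' by force
    also have "\<dots> = (+) v ` (\<Theta> ` X)"
      unfolding X_def image_image
      by (rule image_cong) (auto simp: \<Theta>_def ud linear_add[OF lT] linear_scale[OF lT] algebra_simps)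
    finally show ?thesis .
  qed
  then have 1: "measure lebesgue ((\<lambda>(y, s). y + s *\<^sub>R d) ` (K \<times> {0..1})) = measure lebesgue X"
    by (simp add: measure_translation measure_isometry_image[OF l nT cX])
  have tau: "\<tau> < 0" using d by (simp add: \<tau>_def)
  let ?f = "\<lambda>t. if t \<in> {\<tau>..0} then measure lebesgue A else 0"
  have sl: "measure lebesgue {u. (u, t) \<in> X} = ?f t" for t
  proof (cases "t \<in> {\<tau>..0}")
    case True
    have s01: "t / \<tau> \<in> {0..1}" using True tau by (auto simp: divide_le_eq zero_le_divide_iff)
    have "(u, t) \<in> X \<longleftrightarrow> - ((t / \<tau>) *\<^sub>R ud) + u \<in> A" for u
    proof
      assume "(u, t) \<in> X"
      then obtain w s where w: "w \<in> A" "u = w + s *\<^sub>R ud" "t = s * \<tau>" by (auto simp: X_def)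
      then have "s = t / \<tau>" using tau by simp
      then show "- ((t / \<tau>) *\<^sub>R ud) + u \<in> A" using w by simp
    next
      assume "- ((t / \<tau>) *\<^sub>R ud) + u \<in> A"
      then show "(u, t) \<in> X" unfolding X_def using s01 tau
        by (intro image_eqI[of _ _ "(- ((t / \<tau>) *\<^sub>R ud) + u, t / \<tau>)"]) auto
    qed
    then have "measure lebesgue {u. (u, t) \<in> X} = measure lebesgue A"
      by (simp only: measure_translation_vimage)
    then show ?thesis using True by simp
  next
    case False
    have "(u, t) \<notin> X" for u
    proof
      assume "(u, t) \<in> X"
      then obtain s where "0 \<le> s" "s \<le> 1" "t = s * \<tau>" by (auto simp: X_def)
      moreover from this have "s * \<tau> \<ge> 1 * \<tau>" using tau by (intro mult_right_mono_neg) auto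
      ultimately show False using False tau by (auto simp: mult_le_0_iff)
    qed
    then show ?thesis unfolding if_not_P[OF False] by simp
  qed
  have "((\<lambda>t. measure lebesgue A) has_integral (0 - \<tau>) *\<^sub>R measure lebesgue A) {\<tau>..0}"
    using has_integral_const_real[of "measure lebesgue A" \<tau> 0] tau by simp
  then have "(?f has_integral measure lebesgue A * (- \<tau>)) UNIV"
    by (simp only: has_integral_restrict_UNIV) (simp add: mult.commute)
  then have "measure lebesgue X = measure lebesgue A * (- \<tau>)"
    by (rule measure_slices[where f = ?f, OF cX sl])
  then show ?thesis using 1 by (simp add: A_def T_def \<tau>_def)
qed

lemma point_independentI:
  assumes nn: "\<And>k p h. F k p h \<ge> 0"
    and eq: "\<And>k I p q h. k \<in> S \<Longrightarrow> is_Ik D g S k I \<Longrightarrow> p \<in> level D g k \<Longrightarrow> q \<in> level D g k \<Longrightarrow>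
      k + h \<in> I \<Longrightarrow> F k p h = F k q h"
  shows "point_independent D g S F"
  unfolding point_independent_def
\<comment> \<open>The witness is the value at an arbitrarily chosen point of the level; on an empty
  level it is a default that only has to be nonnegative.\<close>
proof (intro exI[of _ "\<lambda>k h. F k (SOME q. q \<in> level D g k) h"] conjI allI ballI impI)
  fix k I p assume k: "k \<in> S" "is_Ik D g S k I" "p \<in> level D g k"
  have "(SOME q. q \<in> level D g k) \<in> level D g k" using k(3) by (rule someI)
  then show "\<forall>\<^sub>F h in at 0 within {h. k + h \<in> I}. F k p h = F k (SOME q. q \<in> level D g k) h"
    using eq[OF k] by (auto simp: eventually_at intro!: exI[of _ 1])
qed (rule nn)

section \<open>Transfer of the conditions from concentric spheres\<close>

context power_sum_range
begin

context
  fixes C :: real and a :: "real^'n"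
  assumes E: "ellipsoid_form D g C a"
begin

lemma e2: "\<alpha> = 2" by (rule ellipsoid_form_imp(1)[OF E])

lemma a_pos: "a $ i > 0" using E by (auto simp: ellipsoid_form_def)

lemma range_f: "{k. \<exists>x. f x < k} = {C<..}"
proof -
  obtain T b where T: "orthogonal_transformation T"
    and f: "\<And>x. f x = C + (\<Sum>i\<in>UNIV. (a $ i)\<^sup>2 * (T (x - b) $ i)\<^sup>2)"
    using ellipsoid_form_imp(2)[OF E] by blast
  have "f b = C" using T by (simp add: f orthogonal_transformation_def linear_0)
  moreover have "f x \<ge> C" for x by (simp add: f sum_nonneg)
  ultimately show ?thesis by (auto intro: le_less_trans)
qed

lemma S_eq: "S = {C<..}" and regular_eq: "regular_values D g = {C<..}"
  using S_eq_2[OF e2] regular_values_2[OF e2] range_f by auto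

lemma signed_S: "k \<in> S \<Longrightarrow> signed k (-1)"
  using signed_2[OF e2] S_eq_2[OF e2] by auto

lemma normal_S: "k \<in> S \<Longrightarrow> convex_normal D g k = (\<lambda>y. - unit_grad g y)"
  using signed_S by (simp add: signed_def)

lemma grad_nonzero_S: "k \<in> S \<Longrightarrow> p \<in> level D g k \<Longrightarrow> grad g p \<noteq> 0"
  using grad_g_nonzero[OF S_signed_facts] signed_S by blast

lemma lower_level_side:
  assumes "j < k" "k \<in> S" shows "level D g j \<subseteq> convex_side D g k"
proof
  fix y assume y: "y \<in> level D g j"
  show "y \<in> convex_side D g k" unfolding convex_side_def
  proof (intro CollectI ballI)
    fix p assume p: "p \<in> level D g k"
    have "grad g p \<bullet> (y - p) < 0"
      using g_above_tangent[OF e2, of p y] y p assms by (simp add: level_def)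
    then show "convex_normal D g k p \<bullet> (y - p) > 0"
      using grad_nonzero_S[OF assms(2) p] by (simp add: normal_S[OF assms(2)] unit_grad_inner divide_neg_pos)
  qed
qed

text \<open>Over the same \<open>x\<close> the larger level lies farther along the gradient, on the
  side opposite to the convex normal.\<close>

lemma upper_level_not_side:
  assumes k: "k \<in> S" and j: "k < j" shows "\<not> level D g j \<subseteq> convex_side D g k"
proof
  assume sub: "level D g j \<subseteq> convex_side D g k"
  obtain x where x: "f x < k" using k S_eq_2[OF e2] by auto
  let ?p = "(x, sqrt (k - f x))" and ?y = "(x, sqrt (j - f x))"
  have "?p \<in> level D g k" "?y \<in> level D g j" using x j by (auto intro!: sqrt_level(1)[OF e2])
  then have "?y \<in> convex_side D g k" using sub by blast
  then have "convex_normal D g k ?p \<bullet> (?y - ?p) > 0"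
    using \<open>?p \<in> level D g k\<close> unfolding convex_side_def by blast
  then have "grad g ?p \<bullet> (?y - ?p) < 0"
    using grad_nonzero_S[OF k \<open>?p \<in> level D g k\<close>] by (simp add: normal_S[OF k] unit_grad_inner divide_less_0_iff)
  moreover have "grad g ?p \<bullet> (?y - ?p) = 2 * sqrt (k - f x) * (sqrt (j - f x) - sqrt (k - f x))"
    by (simp add: grad_g_2[OF e2] inner_prod_def)
  moreover have "sqrt (j - f x) \<ge> sqrt (k - f x)" "sqrt (k - f x) \<ge> 0" using j x by auto
  then have "2 * sqrt (k - f x) * (sqrt (j - f x) - sqrt (k - f x)) \<ge> 0" by simp
  ultimately show False by linarith
qed

lemma is_Ik_iff: assumes k: "k \<in> S" shows "is_Ik D g S k I \<longleftrightarrow> I = {C<..<k}"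
proof -
  have "is_Ik D g S k {j \<in> S. -1 * (j - k) > 0}"
    using k interior_S_2[OF e2] lower_level_side[OF _ k] by (intro is_Ik_side) auto
  moreover have "{j \<in> S. -1 * (j - k) > 0} = {C<..<k}" by (auto simp: S_eq)
  ultimately have 1: "is_Ik D g S k {C<..<k}" by simp
  have "I = {C<..<k}" if "is_Ik D g S k I"
  proof -
    have r: "convex_side_range D g S k I" and max: "\<And>I'. convex_side_range D g S k I' \<Longrightarrow> I \<subseteq> I' \<Longrightarrow> I' = I"
      using that by (auto simp: is_Ik_def)
    have "I \<subseteq> {C<..<k}"
    proof
      fix j assume j: "j \<in> I"
      then have "j \<in> S" "j \<noteq> k" "level D g j \<subseteq> convex_side D g k" using r by (auto simp: convex_side_range_def)
      then have "\<not> k < j" using upper_level_not_side[OF k] by blast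
      then show "j \<in> {C<..<k}" using \<open>j \<in> S\<close> \<open>j \<noteq> k\<close> by (auto simp: S_eq)
    qed
    then show ?thesis using max[of "{C<..<k}"] 1 by (auto simp: is_Ik_def)
  qed
  with 1 show ?thesis by blast
qed

lemma sphere_coordinates:
  obtains L :: "'n pt \<Rightarrow> 'n pt" and y0 where "linear L" "inj L" "\<And>y. g y = C + (norm (L (y - y0)))\<^sup>2"
    "\<And>p w. grad g p \<bullet> w = 2 * (L (p - y0) \<bullet> L w)"
proof -
  obtain T b where T: "orthogonal_transformation T"
    and f: "\<And>x. f x = C + (\<Sum>i\<in>UNIV. (a $ i)\<^sup>2 * (T (x - b) $ i)\<^sup>2)"
    using ellipsoid_form_imp(2)[OF E] by blast
  have lT: "linear T" using T by (simp add: orthogonal_transformation_def)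
  define L where "L y = ((\<chi> i. a $ i * T (fst y) $ i), snd y)" for y :: "'n pt"
  have L: "linear L"
    by (rule linearI) (auto simp: L_def linear_add[OF lT] linear_scale[OF lT] vec_eq_iff algebra_simps)
  have "inj L"
  proof (subst linear_injective_0[OF L], intro allI impI)
    fix y assume "L y = 0"
    then have "\<forall>i. a $ i * T (fst y) $ i = 0" and s: "snd y = 0"
      by (auto simp: L_def zero_prod_def vec_eq_iff)
    then have "T (fst y) = 0" using a_pos by (auto simp: vec_eq_iff) (metis less_irrefl)
    then have "fst y = 0" using orthogonal_transformation_norm[OF T, of "fst y"] by simp
    then show "y = 0" using s by (simp add: prod_eq_iff)
  qed
  have geq: "g y = C + (norm (L (y - (b, 0))))\<^sup>2" for y
  proof -
    obtain x z where y: "y = (x, z)" by (cases y)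
    have "(norm (L (y - (b, 0))))\<^sup>2 = (\<Sum>i\<in>UNIV. (a $ i)\<^sup>2 * (T (x - b) $ i)\<^sup>2) + z\<^sup>2"
      unfolding power2_norm_eq_inner by (simp add: y L_def inner_prod_def inner_vec_def power2_eq_square mult_ac)
    then show ?thesis by (simp add: y g_apply zpower_2[OF e2] f)
  qed
  have gr: "grad g p \<bullet> w = 2 * (L (p - (b, 0)) \<bullet> L w)" for p w
  proof -
    have bL: "bounded_linear L" using L by (simp add: linear_conv_bounded_linear)
    have "((\<lambda>y. L (y - (b, 0))) has_derivative L) (at p)"
      by (rule bounded_linear.has_derivative[OF bL]) (auto intro!: derivative_eq_intros)
    then have "((\<lambda>y. C + L (y - (b, 0)) \<bullet> L (y - (b, 0))) has_derivative
        (\<lambda>h. L (p - (b, 0)) \<bullet> L h + L h \<bullet> L (p - (b, 0)))) (at p)"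
      by (auto intro!: derivative_eq_intros)
    moreover have "g = (\<lambda>y. C + L (y - (b, 0)) \<bullet> L (y - (b, 0)))"
      by (simp add: fun_eq_iff geq power2_norm_eq_inner)
    ultimately have "(g has_derivative (\<lambda>h. 2 * (L (p - (b, 0)) \<bullet> L h))) (at p)"
      by (simp add: inner_commute)
    moreover have "(g has_derivative (\<lambda>h. h \<bullet> grad g p)) (at p)"
      using g_GDERIV[of p] by (simp add: D_UNIV[OF e2] gderiv_def)
    ultimately have "(\<lambda>h. 2 * (L (p - (b, 0)) \<bullet> L h)) = (\<lambda>h. h \<bullet> grad g p)" by (rule has_derivative_unique)
    then have "2 * (L (p - (b, 0)) \<bullet> L w) = w \<bullet> grad g p" by (rule fun_cong)
    then show ?thesis by (simp add: inner_commute)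
  qed
  show ?thesis using that[OF L \<open>inj L\<close> geq gr] .
qed

text \<open>With \<open>w = L (y - y0)\<close> and \<open>e\<close> the image of \<open>p\<close>,
  the level is the sphere of squared radius \<open>R\<close>, and the two hyperplanes are
  \<open>e \<bullet> w = R\<close> and \<open>e \<bullet> w = \<rho> * R\<close>. Images for
  different \<open>p\<close> differ by an isometry. The division by \<open>norm (grad g p)\<close>
  comes from the height of the oblique cylinder over the section in the direction
  \<open>p - y0\<close>.\<close>

lemma caps_and_sections_equal:
  assumes k: "k \<in> S" and j: "C < k + h" "k + h < k"
    and p: "p \<in> level D g k" and q: "q \<in> level D g k"
  shows "cap_volume D g k p h = cap_volume D g k q h"
    "section_area D g k p h / norm (grad g p) = section_area D g k q h / norm (grad g q)"
proof -
  obtain L :: "'n pt \<Rightarrow> 'n pt" and y0 where L: "linear L" "inj L"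
    and geq: "\<And>y. g y = C + (norm (L (y - y0)))\<^sup>2"
    and gr: "\<And>p w. grad g p \<bullet> w = 2 * (L (p - y0) \<bullet> L w)"
    by (rule sphere_coordinates) blast
  have bijL: "bij L" and lLi: "linear (inv L)" using linear_inj_surj_inverse[OF L] by auto
  have Li: "L (inv L w) = w" "inv L (L y) = y" for w y
    using bijL by (auto simp: bij_is_surj surj_f_inv_f bij_is_inj)
  have injLi: "inj (inv L)" using bijL by (simp add: bij_imp_bij_inv bij_is_inj)
  obtain c where c: "c > 0" "\<And>X. compact X \<Longrightarrow> measure lebesgue (inv L ` X) = c * measure lebesgue X"
    using linear_image_scales_measure[OF lLi injLi] by metis
  define R where "R = k - C"
  \<comment> \<open>The ratio of the radii of the inner and the outer sphere.\<close>
  define \<rho> where "\<rho> = sqrt ((k + h - C) / R)"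
  have R: "R > 0" using k by (simp add: S_eq R_def)
  have kh: "k + h \<in> S" using j by (simp add: S_eq)
  have lam: "\<rho> > 0" "\<rho>\<^sup>2 * R = k + h - C" using R j by (auto simp: \<rho>_def)
  have lam1: "\<rho> < 1" unfolding \<rho>_def using R j by (simp add: R_def)
  have lev: "y \<in> level D g j \<longleftrightarrow> (norm (L (y - y0)))\<^sup>2 = j - C" for y j
    by (auto simp: level_def D_UNIV[OF e2] geq)
  define H where "H e = {w. (norm w)\<^sup>2 = R \<and> e \<bullet> w \<ge> \<rho> * R}" for e :: "'n pt"
  define H0 where "H0 e = {w. (norm w)\<^sup>2 = R \<and> e \<bullet> w = \<rho> * R}" for e :: "'n pt"
  have sphere: "{w. (norm w)\<^sup>2 = R} = sphere (0::'n pt) (sqrt R)"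
    using R by (auto simp: real_sqrt_unique)
  have cH: "compact (H e)" "compact (H0 e)" for e
  proof -
    have "H e = sphere 0 (sqrt R) \<inter> {w. e \<bullet> w \<ge> \<rho> * R}" "H0 e = sphere 0 (sqrt R) \<inter> {w. e \<bullet> w = \<rho> * R}"
      by (auto simp: H_def H0_def sphere[symmetric])
    then show "compact (H e)" "compact (H0 e)"
      by (auto intro!: compact_Int_closed closed_halfspace_ge closed_hyperplane)
  qed
  \<comment> \<open>The image of the oblique cylinder over the section with axis
    \<open>p - y0\<close>.\<close>
  define Z where "Z e = (\<lambda>(w, s). w + s *\<^sub>R e) ` ((convex hull H0 e) \<times> {0..1})" for e :: "'n pt"
  have cZ: "compact (Z e)" for e unfolding Z_def
    by (intro compact_continuous_image compact_Times compact_convex_hull cH compact_Icc)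
      (auto simp: case_prod_beta intro!: continuous_intros)
  have main: "cap_volume D g k p h = c * measure lebesgue (convex hull H (L (p - y0))) \<and>
      section_area D g k p h / norm (grad g p) = c * measure lebesgue (Z (L (p - y0))) / (2 * R) \<and>
      norm (L (p - y0)) = sqrt R"
    if p: "p \<in> level D g k" for p
  proof -
    define e where "e = L (p - y0)"
    have eR: "(norm e)\<^sup>2 = R" using p by (simp add: lev e_def R_def)
    then have ee: "e \<bullet> e = R" by (simp add: power2_norm_eq_inner)
    have gp: "grad g p \<noteq> 0" by (rule grad_nonzero_S[OF k p])
    define \<nu> where "\<nu> = convex_normal D g k p"
    have nu: "\<nu> = - unit_grad g p" by (simp add: \<nu>_def normal_S[OF k])
    have nn: "norm \<nu> = 1" using norm_unit_grad[OF gp] by (simp add: nu)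
    have nuw: "\<nu> \<bullet> w = - 2 * (e \<bullet> L w) / norm (grad g p)" for w
      by (simp add: nu unit_grad_inner gr e_def)
    define v where "v = parallel_point D g k p h"
    have "v \<in> level D g (k + h) \<and> convex_normal D g (k + h) v = convex_normal D g k p"
      unfolding v_def parallel_point_def
    proof (rule someI)
      let ?v = "y0 + \<rho> *\<^sub>R (p - y0)"
      have "L (?v - y0) = \<rho> *\<^sub>R e" by (simp add: e_def linear_scale[OF L(1)])
      then have "?v \<in> level D g (k + h)" using eR lam by (simp add: lev power_mult_distrib)
      moreover have "grad g ?v = \<rho> *\<^sub>R grad g p"
      proof -
        have "(grad g ?v - \<rho> *\<^sub>R grad g p) \<bullet> w = 0" for w
          by (simp add: inner_diff_left gr linear_scale[OF L(1)])
        then show ?thesis by (metis eq_iff_diff_eq_0 inner_eq_zero_iff)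
      qed
      then have "unit_grad g ?v = unit_grad g p" using lam by (simp add: unit_grad_def)
      ultimately show "?v \<in> level D g (k + h) \<and> convex_normal D g (k + h) ?v = convex_normal D g k p"
        by (simp add: normal_S[OF k] normal_S[OF kh])
    qed
    then have vl: "v \<in> level D g (k + h)" and vu: "unit_grad g v = unit_grad g p"
      by (simp_all add: normal_S[OF k] normal_S[OF kh])
    have gv: "grad g v \<noteq> 0" by (rule grad_nonzero_S[OF kh vl])
    \<comment> \<open>Equal unit normals only make the gradients proportional. The radius of the
      inner sphere identifies \<mu> with \<rho>, so the image of the chosen point is
      \<open>\<rho> *\<^sub>R e\<close>.\<close>
    define \<mu> where "\<mu> = norm (grad g v) / norm (grad g p)"
    have mu: "\<mu> > 0" using gv gp by (simp add: \<mu>_def)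
    have "grad g v = norm (grad g v) *\<^sub>R unit_grad g p" unfolding vu[symmetric] using gv by (simp add: unit_grad_def)
    then have gvp: "grad g v = \<mu> *\<^sub>R grad g p" by (simp add: unit_grad_def \<mu>_def divide_inverse)
    have Lv: "L (v - y0) = \<mu> *\<^sub>R e"
    proof -
      have "(L (v - y0) - \<mu> *\<^sub>R e) \<bullet> L w = 0" for w
        using gr[of v w] gr[of p w] by (simp add: gvp e_def inner_diff_left)
      then have "(L (v - y0) - \<mu> *\<^sub>R e) \<bullet> w = 0" for w using Li(1)[of w] by metis
      then show ?thesis by (metis eq_iff_diff_eq_0 inner_eq_zero_iff)
    qed
    have "\<mu>\<^sup>2 * R = \<rho>\<^sup>2 * R" using vl eR lam by (simp add: lev Lv power_mult_distrib)
    then have "\<mu> = \<rho>" using R mu lam(1) by (simp add: power2_eq_iff_nonneg)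
    then have Lv': "L (v - y0) = \<rho> *\<^sub>R e" using Lv by simp
    have elv: "e \<bullet> L (y - v) = e \<bullet> L (y - y0) - \<rho> * R" for y
    proof -
      have "y - v = (y - y0) - (v - y0)" by simp
      then have "L (y - v) = L (y - y0) - L (v - y0)" by (metis linear_diff[OF L(1)])
      then show ?thesis by (simp add: Lv' inner_diff_right ee)
    qed
    have elp: "e \<bullet> L (y - p) = e \<bullet> L (y - y0) - R" for y
    proof -
      have "y - p = (y - y0) - (p - y0)" by simp
      then have "L (y - p) = L (y - y0) - e" unfolding e_def by (metis linear_diff[OF L(1)])
      then show ?thesis by (simp add: inner_diff_right ee)
    qed
    have img: "{y. L (y - y0) \<in> X} = (+) y0 ` (inv L ` X)" for X
    proof (intro subset_antisym subsetI)
      fix y assume "y \<in> {y. L (y - y0) \<in> X}"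
      then show "y \<in> (+) y0 ` (inv L ` X)"
        using Li(2)[of "y - y0"] by (auto simp: image_image intro!: image_eqI[of _ _ "L (y - y0)"])
    qed (auto simp: Li)
    have hull: "convex hull {y. L (y - y0) \<in> X} = (+) y0 ` (inv L ` (convex hull X))" for X
      unfolding img by (simp only: convex_hull_translation convex_hull_linear_image[OF lLi])
    have cap: "level D g k \<inter> {y. \<nu> \<bullet> (y - p) \<ge> 0 \<and> \<nu> \<bullet> (y - v) \<le> 0} = {y. L (y - y0) \<in> H e}"
    proof -
      have CS: "e \<bullet> w \<le> R" if "(norm w)\<^sup>2 = R" for w
      proof -
        have "norm w = sqrt R" "norm e = sqrt R" using that eR by (auto simp: real_sqrt_unique)
        then show ?thesis using norm_cauchy_schwarz[of e w] R by simp
      qed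
      have "y \<in> level D g k \<inter> {y. \<nu> \<bullet> (y - p) \<ge> 0 \<and> \<nu> \<bullet> (y - v) \<le> 0} \<longleftrightarrow> L (y - y0) \<in> H e" for y
        using gp CS[of "L (y - y0)"]
        by (auto simp: lev H_def R_def[symmetric] nuw elv elp zero_le_divide_iff divide_le_0_iff)
      then show ?thesis by blast
    qed
    have "cap_volume D g k p h = measure lebesgue ((+) y0 ` (inv L ` (convex hull H e)))"
      by (simp add: cap_volume_def Let_def \<nu>_def[symmetric] v_def[symmetric] cap hull)
    then have 1: "cap_volume D g k p h = c * measure lebesgue (convex hull H e)"
      by (simp add: measure_translation c(2) compact_convex_hull cH)
    have sec: "level D g k \<inter> {y. \<nu> \<bullet> (y - v) = 0} = {y. L (y - y0) \<in> H0 e}"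
      using gp by (auto simp: lev H0_def R_def nuw elv)
    define K where "K = convex hull {y. L (y - y0) \<in> H0 e}"
    have K: "K = (+) y0 ` (inv L ` (convex hull H0 e))" unfolding K_def by (rule hull)
    have "compact (inv L ` (convex hull H0 e))"
      using lLi cH by (intro compact_continuous_image linear_continuous_on compact_convex_hull)
        (auto simp: linear_conv_bounded_linear)
    then have cK: "compact K" unfolding K by (rule compact_translation)
    have Kplane: "K \<subseteq> {y. \<nu> \<bullet> (y - v) = 0}"
      unfolding K_def sec[symmetric]
    proof (rule hull_minimal)
      have "{y. \<nu> \<bullet> (y - v) = 0} = {y. \<nu> \<bullet> y = \<nu> \<bullet> v}" by (auto simp: inner_diff_right)
      then show "convex {y. \<nu> \<bullet> (y - v) = 0}" by (simp add: convex_hyperplane)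
    qed auto
    have nud: "\<nu> \<bullet> (p - y0) = - (2 * R) / norm (grad g p)" by (simp add: nuw e_def[symmetric] ee)
    then have neg: "\<nu> \<bullet> (p - y0) < 0" using R gp by (simp add: divide_neg_pos)
    have "section_area D g k p h = measure lebesgue {u. v + frame \<nu> u \<in> K}"
      by (simp add: section_area_def Let_def \<nu>_def[symmetric] v_def[symmetric] sec K_def)
    then have "section_area D g k p h * (2 * R / norm (grad g p))
        = measure lebesgue ((\<lambda>(y, s). y + s *\<^sub>R (p - y0)) ` (K \<times> {0..1}))"
      unfolding oblique_cylinder_measure[OF nn cK Kplane neg] nud by simp
    also have "(\<lambda>(y, s). y + s *\<^sub>R (p - y0)) ` (K \<times> {0..1}) = (+) y0 ` (inv L ` Z e)"
    proof -
      have "p - y0 = inv L e" by (simp add: e_def Li)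
      then have "(\<lambda>(y, s). y + s *\<^sub>R (p - y0)) ` (K \<times> {0..1})
          = (\<lambda>(w, s). y0 + inv L (w + s *\<^sub>R e)) ` ((convex hull H0 e) \<times> {0..1})"
        unfolding K by (force simp: linear_add[OF lLi] linear_scale[OF lLi] add.assoc)
      also have "\<dots> = (+) y0 ` (inv L ` Z e)" unfolding Z_def image_image by (simp add: case_prod_beta)
      finally show ?thesis .
    qed
    finally have "section_area D g k p h * (2 * R / norm (grad g p)) = c * measure lebesgue (Z e)"
      by (simp add: measure_translation c(2) cZ)
    then have 2: "section_area D g k p h / norm (grad g p) = c * measure lebesgue (Z e) / (2 * R)"
      using R by (simp add: field_simps)
    have "norm e = sqrt R" using eR by (auto simp: real_sqrt_unique)
    then show ?thesis using 1 2 by (simp add: e_def)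
  qed
  have "norm (L (p - y0)) = norm (L (q - y0))" using main[OF p] main[OF q] by simp
  then obtain O' where O': "linear O'" "\<And>x. norm (O' x) = norm x" "\<And>x y. O' x \<bullet> O' y = x \<bullet> y"
    "O' (L (p - y0)) = L (q - y0)"
    by (rule isometry_between) blast
  have bO: "bij O'" using linear_inj_surj_inverse[OF O'(1) linear_isometry_inj[OF O'(1,2)]] by simp
  let ?e = "L (p - y0)" and ?e' = "L (q - y0)"
  have HO: "H ?e' = O' ` H ?e" "H0 ?e' = O' ` H0 ?e"
  proof -
    have *: "{w. P w} = O' ` {w. P (O' w)}" for P
    proof (intro subset_antisym subsetI)
      fix w assume "w \<in> {w. P w}"
      moreover obtain x where "w = O' x" using bO by (rule bij_pointE) blast
      ultimately show "w \<in> O' ` {w. P (O' w)}" by auto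
    qed auto
    show "H ?e' = O' ` H ?e" "H0 ?e' = O' ` H0 ?e"
      unfolding H_def H0_def O'(4)[symmetric] by (subst *, simp add: O'(2,3))+
  qed
  have "measure lebesgue (convex hull H ?e') = measure lebesgue (convex hull H ?e)"
    unfolding HO by (simp only: convex_hull_linear_image[OF O'(1), symmetric]
        measure_isometry_image[OF O'(1,2) compact_convex_hull[OF cH(1)]])
  then show "cap_volume D g k p h = cap_volume D g k q h" using main[OF p] main[OF q] by simp
  have "(\<lambda>(w, s). w + s *\<^sub>R O' x) ` ((O' ` K) \<times> {0..1}) = O' ` ((\<lambda>(w, s). w + s *\<^sub>R x) ` (K \<times> {0..1}))" for K x
    by (force simp: linear_add[OF O'(1)] linear_scale[OF O'(1)])
  from this[of ?e "convex hull H0 ?e"] have "Z ?e' = O' ` Z ?e"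
    unfolding Z_def HO O'(4) convex_hull_linear_image[OF O'(1), symmetric] .
  then have "measure lebesgue (Z ?e') = measure lebesgue (Z ?e)"
    by (simp add: measure_isometry_image[OF O'(1,2) cZ])
  then show "section_area D g k p h / norm (grad g p) = section_area D g k q h / norm (grad g q)"
    using main[OF p] main[OF q] by simp
qed

lemma ellipsoid_condV: "condV D g S"
  unfolding condV_def
proof (rule point_independentI)
  show "cap_volume D g k p h \<ge> 0" for k p h by (simp add: cap_volume_def Let_def)
  fix k I p q h assume k: "k \<in> S" "is_Ik D g S k I" "p \<in> level D g k" "q \<in> level D g k" "k + h \<in> I"
  then have "k + h \<in> {C<..<k}" using is_Ik_iff by blast
  then show "cap_volume D g k p h = cap_volume D g k q h"
    by (intro caps_and_sections_equal(1) k) auto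
qed

lemma ellipsoid_condA: "condA D g S"
  unfolding condA_def
proof (rule point_independentI)
  show "section_area D g k p h / norm (grad g p) \<ge> 0" for k p h by (simp add: section_area_def Let_def)
  fix k I p q h assume k: "k \<in> S" "is_Ik D g S k I" "p \<in> level D g k" "q \<in> level D g k" "k + h \<in> I"
  then have "k + h \<in> {C<..<k}" using is_Ik_iff by blast
  then show "section_area D g k p h / norm (grad g p) = section_area D g k q h / norm (grad g q)"
    by (intro caps_and_sections_equal(2) k) auto
qed

text \<open>The curvature is not computed; the claim follows from \<open>ellipsoid_condV\<close>
  through the asymptotics, as every \<open>k\<close> in \<open>S\<close> is interior.\<close>

lemma ellipsoid_condK: "condK D g S"
  unfolding condK_def
proof (intro exI[of _ "\<lambda>k. curv k (SOME q. q \<in> level D g k)"] ballI)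
  fix k p assume k: "k \<in> S" and p: "p \<in> level D g k"
  have q: "(SOME q. q \<in> level D g k) \<in> level D g k" using p by (rule someI)
  have "curv k p = curv k (SOME q. q \<in> level D g k)"
    using curv_const_if_cond[OF _ _ p q] ellipsoid_condV k interior_S_2[OF e2] by simp
  then show "gauss_kronecker (convex_normal D g k) p * norm (grad g p) ^ (CARD('n) + 2)
      = curv k (SOME q. q \<in> level D g k)" by (simp add: curv_def)
qed

end

theorem equivalences:
  "(condV D g S \<longleftrightarrow> condA D g S) \<and> (condA D g S \<longleftrightarrow> condK D g S) \<and>
   (condK D g S \<longleftrightarrow> (\<exists>C a. ellipsoid_form D g C a)) \<and>
   (\<forall>C a. ellipsoid_form D g C a \<longrightarrow> regular_values D g = {C<..} \<and> S = {C<..} \<and>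
      (\<forall>k \<in> S. \<forall>I. is_Ik D g S k I \<longleftrightarrow> I = {C<..<k}))"
proof -
  have "\<exists>C a. ellipsoid_form D g C a" if "condV D g S \<or> condA D g S \<or> condK D g S"
  proof (rule ellipsoid_if_curv_const)
    fix k p q assume k: "k \<in> interior S" and pq: "p \<in> level D g k" "q \<in> level D g k"
    have "k \<in> S" using k interior_subset by blast
    then show "curv k p = curv k q"
      using that curv_const_if_cond[OF _ k pq] curv_const_if_condK[OF _ _ pq] by blast
  qed
  moreover have "condV D g S \<and> condA D g S \<and> condK D g S" if "\<exists>C a. ellipsoid_form D g C a"
    using that ellipsoid_condV ellipsoid_condA ellipsoid_condK by blast
  moreover have "regular_values D g = {C<..} \<and> S = {C<..} \<and>
      (\<forall>k \<in> S. \<forall>I. is_Ik D g S k I \<longleftrightarrow> I = {C<..<k})" if "ellipsoid_form D g C a" for C a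
    using regular_eq[OF that] S_eq[OF that] is_Ik_iff[OF that] by blast
  ultimately show ?thesis by blast
qed

end

theorem theorem3:
  fixes f :: "real^'n::finite \<Rightarrow> real" and \<alpha> :: real
    and J :: "real set" and D :: "'n pt set" and g :: "'n pt \<Rightarrow> real" and S :: "real set"
  assumes "smooth f"
    and "\<forall>x. f x \<ge> 0"
    and "strictly_convex_fun f"
    and "\<alpha> \<noteq> 0" and "\<alpha> \<noteq> 1"
    and "J \<in> components (power_domain \<alpha>)"
    and "D = UNIV \<times> J"
    and "g = g_fun \<alpha> f"
    and "is_Sg D g S"
  shows "(condV D g S \<longleftrightarrow> condA D g S) \<and>
         (condA D g S \<longleftrightarrow> condK D g S) \<and>
         (condK D g S \<longleftrightarrow> (\<exists>C a. ellipsoid_form D g C a)) \<and>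
         (\<forall>C a. ellipsoid_form D g C a \<longrightarrow>
            regular_values D g = {C<..} \<and> S = {C<..} \<and>
            (\<forall>k \<in> S. \<forall>I. is_Ik D g S k I \<longleftrightarrow> I = {C<..<k}))"
proof -
  interpret power_sum_range f \<alpha> J D g S
    by unfold_locales (use assms in auto)
  show ?thesis by (rule equivalences)
qed

end
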